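(* Let $k$ be a field and let $\Gamma$ be a finite simplicial graph whose flag complex is acyclic over $k$. Then there is an isomorphism of graded $k$-algebras $$H^\bullet(B_\Gamma,k)\simeq H^\bullet(G_\Gamma,k)/(\chi_\Gamma),$$ where $(\chi_\Gamma)$ denotes the ideal of $H^\bullet(G_\Gamma,k)$ generated by the class of the $1$-cocycle $\chi_\Gamma:G_\Gamma\to k$.
   Context: For a simplicial graph $\Gamma=(V,E)$, the right-angled Artin group is $G_\Gamma=\langle v\in V\mid vw=wv \text{ for } \{v,w\}\in E\rangle$. The Bestvina-Brady group $B_\Gamma$ is the kernel of the length character $G_\Gamma\to\mathbb Z$ sending every $v\in V$ to $1$. Here $\chi_\Gamma:G_\Gamma\to k$ also denotes the homomorphism to the additive group of $k$ sending every vertex to $1$, viewed as an element of $H^1(G_\Gamma,k)=\mathrm{Hom}(G_\Gamma,k)$. The flag complex of $\Gamma$ is the simplicial complex on $V$ whose simplices are the nonempty finite sets of pairwise adjacent vertices. It is acyclic over $k$ if all its reduced simplicial homology groups with coefficients in $k$ vanish. Cohomology is with trivial coefficients, with the cup product. *)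

theory Defs
  imports
    "HOL-Library.Ramsey"
    "HOL-Algebra.QuotRing"
    "HOL-Algebra.Module"
    "HOL-Algebra.Elementary_Groups"
begin

section \<open>Group presentations\<close>

text \<open>
  A letter \<open>(s, True)\<close> stands for the generator \<open>s\<close> and \<open>(s, False)\<close> for its formal inverse.
  The group \<open>\<langle>S | R\<rangle>\<close> is the set of words over these letters modulo the congruence generated by
  \<open>s s\<inverse> = 1 = s\<inverse> s\<close> and by \<open>l = r\<close> for \<open>(l, r) \<in> R\<close>.
\<close>

type_synonym 'a word = "('a \<times> bool) list"

definition words :: "'a set \<Rightarrow> 'a word set" where
  "words S = lists (S \<times> UNIV)"

inductive_set word_cong :: "'a set \<Rightarrow> ('a word \<times> 'a word) set \<Rightarrow> ('a word \<times> 'a word) set"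
  for S R where
  refl: "w \<in> words S \<Longrightarrow> (w, w) \<in> word_cong S R"
| sym: "(u, w) \<in> word_cong S R \<Longrightarrow> (w, u) \<in> word_cong S R"
| trans: "(u, v) \<in> word_cong S R \<Longrightarrow> (v, w) \<in> word_cong S R \<Longrightarrow> (u, w) \<in> word_cong S R"
| cancel: "u \<in> words S \<Longrightarrow> w \<in> words S \<Longrightarrow> s \<in> S \<Longrightarrow>
    (u @ [(s, b), (s, \<not> b)] @ w, u @ w) \<in> word_cong S R"
| relator: "u \<in> words S \<Longrightarrow> w \<in> words S \<Longrightarrow> (l, r) \<in> R \<Longrightarrow> l \<in> words S \<Longrightarrow> r \<in> words S \<Longrightarrow>
    (u @ l @ w, u @ r @ w) \<in> word_cong S R"

definition presented_group :: "'a set \<Rightarrow> ('a word \<times> 'a word) set \<Rightarrow> 'a word set monoid" where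
  "presented_group S R =
    \<lparr>carrier = words S // word_cong S R,
     mult = (\<lambda>X Y. \<Union>u\<in>X. \<Union>v\<in>Y. word_cong S R `` {u @ v}),
     one = word_cong S R `` {[]}\<rparr>"


section \<open>Right-angled Artin groups and Bestvina-Brady groups\<close>

definition simplicial_graph :: "'a set \<Rightarrow> 'a set set \<Rightarrow> bool" where
  "simplicial_graph V E \<longleftrightarrow> E \<subseteq> [V]\<^bsup>2\<^esup>"

definition commutation_relators :: "'a set set \<Rightarrow> ('a word \<times> 'a word) set" where
  "commutation_relators E =
    {([(v, True), (w, True)], [(w, True), (v, True)]) | v w. {v, w} \<in> E}"

definition raag :: "'a set \<Rightarrow> 'a set set \<Rightarrow> 'a word set monoid" where
  "raag V E = presented_group V (commutation_relators E)"

definition exponent_sum :: "'a word \<Rightarrow> int" where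
  "exponent_sum u = (\<Sum>(s, b)\<leftarrow>u. if b then 1 else - 1)"

text \<open>
  The homomorphism to \<open>\<int>\<close> sending every vertex to \<open>1\<close>. It is well defined because congruent words
  have the same exponent sum; see \<open>length_char_hom\<close> and \<open>length_char_vertex\<close> below.
\<close>

definition length_char :: "'a word set \<Rightarrow> int" where
  "length_char X = the_elem (exponent_sum ` X)"

definition bestvina_brady :: "'a set \<Rightarrow> 'a set set \<Rightarrow> 'a word set monoid" where
  "bestvina_brady V E = (raag V E)\<lparr>carrier := kernel (raag V E) integer_group length_char\<rparr>"


section \<open>Reduced simplicial homology\<close>

definition flag_complex :: "'a set \<Rightarrow> 'a set set \<Rightarrow> 'a set set" where
  "flag_complex V E = {s. s \<noteq> {} \<and> finite s \<and> s \<subseteq> V \<and> clique s E}"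

text \<open>
  Oriented chains: a chain is a finitely supported function on the vertex orderings of the simplices
  that changes sign when two neighbouring vertices are exchanged. Chains are indexed by the number
  \<open>m\<close> of vertices, so \<open>m\<close> is the dimension plus one; \<open>m = 0\<close> is the augmentation term in
  dimension \<open>-1\<close>, spanned by the empty ordering.

  If \<open>c\<close> is the elementary chain of \<open>[v\<^sub>0, \<dots>, v\<^sub>n]\<close>, then
  \<open>c (v\<^sub>i # [v\<^sub>0, \<dots>, v\<^sub>i\<^sub>-\<^sub>1, v\<^sub>i\<^sub>+\<^sub>1, \<dots>, v\<^sub>n]) = (-1)\<^sup>i\<close>, so \<open>simplicial_bd\<close> is the usual
  alternating sum of faces.
  The arguments \<open>k :: 'k itself\<close>, here and below, only carry the coefficient field.
\<close>

definition oriented_chains :: "'k::field itself \<Rightarrow> 'a set set \<Rightarrow> nat \<Rightarrow> ('a list \<Rightarrow> 'k) set" where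
  "oriented_chains k K m =
    {c. finite {xs. c xs \<noteq> 0} \<and>
        (\<forall>xs. c xs \<noteq> 0 \<longrightarrow> length xs = m \<and> distinct xs \<and> set xs \<in> insert {} K) \<and>
        (\<forall>xs x y ys. c (xs @ [x, y] @ ys) = - c (xs @ [y, x] @ ys))}"

definition simplicial_bd :: "('a list \<Rightarrow> 'k::field) \<Rightarrow> 'a list \<Rightarrow> 'k" where
  "simplicial_bd c xs = (\<Sum>v | c (v # xs) \<noteq> 0. c (v # xs))"

definition reduced_cycle_group ::
  "'k::field itself \<Rightarrow> 'a set set \<Rightarrow> nat \<Rightarrow> ('a list \<Rightarrow> 'k) monoid" where
  "reduced_cycle_group k K m =
    \<lparr>carrier = {c \<in> oriented_chains k K m. simplicial_bd c = (\<lambda>_. 0)},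
     mult = (\<lambda>c d xs. c xs + d xs),
     one = (\<lambda>_. 0)\<rparr>"

definition reduced_homology ::
  "'k::field itself \<Rightarrow> 'a set set \<Rightarrow> nat \<Rightarrow> ('a list \<Rightarrow> 'k) set monoid" where
  "reduced_homology k K m =
    reduced_cycle_group k K m Mod (simplicial_bd ` oriented_chains k K (Suc m))"

definition acyclic_over :: "'k::field itself \<Rightarrow> 'a set set \<Rightarrow> bool" where
  "acyclic_over k K \<longleftrightarrow> (\<forall>m. trivial_group (reduced_homology k K m))"


section \<open>Graded algebras\<close>

text \<open>
  \<open>hcomp A n\<close> is the homogeneous component of degree \<open>n\<close> of \<open>A\<close>.
\<close>

record ('k, 'b) graded_algebra = "('k, 'b) module" +
  hcomp :: "nat \<Rightarrow> 'b set"

definition graded_quotient ::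
  "('k, 'b, 'm) graded_algebra_scheme \<Rightarrow> 'b set \<Rightarrow> ('k, 'b set) graded_algebra" where
  "graded_quotient A I =
    \<lparr>carrier = carrier (A Quot I),
     mult = mult (A Quot I),
     one = one (A Quot I),
     zero = zero (A Quot I),
     add = add (A Quot I),
     smult = (\<lambda>c X. \<Union>x\<in>X. I +>\<^bsub>A\<^esub> (c \<odot>\<^bsub>A\<^esub> x)),
     hcomp = (\<lambda>n. (\<lambda>x. I +>\<^bsub>A\<^esub> x) ` hcomp A n)\<rparr>"

definition graded_algebra_iso ::
  "('k, 'b, 'm) graded_algebra_scheme \<Rightarrow> ('k, 'c, 'n) graded_algebra_scheme \<Rightarrow> ('b \<Rightarrow> 'c) set" where
  "graded_algebra_iso A B =
    {\<phi> \<in> ring_iso A B.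
      (\<forall>c. \<forall>x\<in>carrier A. \<phi> (c \<odot>\<^bsub>A\<^esub> x) = c \<odot>\<^bsub>B\<^esub> \<phi> x) \<and>
      (\<forall>n. \<phi> ` hcomp A n = hcomp B n)}"


section \<open>Group cohomology with trivial coefficients\<close>

text \<open>
  The direct sum of all groups of inhomogeneous (bar) cochains \<open>G\<^sup>n \<rightarrow> k\<close>: the restriction of
  \<open>f\<close> to lists of length \<open>n\<close> is its component of degree \<open>n\<close>.
\<close>

definition cochains :: "'k::field itself \<Rightarrow> ('g, 'm) monoid_scheme \<Rightarrow> ('g list \<Rightarrow> 'k) set" where
  "cochains k G =
    {f. (\<forall>xs. f xs \<noteq> 0 \<longrightarrow> xs \<in> lists (carrier G)) \<and> (\<exists>N. \<forall>xs. f xs \<noteq> 0 \<longrightarrow> length xs \<le> N)}"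

definition coboundary :: "('g, 'm) monoid_scheme \<Rightarrow> ('g list \<Rightarrow> 'k::field) \<Rightarrow> 'g list \<Rightarrow> 'k" where
  "coboundary G f xs =
    (if xs = [] \<or> xs \<notin> lists (carrier G) then 0
     else f (tl xs)
       + (\<Sum>i<length xs - 1.
            (- 1) ^ Suc i * f (take i xs @ [xs ! i \<otimes>\<^bsub>G\<^esub> xs ! Suc i] @ drop (i + 2) xs))
       + (- 1) ^ length xs * f (butlast xs))"

definition cup :: "('g list \<Rightarrow> 'k::field) \<Rightarrow> ('g list \<Rightarrow> 'k) \<Rightarrow> 'g list \<Rightarrow> 'k" where
  "cup f g xs = (\<Sum>i\<le>length xs. f (take i xs) * g (drop i xs))"

definition cocycle_algebra ::
  "'k::field itself \<Rightarrow> ('g, 'm) monoid_scheme \<Rightarrow> ('k, 'g list \<Rightarrow> 'k) graded_algebra" where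
  "cocycle_algebra k G =
    \<lparr>carrier = {f \<in> cochains k G. coboundary G f = (\<lambda>_. 0)},
     mult = cup,
     one = (\<lambda>xs. if xs = [] then 1 else 0),
     zero = (\<lambda>_. 0),
     add = (\<lambda>f g xs. f xs + g xs),
     smult = (\<lambda>c f xs. c * f xs),
     hcomp = (\<lambda>n. {f \<in> cochains k G. coboundary G f = (\<lambda>_. 0) \<and> (\<forall>xs. f xs \<noteq> 0 \<longrightarrow> length xs = n)})\<rparr>"

definition coboundaries :: "'k::field itself \<Rightarrow> ('g, 'm) monoid_scheme \<Rightarrow> ('g list \<Rightarrow> 'k) set" where
  "coboundaries k G = coboundary G ` cochains k G"

text \<open>
  \<open>H\<^sup>\<bullet>(G, k)\<close> as cocycles modulo coboundaries; its degree \<open>n\<close> component consists of the classes of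
  the cocycles of degree \<open>n\<close>.
\<close>

definition cohomology ::
  "'k::field itself \<Rightarrow> ('g, 'm) monoid_scheme \<Rightarrow> ('k, ('g list \<Rightarrow> 'k) set) graded_algebra" where
  "cohomology k G = graded_quotient (cocycle_algebra k G) (coboundaries k G)"

text \<open>The class in \<open>H\<^sup>1(G, k)\<close> of a homomorphism \<open>\<chi>\<close> from \<open>G\<close> to the additive group of \<open>k\<close>.\<close>

definition hom_class ::
  "'k::field itself \<Rightarrow> ('g, 'm) monoid_scheme \<Rightarrow> ('g \<Rightarrow> 'k) \<Rightarrow> ('g list \<Rightarrow> 'k) set" where
  "hom_class k G \<chi> =
    coboundaries k G +>\<^bsub>cocycle_algebra k G\<^esub>
      (\<lambda>xs. case xs of [g] \<Rightarrow> if g \<in> carrier G then \<chi> g else 0 | _ \<Rightarrow> 0)"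

definition chi_class ::
  "'k::field itself \<Rightarrow> 'a set \<Rightarrow> 'a set set \<Rightarrow> ('a word set list \<Rightarrow> 'k) set" where
  "chi_class k V E = hom_class k (raag V E) (\<lambda>g. of_int (length_char g))"


section \<open>The length character is well defined\<close>

lemma exponent_sum_append: "exponent_sum (u @ w) = exponent_sum u + exponent_sum w"
  by (simp add: exponent_sum_def)

lemma word_cong_words: "(u, w) \<in> word_cong S R \<Longrightarrow> u \<in> words S \<and> w \<in> words S"
  by (induction rule: word_cong.induct) (auto simp: words_def)

lemma equiv_word_cong: "equiv (words S) (word_cong S R)"
proof (rule equivI)
  show "word_cong S R \<subseteq> words S \<times> words S"
    using word_cong_words by fastforce
  show "refl_on (words S) (word_cong S R)"
    by (auto intro!: refl_onI word_cong.refl dest: word_cong_words)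
  show "sym (word_cong S R)"
    by (rule symI) (rule word_cong.sym)
  show "trans (word_cong S R)"
    by (rule transI) (rule word_cong.trans)
qed

lemma word_cong_append_left:
  "(u, w) \<in> word_cong S R \<Longrightarrow> z \<in> words S \<Longrightarrow> (z @ u, z @ w) \<in> word_cong S R"
proof (induction rule: word_cong.induct)
  case (refl w)
  then show ?case by (auto simp: words_def intro: word_cong.refl)
next
  case (sym u w)
  then show ?case by (simp add: word_cong.sym)
next
  case (trans u v w)
  then show ?case by (meson word_cong.trans)
next
  case (cancel u w s b)
  then show ?case using word_cong.cancel[of "z @ u" S w s b R] by (auto simp: words_def)
next
  case (relator u w l r)
  then show ?case using word_cong.relator[of "z @ u" S w l r R] by (auto simp: words_def)
qed

lemma word_cong_append_right:
  "(u, w) \<in> word_cong S R \<Longrightarrow> z \<in> words S \<Longrightarrow> (u @ z, w @ z) \<in> word_cong S R"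
proof (induction rule: word_cong.induct)
  case (refl w)
  then show ?case by (auto simp: words_def intro: word_cong.refl)
next
  case (sym u w)
  then show ?case by (simp add: word_cong.sym)
next
  case (trans u v w)
  then show ?case by (meson word_cong.trans)
next
  case (cancel u w s b)
  then show ?case using word_cong.cancel[of u S "w @ z" s b R] by (auto simp: words_def)
next
  case (relator u w l r)
  then show ?case using word_cong.relator[of u S "w @ z" l r R] by (auto simp: words_def)
qed

lemma mult_presented_group:
  assumes "u \<in> words S" "w \<in> words S"
  shows "word_cong S R `` {u} \<otimes>\<^bsub>presented_group S R\<^esub> word_cong S R `` {w} = word_cong S R `` {u @ w}"
proof -
  have cong: "word_cong S R `` {u' @ w'} = word_cong S R `` {u @ w}"
    if "u' \<in> word_cong S R `` {u}" "w' \<in> word_cong S R `` {w}" for u' w'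
  proof -
    from that have u': "(u, u') \<in> word_cong S R" and w': "(w, w') \<in> word_cong S R" by simp_all
    have "(u @ w, u' @ w) \<in> word_cong S R"
      using u' assms(2) by (rule word_cong_append_right)
    moreover have "(u' @ w, u' @ w') \<in> word_cong S R"
      using w' word_cong_words[OF u', THEN conjunct2] by (rule word_cong_append_left)
    ultimately have "(u @ w, u' @ w') \<in> word_cong S R" by (rule word_cong.trans)
    then show ?thesis by (rule equiv_class_eq[OF equiv_word_cong, symmetric])
  qed
  have "u \<in> word_cong S R `` {u}" "w \<in> word_cong S R `` {w}"
    using assms by (simp_all add: word_cong.refl)
  then have ne: "word_cong S R `` {u} \<noteq> {}" "word_cong S R `` {w} \<noteq> {}" by blast+
  have "word_cong S R `` {u} \<otimes>\<^bsub>presented_group S R\<^esub> word_cong S R `` {w} =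
      (\<Union>u'\<in>word_cong S R `` {u}. \<Union>w'\<in>word_cong S R `` {w}. word_cong S R `` {u' @ w'})"
    by (simp only: presented_group_def monoid.simps)
  also have "\<dots> = (\<Union>u'\<in>word_cong S R `` {u}. \<Union>w'\<in>word_cong S R `` {w}. word_cong S R `` {u @ w})"
    by (rule SUP_cong[OF HOL.refl], rule SUP_cong[OF HOL.refl], rule cong)
  also have "\<dots> = word_cong S R `` {u @ w}"
    by (simp only: UN_constant ne if_False)
  finally show ?thesis .
qed

lemma group_presented_group: "group (presented_group S R)"
proof (rule groupI)
  let ?G = "presented_group S R" and ?c = "\<lambda>u. word_cong S R `` {u}"
  have car: "X \<in> carrier ?G \<longleftrightarrow> (\<exists>u\<in>words S. X = ?c u)" for X
    by (auto simp: presented_group_def quotient_def)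
  have one: "\<one>\<^bsub>?G\<^esub> = ?c []" and nil: "[] \<in> words S"
    by (auto simp: presented_group_def words_def)
  have app: "u @ w \<in> words S" if "u \<in> words S" "w \<in> words S" for u w
    using that by (auto simp: words_def)
  show "\<one>\<^bsub>?G\<^esub> \<in> carrier ?G" unfolding car one using nil by blast
  show "x \<otimes>\<^bsub>?G\<^esub> y \<in> carrier ?G" if "x \<in> carrier ?G" "y \<in> carrier ?G" for x y
  proof -
    from that obtain u v where "u \<in> words S" "v \<in> words S" "x = ?c u" "y = ?c v"
      unfolding car by blast
    then have "x \<otimes>\<^bsub>?G\<^esub> y = ?c (u @ v)" "u @ v \<in> words S"
      by (simp_all add: mult_presented_group app)
    then show ?thesis unfolding car by blast
  qed
  show "x \<otimes>\<^bsub>?G\<^esub> y \<otimes>\<^bsub>?G\<^esub> z = x \<otimes>\<^bsub>?G\<^esub> (y \<otimes>\<^bsub>?G\<^esub> z)"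
    if xyz: "x \<in> carrier ?G" "y \<in> carrier ?G" "z \<in> carrier ?G" for x y z
  proof -
    from xyz obtain u v w where "u \<in> words S" "v \<in> words S" "w \<in> words S"
      "x = ?c u" "y = ?c v" "z = ?c w" unfolding car by blast
    then show ?thesis by (simp add: mult_presented_group app)
  qed
  show "\<one>\<^bsub>?G\<^esub> \<otimes>\<^bsub>?G\<^esub> x = x" if "x \<in> carrier ?G" for x
  proof -
    from that obtain u where "u \<in> words S" "x = ?c u" unfolding car by blast
    with nil show ?thesis by (simp add: one mult_presented_group)
  qed
  have inv: "\<exists>w\<in>words S. (w @ u, []) \<in> word_cong S R" if "u \<in> words S" for u
    using that
  proof (induction u)
    case Nil
    then show ?case using word_cong.refl[OF nil] nil by fastforce
  next
    case (Cons a u)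
    obtain s b where a: "a = (s, b)" by force
    from Cons a have s: "s \<in> S" and u: "u \<in> words S" by (auto simp: words_def)
    from Cons.IH[OF u] obtain w where w: "w \<in> words S" "(w @ u, []) \<in> word_cong S R" by blast
    have "((w @ [(s, \<not> b)]) @ a # u, w @ u) \<in> word_cong S R"
      using word_cong.cancel[OF w(1) u s, of "\<not> b"] a by simp
    then have "((w @ [(s, \<not> b)]) @ a # u, []) \<in> word_cong S R"
      using w(2) word_cong.trans by blast
    moreover have "w @ [(s, \<not> b)] \<in> words S" using w(1) s by (auto simp: words_def)
    ultimately show ?case by blast
  qed
  show "\<exists>y\<in>carrier ?G. y \<otimes>\<^bsub>?G\<^esub> x = \<one>\<^bsub>?G\<^esub>" if "x \<in> carrier ?G" for x
  proof -
    from that obtain u where u: "u \<in> words S" "x = ?c u" unfolding car by blast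
    from inv[OF u(1)] obtain w where w: "w \<in> words S" "(w @ u, []) \<in> word_cong S R" by blast
    have "?c w \<otimes>\<^bsub>?G\<^esub> x = ?c []"
      using mult_presented_group[OF w(1) u(1)] u(2) equiv_class_eq[OF equiv_word_cong w(2)] by simp
    then show ?thesis unfolding one using w(1) car by (intro bexI[of _ "?c w"]) auto
  qed
qed

lemma group_raag: "group (raag V E)"
  by (simp add: raag_def group_presented_group)

lemma length_char_class:
  assumes "u \<in> words V" and "\<And>l r. (l, r) \<in> R \<Longrightarrow> exponent_sum l = exponent_sum r"
  shows "length_char (word_cong V R `` {u}) = exponent_sum u"
proof -
  have "exponent_sum u = exponent_sum w" if "(u, w) \<in> word_cong V R" for u w
    using that
  proof (induction rule: word_cong.induct)
    case (cancel u w s b)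
    then show ?case by (cases b) (simp_all add: exponent_sum_def)
  next
    case (relator u w l r)
    then show ?case by (simp add: exponent_sum_append assms(2)[of l r])
  qed simp_all
  then have "exponent_sum w = exponent_sum u" if "w \<in> word_cong V R `` {u}" for w
    using that by (metis Image_singleton_iff)
  moreover have "u \<in> word_cong V R `` {u}" using word_cong.refl[OF assms(1)] by simp
  ultimately have "exponent_sum ` (word_cong V R `` {u}) = {exponent_sum u}" by blast
  then show ?thesis by (simp add: length_char_def)
qed

lemma length_char_word:
  assumes "u \<in> words V"
  shows "length_char (word_cong V (commutation_relators E) `` {u}) = exponent_sum u"
  using assms
  by (rule length_char_class) (auto simp: commutation_relators_def exponent_sum_def)

lemma length_char_hom: "length_char \<in> hom (raag V E) integer_group"
proof (rule homI)
  show "length_char x \<in> carrier integer_group" for x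
    by (simp add: integer_group_def)
  show "length_char (x \<otimes>\<^bsub>raag V E\<^esub> y) = length_char x \<otimes>\<^bsub>integer_group\<^esub> length_char y"
    if "x \<in> carrier (raag V E)" "y \<in> carrier (raag V E)" for x y
  proof -
    let ?c = "\<lambda>u. word_cong V (commutation_relators E) `` {u}"
    from that obtain u w where uw: "u \<in> words V" "w \<in> words V" "x = ?c u" "y = ?c w"
      by (auto simp: raag_def presented_group_def quotient_def)
    then have "u @ w \<in> words V" by (auto simp: words_def)
    with uw show ?thesis
      by (simp add: raag_def mult_presented_group length_char_word exponent_sum_append)
  qed
qed

lemma length_char_vertex:
  assumes "v \<in> V"
  shows "length_char (word_cong V (commutation_relators E) `` {[(v, True)]}) = 1"
  using length_char_word[of "[(v, True)]" V E] assms by (simp add: words_def exponent_sum_def)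

end

(*
  Write G for the right-angled Artin group, B for the kernel of the length character l and s for a
  generator. B-invariant homogeneous cochains of G compute the cohomology of B. On them T - 1 is onto,
  where T is translation by s, and its kernel consists of the cochains of G. If T acts as the identity
  on the cohomology of B, then every B-cocycle is cohomologous to a G-invariant one, so restriction is
  onto; and if a G-cocycle is the coboundary of a B-invariant h, one can arrange that
  (T - 1) h = u is a G-cocycle, and then h - l u is G-invariant and d (l u) is the cup product of the
  length class and u. Hence the kernel of the restriction is the ideal generated by that class.

  To see that T is the identity, compare with the cubical complex on which G acts freely, through the
  double complex of functions on bar simplices times cubes. Its columns are exact by induction on the
  vertex set, where only the first cohomology needs the presentation of G. On B-invariant cubical
  cochains the differential is (T - 1) composed with the dual of the augmented simplicial boundary of
  the flag complex, so by acyclicity T - 1 maps cocycles to coboundaries.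
*)

theory Submission
  imports Defs "HOL.Vector_Spaces" "HOL-Library.Function_Algebras"
begin

section \<open>Homogeneous cochains\<close>

text \<open>Restriction is a ring homomorphism already on cochains, so only its image and kernel
  have to be found.

  A cube of dimension q belongs to a clique with q vertices, that is to a simplex of dimension q -
  1, and the vertices of the cube complex belong to the empty clique; this is why reduced homology
  is the right condition. All generators v have height 1, so x v and s x lie in the same B-coset for
  every v; hence the invariant cellular differential involves one and the same boundary map for all
  x.

  No equivalence between the bar complex and the cubical complex is constructed: a single cocycle is
  followed through the double complex.

  Column exactness is stated for all vertex subsets W with all of G kept as base points, so that the
  link of a vertex poses a problem of the same kind. The complex on W is then in general
  disconnected; degree 0 is left out, and degree 1 starts the induction.

  A cochain may have components in several degrees. The arguments treat one degree at a time and
  choose 0 wherever the given cocycle vanishes.\<close>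

definition hbd :: "('g list \<Rightarrow> 'k::comm_ring_1) \<Rightarrow> 'g list \<Rightarrow> 'k" where
  "hbd F gs = (\<Sum>i<length gs. (- 1) ^ i * F (take i gs @ drop (Suc i) gs))"

lemma hbd_Nil [simp]: "hbd F [] = 0"
  by (simp add: hbd_def)

text \<open>Splitting off the first vertex turns the identities below into inductions on the list.
  On one vertex it reads \<open>hbd F [g] = F []\<close>: the complex is augmented, so conditions
  such as \<open>F [] = 0\<close> are added where the unaugmented complex is meant.\<close>

lemma hbd_Cons: "hbd F (g # gs) = F gs - hbd (\<lambda>ys. F (g # ys)) gs"
  unfolding hbd_def length_Cons by (subst sum.lessThan_Suc_shift) (simp add: sum_negf)

lemma hbd_cong:
  assumes "gs \<in> lists A"
    and "\<And>ys. ys \<in> lists A \<Longrightarrow> Suc (length ys) = length gs \<Longrightarrow> F ys = F' ys"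
  shows "hbd F gs = hbd F' gs"
proof -
  have "take i gs @ drop (Suc i) gs \<in> lists A" for i
    using assms(1) by (auto dest: in_set_takeD in_set_dropD)
  then show ?thesis
    unfolding hbd_def by (intro sum.cong refl arg_cong2[where f = "(*)"] assms(2)) auto
qed

lemma hbd_add: "hbd (\<lambda>ys. F ys + F' ys) gs = hbd F gs + hbd F' gs"
  by (simp add: hbd_def algebra_simps sum.distrib)

lemma hbd_diff: "hbd (\<lambda>ys. F ys - F' ys) gs = hbd F gs - hbd F' gs"
  by (simp add: hbd_def algebra_simps sum_subtractf)

lemma hbd_scale: "hbd (\<lambda>ys. a * F ys) gs = a * hbd F gs"
  by (simp add: hbd_def sum_distrib_left algebra_simps)

lemma hbd_sum: "hbd (\<lambda>ys. \<Sum>v\<in>A. F v ys) gs = (\<Sum>v\<in>A. hbd (F v) gs)"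
  unfolding hbd_def by (simp add: sum_distrib_left) (rule sum.swap)

lemma hbd_zero [simp]: "hbd (\<lambda>ys. 0) gs = 0"
  by (simp add: hbd_def)

lemma hbd_map: "hbd F (map r gs) = hbd (\<lambda>ys. F (map r ys)) gs"
  by (simp add: hbd_def take_map drop_map)

lemma hbd_hbd [simp]: "hbd (hbd F) gs = 0"
proof (induction gs arbitrary: F)
  case (Cons g gs)
  show ?case by (simp add: hbd_Cons hbd_diff Cons.IH)
qed simp

section \<open>The prism homotopy of a map of vertices\<close>

primrec prism :: "('g \<Rightarrow> 'g) \<Rightarrow> ('g list \<Rightarrow> 'k::comm_ring_1) \<Rightarrow> 'g list \<Rightarrow> 'k" where
  "prism r F [] = 0"
| "prism r F (g # gs) = F (g # map r (g # gs)) - prism r (\<lambda>ys. F (g # ys)) gs"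

lemma prism_diff: "prism r (\<lambda>ys. F ys - F' ys) gs = prism r F gs - prism r F' gs"
  by (induction gs arbitrary: F F') (simp_all add: algebra_simps)

text \<open>On g_0, ..., g_n the operator \<open>prism r F\<close> is the alternating sum over i of
  the values of F on g_0, ..., g_i, r g_i, ..., r g_n: the usual cutting of a prism into
  simplices.\<close>

lemma prism_homotopy: "hbd (prism r F) gs + prism r (hbd F) gs = F (map r gs) - F gs"
proof (induction gs arbitrary: F)
  case (Cons g gs)
  show ?case
    using Cons.IH[of "\<lambda>ys. F (g # ys)"]
      hbd_map[of "\<lambda>ys. F (g # r g # ys)" r gs]
    by (simp add: hbd_Cons hbd_diff prism_diff algebra_simps)
qed simp

lemma prism_map:
  assumes "gs \<in> lists A" and "\<And>g. g \<in> A \<Longrightarrow> r (f g) = f (r g)"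
  shows "prism r F (map f gs) = prism r (\<lambda>ys. F (map f ys)) gs"
  using assms(1)
proof (induction gs arbitrary: F)
  case (Cons g gs)
  then have "r (f g) = f (r g)" and "map (r \<circ> f) gs = map (f \<circ> r) gs"
    using assms(2) by (auto simp: in_lists_conv_set)
  moreover have "prism r (\<lambda>ys. F (f g # ys)) (map f gs) = prism r (\<lambda>ys. F (f g # map f ys)) gs"
    using Cons by simp
  ultimately show ?case by (simp only: list.map prism.simps map_map)
qed simp

lemma prism_cong:
  assumes "gs \<in> lists A" and "r \<in> A \<rightarrow> A"
    and "\<And>ys. ys \<in> lists A \<Longrightarrow> length ys = Suc (length gs) \<Longrightarrow> F ys = F' ys"
  shows "prism r F gs = prism r F' gs"
  using assms(1,3)
proof (induction gs arbitrary: F F')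
  case (Cons g gs)
  have "g # map r (g # gs) \<in> lists A" 
    using Cons.hyps Cons.prems(1) assms(2) by (auto simp: Pi_iff in_lists_conv_set)
  moreover have "prism r (\<lambda>ys. F (g # ys)) gs = prism r (\<lambda>ys. F' (g # ys)) gs"
    using Cons.hyps Cons.prems by (intro Cons.IH) auto
  ultimately show ?case using Cons.prems[of "g # map r (g # gs)"] by simp
qed simp

text \<open>The Alexander-Whitney product; the front face and the back face share the vertex
  \<open>gs ! i\<close>.\<close>

definition hcup :: "('g list \<Rightarrow> 'k::comm_ring_1) \<Rightarrow> ('g list \<Rightarrow> 'k) \<Rightarrow> 'g list \<Rightarrow> 'k" where
  "hcup F H gs = (\<Sum>i<length gs. F (take (Suc i) gs) * H (drop i gs))"

lemma hcup_Nil [simp]: "hcup F H [] = 0"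
  by (simp add: hcup_def)

lemma hcup_Cons: "hcup F H (g # gs) = F [g] * H (g # gs) + hcup (\<lambda>ys. F (g # ys)) H gs"
  unfolding hcup_def length_Cons by (subst sum.lessThan_Suc_shift) simp

lemma hcup_diff_left: "hcup (\<lambda>ys. F ys - F' ys) H gs = hcup F H gs - hcup F' H gs"
  by (simp add: hcup_def algebra_simps sum_subtractf)

lemma hcup_cong:
  assumes "gs \<in> lists A"
    and "\<And>ys. ys \<in> lists A \<Longrightarrow> F ys = F' ys" and "\<And>ys. ys \<in> lists A \<Longrightarrow> H ys = H' ys"
  shows "hcup F H gs = hcup F' H' gs"
proof -
  have "take i gs \<in> lists A" "drop i gs \<in> lists A" for i
    using assms(1) by (auto dest: in_set_takeD in_set_dropD)
  with assms show ?thesis unfolding hcup_def by simp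
qed

text \<open>The correction term is there only to make the induction go through: \<open>F [] = 0\<close> for the
  homogeneous form of an inhomogeneous cochain.\<close>

lemma hbd_hcup:
  assumes "H [] = 0"
  shows "hbd (hcup F H) gs =
    hcup (hbd F) H gs + hcup (\<lambda>ys. (- 1) ^ Suc (length ys) * F ys) (hbd H) gs - F [] * H gs"
proof (induction gs arbitrary: F)
  case Nil
  then show ?case using assms by simp
next
  case (Cons g gs)
  let ?F = "\<lambda>ys. F (g # ys)" and ?s = "\<lambda>F ys. (- 1) ^ Suc (length ys) * F ys"
  have neg: "hcup (\<lambda>ys. ?s F (g # ys)) (hbd H) gs = - hcup (?s ?F) (hbd H) gs"
    by (simp add: hcup_def sum_negf)
  have "hbd (hcup F H) (g # gs) = hcup F H gs - (F [g] * hbd (\<lambda>ys. H (g # ys)) gs + hbd (hcup ?F H) gs)"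
    by (simp only: hbd_Cons hcup_Cons hbd_add hbd_scale)
  moreover have "hcup (hbd F) H (g # gs) = F [] * H (g # gs) + (hcup F H gs - hcup (hbd ?F) H gs)"
    by (simp add: hcup_Cons hbd_Cons hcup_diff_left)
  moreover have "hcup (?s F) (hbd H) (g # gs) = F [g] * (H gs - hbd (\<lambda>ys. H (g # ys)) gs) - hcup (?s ?F) (hbd H) gs"
    by (simp only: hcup_Cons neg hbd_Cons) simp
  ultimately show ?case
    unfolding Cons.IH[of ?F] by (simp add: right_diff_distrib)
qed

section \<open>Homogeneous and inhomogeneous cochains\<close>

text \<open>\<open>diffs\<close> and \<open>prods\<close> change between the homogeneous and the
  inhomogeneous bar coordinates. \<open>diffs\<close> forgets the base point, so functions that
  factor through it are left invariant.\<close>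

fun diffs :: "('g, 'm) monoid_scheme \<Rightarrow> 'g list \<Rightarrow> 'g list" where
  "diffs G (x # y # ys) = (inv\<^bsub>G\<^esub> x \<otimes>\<^bsub>G\<^esub> y) # diffs G (y # ys)"
| "diffs G _ = []"

primrec prods :: "('g, 'm) monoid_scheme \<Rightarrow> 'g \<Rightarrow> 'g list \<Rightarrow> 'g list" where
  "prods G x [] = [x]"
| "prods G x (y # ys) = x # prods G (x \<otimes>\<^bsub>G\<^esub> y) ys"

text \<open>The empty list carries no homogeneous cochain, hence the value \<open>0\<close> there.\<close>

definition homog :: "('g, 'm) monoid_scheme \<Rightarrow> ('g list \<Rightarrow> 'k::field) \<Rightarrow> 'g list \<Rightarrow> 'k" where
  "homog G f gs = (if gs = [] then 0 else f (diffs G gs))"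

lemma homog_Nil [simp]: "homog G f [] = 0"
  by (simp add: homog_def)

lemma length_prods [simp]: "length (prods G x xs) = Suc (length xs)"
  by (induction xs arbitrary: x) simp_all

lemma prods_not_Nil [simp]: "prods G x xs \<noteq> []"
  by (cases xs) simp_all

lemma hd_prods [simp]: "hd (prods G x xs) = x"
  by (cases xs) simp_all

lemma length_diffs [simp]: "length (diffs G gs) = length gs - 1"
  by (induction gs rule: induct_list012) simp_all

lemma take_prods: "i \<le> length xs \<Longrightarrow> take (Suc i) (prods G x xs) = prods G x (take i xs)"
proof (induction xs arbitrary: x i)
  case (Cons y ys)
  then show ?case by (cases i) simp_all
qed simp

context group
begin

lemma prods_in_lists: "xs \<in> lists (carrier G) \<Longrightarrow> x \<in> carrier G \<Longrightarrow> prods G x xs \<in> lists (carrier G)"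
  by (induction xs arbitrary: x) auto

lemma diffs_in_lists: "gs \<in> lists (carrier G) \<Longrightarrow> diffs G gs \<in> lists (carrier G)"
  by (induction gs rule: induct_list012) auto

lemma inv_mult_mult: "x \<in> carrier G \<Longrightarrow> y \<in> carrier G \<Longrightarrow> inv x \<otimes> (x \<otimes> y) = y"
  by (simp add: m_assoc[symmetric])

lemma mult_inv_mult: "x \<in> carrier G \<Longrightarrow> y \<in> carrier G \<Longrightarrow> x \<otimes> (inv x \<otimes> y) = y"
  by (simp add: m_assoc[symmetric])

lemma diffs_prods:
  "xs \<in> lists (carrier G) \<Longrightarrow> x \<in> carrier G \<Longrightarrow> diffs G (prods G x xs) = xs"
proof (induction xs arbitrary: x)
  case (Cons y ys)
  obtain zs where zs: "prods G (x \<otimes> y) ys = (x \<otimes> y) # zs"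
    by (cases ys) auto
  then have "diffs G (prods G x (y # ys)) = inv x \<otimes> (x \<otimes> y) # diffs G (prods G (x \<otimes> y) ys)"
    by simp
  with Cons show ?case by (simp add: inv_mult_mult)
qed simp

lemma prods_diffs:
  "gs \<in> lists (carrier G) \<Longrightarrow> gs \<noteq> [] \<Longrightarrow> prods G (hd gs) (diffs G gs) = gs"
  by (induction gs rule: induct_list012) (auto simp: mult_inv_mult)

lemma drop_prods:
  "i \<le> length xs \<Longrightarrow> xs \<in> lists (carrier G) \<Longrightarrow> x \<in> carrier G \<Longrightarrow>
    \<exists>z\<in>carrier G. drop i (prods G x xs) = prods G z (drop i xs)"
proof (induction xs arbitrary: x i)
  case (Cons y ys)
  then show ?case by (cases i) auto
qed auto

lemma diffs_map_mult:
  "gs \<in> lists (carrier G) \<Longrightarrow> g \<in> carrier G \<Longrightarrow> diffs G (map (\<lambda>x. g \<otimes> x) gs) = diffs G gs"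
proof (induction gs rule: induct_list012)
  case (3 x y ys)
  then have "inv (g \<otimes> x) \<otimes> (g \<otimes> y) = inv x \<otimes> y"
    by (simp add: inv_mult_group m_assoc inv_mult_mult)
  with 3 show ?case by simp
qed simp_all

lemma prods_mult:
  "xs \<in> lists (carrier G) \<Longrightarrow> g \<in> carrier G \<Longrightarrow> x \<in> carrier G \<Longrightarrow>
    prods G (g \<otimes> x) xs = map (\<lambda>x. g \<otimes> x) (prods G x xs)"
  by (induction xs arbitrary: x) (auto simp: m_assoc)

text \<open>Omitting an inner vertex of a path multiplies the two adjacent increments; this is the
  origin of the middle terms of \<open>coboundary\<close>.\<close>

lemma prods_merge:
  assumes "Suc j < length xs" "xs \<in> lists (carrier G)" "x \<in> carrier G"
  shows "take (Suc j) (prods G x xs) @ drop (Suc (Suc j)) (prods G x xs) =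
    prods G x (take j xs @ [xs ! j \<otimes> xs ! Suc j] @ drop (j + 2) xs)"
  using assms
proof (induction xs arbitrary: x j)
  case (Cons y ys)
  show ?case
  proof (cases j)
    case 0
    with Cons.prems obtain z zs where ys: "ys = z # zs" by (cases ys) auto
    with Cons.prems 0 show ?thesis by (cases zs) (simp_all add: m_assoc)
  next
    case (Suc j')
    with Cons.prems Cons.IH[of j' "x \<otimes> y"] show ?thesis by simp
  qed
qed simp

lemma homog_prods:
  "xs \<in> lists (carrier G) \<Longrightarrow> x \<in> carrier G \<Longrightarrow> homog G f (prods G x xs) = f xs"
  by (simp add: homog_def diffs_prods)

lemma homog_map_mult:
  "gs \<in> lists (carrier G) \<Longrightarrow> g \<in> carrier G \<Longrightarrow> homog G f (map (\<lambda>x. g \<otimes> x) gs) = homog G f gs"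
  by (simp add: homog_def diffs_map_mult)

lemma hbd_homog_prods:
  assumes xs: "xs \<in> lists (carrier G)" and x: "x \<in> carrier G"
  shows "hbd (homog G f) (prods G x xs) = coboundary G f xs"
proof (cases xs rule: rev_cases)
  case Nil
  then show ?thesis by (simp add: coboundary_def hbd_Cons)
next
  case (snoc xs' z)
  define n where "n = length xs'"
  let ?p = "prods G x xs" and ?F = "homog G f"
  have n: "length xs = Suc n" using snoc by (simp add: n_def)
  then obtain y ys where y: "xs = y # ys" by (cases xs) auto
  have "hbd ?F ?p = (\<Sum>i<Suc (Suc n). (- 1) ^ i * ?F (take i ?p @ drop (Suc i) ?p))"
    using n by (simp add: hbd_def)
  also have "\<dots> = ?F (drop 1 ?p) +
      (\<Sum>j<n. (- 1) ^ Suc j * ?F (take (Suc j) ?p @ drop (Suc (Suc j)) ?p)) +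
      (- 1) ^ Suc n * ?F (take (Suc n) ?p @ drop (Suc (Suc n)) ?p)"
    by (subst sum.lessThan_Suc_shift, subst sum.lessThan_Suc) simp
  \<comment> \<open>Without its first vertex the path has the increments \<open>tl xs\<close> and
    another base point, which \<open>homog\<close> does not see.\<close>
  also have "?F (drop 1 ?p) = f (tl xs)"
    using xs x y by (simp add: homog_prods)
  also have "(\<Sum>j<n. (- 1) ^ Suc j * ?F (take (Suc j) ?p @ drop (Suc (Suc j)) ?p)) =
    (\<Sum>j<n. (- 1) ^ Suc j * f (take j xs @ [xs ! j \<otimes> xs ! Suc j] @ drop (j + 2) xs))"
  proof (rule sum.cong[OF HOL.refl])
    fix j assume "j \<in> {..<n}"
    then have j: "Suc j < length xs" using n by simp
    have "take j xs @ [xs ! j \<otimes> xs ! Suc j] @ drop (j + 2) xs \<in> lists (carrier G)"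
      using xs j by (auto dest: in_set_takeD in_set_dropD)
    then show "(- 1) ^ Suc j * ?F (take (Suc j) ?p @ drop (Suc (Suc j)) ?p) =
        (- 1) ^ Suc j * f (take j xs @ [xs ! j \<otimes> xs ! Suc j] @ drop (j + 2) xs)"
      unfolding prods_merge[OF j xs x] using x by (simp add: homog_prods)
  qed
  also have "take (Suc n) ?p @ drop (Suc (Suc n)) ?p = prods G x (butlast xs)"
    using n by (simp add: take_prods butlast_conv_take)
  also have "?F (prods G x (butlast xs)) = f (butlast xs)"
    using xs x snoc by (intro homog_prods) auto
  finally show ?thesis
    using xs snoc n by (simp add: coboundary_def)
qed

lemma hbd_homog:
  assumes "gs \<in> lists (carrier G)"
  shows "hbd (homog G f) gs = homog G (coboundary G f) gs"
proof (cases "gs = []")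
  case False
  then have "hd gs \<in> carrier G" using assms by (cases gs) auto
  then have "hbd (homog G f) gs = coboundary G f (diffs G gs)"
    using hbd_homog_prods[of "diffs G gs" "hd gs" f] prods_diffs[OF assms False] diffs_in_lists[OF assms]
    by simp
  with False show ?thesis by (simp add: homog_def)
qed simp

lemma hcup_homog_prods:
  assumes xs: "xs \<in> lists (carrier G)" and x: "x \<in> carrier G"
  shows "hcup (homog G f) (homog G h) (prods G x xs) = cup f h xs"
proof -
  have "homog G f (take (Suc i) (prods G x xs)) * homog G h (drop i (prods G x xs)) =
      f (take i xs) * h (drop i xs)" if i: "i \<le> length xs" for i
  proof -
    have "take i xs \<in> lists (carrier G)" "drop i xs \<in> lists (carrier G)"
      using xs by (auto dest: in_set_takeD in_set_dropD)
    moreover obtain z where "z \<in> carrier G" "drop i (prods G x xs) = prods G z (drop i xs)"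
      using drop_prods[OF i xs x] by blast
    ultimately show ?thesis using i x by (simp add: take_prods homog_prods)
  qed
  then show ?thesis
    unfolding hcup_def cup_def by (simp add: lessThan_Suc_atMost)
qed

lemma hcup_homog:
  assumes "gs \<in> lists (carrier G)"
  shows "hcup (homog G f) (homog G h) gs = homog G (cup f h) gs"
proof (cases "gs = []")
  case False
  then have "hd gs \<in> carrier G" using assms by (cases gs) auto
  then show ?thesis
    using hcup_homog_prods[of "diffs G gs" "hd gs" f h] prods_diffs[OF assms False] 
      diffs_in_lists[OF assms] False
    by (simp add: homog_def)
qed simp

text \<open>Invariance is asked for in one degree only, because invariant cochains will be chosen
  degree by degree.\<close>

lemma homog_inhomog:
  assumes inv: "\<And>g ys. g \<in> carrier G \<Longrightarrow> ys \<in> lists (carrier G) \<Longrightarrow> length ys = Suc n \<Longrightarrow>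
      F (map (\<lambda>x. g \<otimes> x) ys) = F ys"
    and gs: "gs \<in> lists (carrier G)" "length gs = Suc n"
  shows "homog G (\<lambda>xs. F (prods G \<one> xs)) gs = F gs"
proof -
  have ne: "gs \<noteq> []" using gs by auto
  then have hd: "hd gs \<in> carrier G" using gs by (cases gs) auto
  have d: "diffs G gs \<in> lists (carrier G)" using diffs_in_lists gs by blast
  have "F gs = F (prods G (hd gs \<otimes> \<one>) (diffs G gs))"
    using hd prods_diffs[OF gs(1) ne] by simp
  also have "\<dots> = F (prods G \<one> (diffs G gs))"
    using d hd gs prods_in_lists[OF d one_closed]
    by (subst prods_mult) (simp_all add: inv)
  finally show ?thesis using ne by (simp add: homog_def)
qed

end

section \<open>The cohomology ring\<close>

lemma cup_Cons: "cup f g (y # ys) = f [] * g (y # ys) + cup (\<lambda>zs. f (y # zs)) g ys"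
  unfolding cup_def length_Cons by (subst sum.atMost_Suc_shift) simp

lemma cup_Nil: "cup f g [] = f [] * g []"
  by (simp add: cup_def)

lemma cup_add_left: "cup (\<lambda>xs. f xs + f' xs) g xs = cup f g xs + cup f' g xs"
  by (simp add: cup_def algebra_simps sum.distrib)

lemma cup_add_right: "cup f (\<lambda>xs. g xs + g' xs) xs = cup f g xs + cup f g' xs"
  by (simp add: cup_def algebra_simps sum.distrib)

lemma cup_scale_left: "cup (\<lambda>xs. a * f xs) g xs = a * cup f g xs"
  by (simp add: cup_def sum_distrib_left algebra_simps)

lemma cup_zero_left [simp]: "cup (\<lambda>_. 0) g xs = 0"
  by (simp add: cup_def)

lemma cup_zero_right [simp]: "cup f (\<lambda>_. 0) xs = 0"
  by (simp add: cup_def)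

lemma cup_assoc: "cup (cup f g) h xs = cup f (cup g h) xs"
proof (induction xs arbitrary: f)
  case (Cons y ys)
  let ?f = "\<lambda>zs. f (y # zs)"
  have "cup (\<lambda>zs. cup f g (y # zs)) h ys = f [] * cup (\<lambda>zs. g (y # zs)) h ys + cup ?f (cup g h) ys"
    by (simp add: cup_Cons cup_add_left cup_scale_left Cons.IH)
  then show ?case by (simp add: cup_Cons cup_Nil algebra_simps)
qed (simp add: cup_Nil mult.assoc)

lemma cup_one_left: "cup (\<lambda>xs. if xs = [] then 1 else 0) f xs = f xs"
  by (cases xs) (simp_all add: cup_Nil cup_Cons)

lemma cup_one_right: "cup f (\<lambda>xs. if xs = [] then 1 else 0) xs = f xs"
  by (induction xs arbitrary: f) (simp_all add: cup_Nil cup_Cons)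

lemma cup_nonzero_splits:
  assumes "cup f g xs \<noteq> 0"
  obtains i where "i \<le> length xs" "f (take i xs) \<noteq> 0" "g (drop i xs) \<noteq> 0"
proof -
  have "\<exists>i\<in>{..length xs}. f (take i xs) * g (drop i xs) \<noteq> 0"
    using assms unfolding cup_def by (meson sum.not_neutral_contains_not_neutral)
  then show ?thesis using that by auto
qed

text \<open>The sign of the Leibniz rule, read off from the length of the list since a cochain may
  have components in several degrees.\<close>

definition degree_sign :: "('g list \<Rightarrow> 'k::field) \<Rightarrow> 'g list \<Rightarrow> 'k" where
  "degree_sign f xs = (- 1) ^ length xs * f xs"

lemma degree_sign_degree_sign: "degree_sign (degree_sign f) = f"
  by (rule ext) (simp add: degree_sign_def mult.assoc[symmetric] power_add[symmetric] mult_2[symmetric])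

lemma cochainsI:
  "(\<And>xs. f xs \<noteq> 0 \<Longrightarrow> xs \<in> lists (carrier G) \<and> length xs \<le> N) \<Longrightarrow> f \<in> cochains k G"
  unfolding cochains_def by blast

lemma cochainsE:
  assumes "f \<in> cochains k G"
  obtains N where "\<And>xs. f xs \<noteq> 0 \<Longrightarrow> xs \<in> lists (carrier G)" "\<And>xs. f xs \<noteq> 0 \<Longrightarrow> length xs \<le> N"
  using assms unfolding cochains_def by blast

lemma cochains_outside: "f \<in> cochains k G \<Longrightarrow> xs \<notin> lists (carrier G) \<Longrightarrow> f xs = 0"
  unfolding cochains_def by blast

lemma zero_cochain [simp]: "(\<lambda>_. 0) \<in> cochains k G"
  by (simp add: cochains_def)

lemma add_cochains:
  assumes "f \<in> cochains k G" "g \<in> cochains k G"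
  shows "(\<lambda>xs. f xs + g xs) \<in> cochains k G"
proof -
  obtain N where N: "\<And>xs. f xs \<noteq> 0 \<Longrightarrow> xs \<in> lists (carrier G)" "\<And>xs. f xs \<noteq> 0 \<Longrightarrow> length xs \<le> N"
    using cochainsE[OF assms(1)] by blast
  obtain M where M: "\<And>xs. g xs \<noteq> 0 \<Longrightarrow> xs \<in> lists (carrier G)" "\<And>xs. g xs \<noteq> 0 \<Longrightarrow> length xs \<le> M"
    using cochainsE[OF assms(2)] by blast
  show ?thesis
  proof (rule cochainsI[where N = "max N M"])
    fix xs assume "f xs + g xs \<noteq> 0"
    then have "f xs \<noteq> 0 \<or> g xs \<noteq> 0" by auto
    then show "xs \<in> lists (carrier G) \<and> length xs \<le> max N M"
      using N M by (auto simp: le_max_iff_disj)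
  qed
qed

lemma scale_cochains: "f \<in> cochains k G \<Longrightarrow> (\<lambda>xs. a xs * f xs) \<in> cochains k G"
  unfolding cochains_def by (simp, meson mult_eq_0_iff)

lemma uminus_cochains: "f \<in> cochains k G \<Longrightarrow> (\<lambda>xs. - f xs) \<in> cochains k G"
  by (simp add: cochains_def)

lemma degree_sign_cochains: "f \<in> cochains k G \<Longrightarrow> degree_sign f \<in> cochains k G"
  unfolding degree_sign_def[abs_def] by (rule scale_cochains)

lemma cup_cochains:
  assumes "f \<in> cochains k G" "g \<in> cochains k G"
  shows "cup f g \<in> cochains k G"
proof -
  obtain N where N: "\<And>xs. f xs \<noteq> 0 \<Longrightarrow> xs \<in> lists (carrier G)" "\<And>xs. f xs \<noteq> 0 \<Longrightarrow> length xs \<le> N"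
    using cochainsE[OF assms(1)] by blast
  obtain M where M: "\<And>xs. g xs \<noteq> 0 \<Longrightarrow> xs \<in> lists (carrier G)" "\<And>xs. g xs \<noteq> 0 \<Longrightarrow> length xs \<le> M"
    using cochainsE[OF assms(2)] by blast
  show ?thesis
  proof (rule cochainsI[where N = "N + M"])
    fix xs assume "cup f g xs \<noteq> 0"
    then obtain i where i: "i \<le> length xs" "f (take i xs) \<noteq> 0" "g (drop i xs) \<noteq> 0"
      by (rule cup_nonzero_splits)
    have "take i xs @ drop i xs \<in> lists (carrier G)"
      using N(1)[OF i(2)] M(1)[OF i(3)] by (simp only: append_in_lists_conv)
    then show "xs \<in> lists (carrier G) \<and> length xs \<le> N + M"
      using N(2)[OF i(2)] M(2)[OF i(3)] i(1) by simp
  qed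
qed

lemma one_cochain: "(\<lambda>xs. if xs = [] then 1 else 0) \<in> cochains k G"
  by (rule cochainsI[where N = 0]) (auto split: if_splits)

lemma coboundary_outside: "xs \<notin> lists (carrier G) \<Longrightarrow> coboundary G f xs = 0"
  by (simp add: coboundary_def)

lemma coboundary_add:
  "coboundary G (\<lambda>xs. f xs + g xs) xs = coboundary G f xs + coboundary G g xs"
  unfolding coboundary_def distrib_left sum.distrib by simp

lemma coboundary_scale: "coboundary G (\<lambda>xs. a * f xs) xs = a * coboundary G f xs"
  by (simp add: coboundary_def distrib_left sum_distrib_left mult.left_commute)

lemma coboundary_uminus: "coboundary G (\<lambda>xs. - f xs) xs = - coboundary G f xs"
  using coboundary_scale[of G "- 1" f xs] by simp

lemma coboundary_zero [simp]: "coboundary G (\<lambda>_. 0) = (\<lambda>_. 0)"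
  by (rule ext) (simp add: coboundary_def)

section \<open>The cochain complex and its Leibniz rule\<close>

context group
begin

lemma coboundary_prods:
  "xs \<in> lists (carrier G) \<Longrightarrow> coboundary G f xs = hbd (homog G f) (prods G \<one> xs)"
  by (simp add: hbd_homog_prods)

lemma coboundary_vanishes:
  assumes "\<And>ys. ys \<in> lists (carrier G) \<Longrightarrow> Suc (length ys) = length xs \<Longrightarrow> f ys = 0"
  shows "coboundary G f xs = 0"
proof (cases "xs \<in> lists (carrier G)")
  case True
  have "hbd (homog G f) (prods G \<one> xs) = hbd (\<lambda>_. 0) (prods G \<one> xs)"
  proof (rule hbd_cong[OF prods_in_lists[OF True one_closed]])
    fix ys assume ys: "ys \<in> lists (carrier G)" "Suc (length ys) = length (prods G \<one> xs)"
    show "homog G f ys = 0"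
    proof (cases "ys = []")
      case False
      then have "Suc (length (diffs G ys)) = length xs" using ys by (cases ys) simp_all
      then have "f (diffs G ys) = 0" by (rule assms[OF diffs_in_lists[OF ys(1)]])
      then show ?thesis by (simp add: homog_def)
    qed simp
  qed
  then show ?thesis by (simp add: coboundary_prods[OF True])
qed (rule coboundary_outside)

lemma coboundary_cochains:
  assumes "f \<in> cochains k G"
  shows "coboundary G f \<in> cochains k G"
proof -
  obtain N where "\<And>xs. f xs \<noteq> 0 \<Longrightarrow> xs \<in> lists (carrier G)"
    and N: "\<And>xs. f xs \<noteq> 0 \<Longrightarrow> length xs \<le> N"
    using cochainsE[OF assms] by metis
  show ?thesis
  proof (rule cochainsI[where N = "Suc N"])
    fix xs assume nz: "coboundary G f xs \<noteq> 0"
    then have "xs \<in> lists (carrier G)" using coboundary_outside[of xs G f] by argo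
    moreover have "length xs \<le> Suc N"
    proof (rule ccontr)
      assume "\<not> length xs \<le> Suc N"
      then have "f ys = 0" if "Suc (length ys) = length xs" for ys
        using N[of ys] that by linarith
      then have "coboundary G f xs = 0" by (rule coboundary_vanishes)
      with nz show False by simp
    qed
    ultimately show "xs \<in> lists (carrier G) \<and> length xs \<le> Suc N" ..
  qed
qed

lemma coboundary_coboundary: "coboundary G (coboundary G f) = (\<lambda>_. 0)"
proof (rule ext)
  fix xs show "coboundary G (coboundary G f) xs = 0"
  proof (cases "xs \<in> lists (carrier G)")
    case True
    have "hbd (homog G (coboundary G f)) (prods G \<one> xs) = hbd (hbd (homog G f)) (prods G \<one> xs)"
      by (rule hbd_cong[OF prods_in_lists[OF True one_closed]]) (simp add: hbd_homog)
    then show ?thesis by (simp add: coboundary_prods[OF True])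
  qed (rule coboundary_outside)
qed

text \<open>Transported from \<open>hbd_hcup\<close>, whose correction term vanishes because
  \<open>homog G f [] = 0\<close>. The case distinction reflects that \<open>f\<close> and
  \<open>g\<close> are arbitrary functions: off the lists over the carrier the coboundary is 0 by
  definition, while the products may be nonzero.\<close>

lemma coboundary_cup:
  "coboundary G (cup f g) xs =
    (if xs \<in> lists (carrier G) then cup (coboundary G f) g xs + cup (degree_sign f) (coboundary G g) xs else 0)"
proof (cases "xs \<in> lists (carrier G)")
  case True
  let ?p = "prods G \<one> xs"
  have p: "?p \<in> lists (carrier G)" using prods_in_lists[OF True one_closed] .
  have "coboundary G (cup f g) xs = hbd (hcup (homog G f) (homog G g)) ?p"
    unfolding coboundary_prods[OF True] by (rule hbd_cong[OF p]) (simp add: hcup_homog)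
  also have "\<dots> = hcup (hbd (homog G f)) (homog G g) ?p +
      hcup (\<lambda>ys. (- 1) ^ Suc (length ys) * homog G f ys) (hbd (homog G g)) ?p"
    by (simp add: hbd_hcup)
  also have "hcup (hbd (homog G f)) (homog G g) ?p = hcup (homog G (coboundary G f)) (homog G g) ?p"
    by (rule hcup_cong[OF p]) (simp_all add: hbd_homog)
  also have "hcup (\<lambda>ys. (- 1) ^ Suc (length ys) * homog G f ys) (hbd (homog G g)) ?p =
      hcup (homog G (degree_sign f)) (homog G (coboundary G g)) ?p"
    by (rule hcup_cong[OF p])
      (auto simp: hbd_homog homog_def degree_sign_def neq_Nil_conv)
  finally show ?thesis using True by (simp add: hcup_homog_prods)
qed (simp add: coboundary_outside)

lemma coboundary_degree_sign:
  "coboundary G (degree_sign f) = (\<lambda>xs. - degree_sign (coboundary G f) xs)"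
proof
  fix xs
  show "coboundary G (degree_sign f) xs = - degree_sign (coboundary G f) xs"
  proof (cases "xs \<in> lists (carrier G)")
    case True
    have "hbd (homog G (degree_sign f)) (prods G \<one> xs) =
        hbd (\<lambda>ys. (- 1) ^ (length xs - 1) * homog G f ys) (prods G \<one> xs)"
      by (rule hbd_cong[OF prods_in_lists[OF True one_closed]])
        (auto simp: homog_def degree_sign_def)
    then have "coboundary G (degree_sign f) xs = (- 1) ^ (length xs - 1) * coboundary G f xs"
      by (simp add: coboundary_prods[OF True] hbd_scale)
    then show ?thesis by (cases xs) (simp_all add: degree_sign_def coboundary_def)
  qed (simp add: coboundary_outside degree_sign_def)
qed

lemma cup_cocycles:
  assumes "coboundary G f = (\<lambda>_. 0)" "coboundary G g = (\<lambda>_. 0)"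
  shows "coboundary G (cup f g) = (\<lambda>_. 0)"
  by (rule ext) (simp add: coboundary_cup assms)

lemma coboundary_one: "coboundary G (\<lambda>xs. if xs = [] then 1 else 0) = (\<lambda>_. 0)"
proof
  fix xs show "coboundary G (\<lambda>xs. if xs = [] then 1 else 0) xs = (0::'k::field)"
  proof (cases "length xs = 1")
    case True
    then obtain x where "xs = [x]" by (cases xs) auto
    then show ?thesis by (simp add: coboundary_def)
  qed (rule coboundary_vanishes, auto)
qed

section \<open>The ring of cocycles and the ideal of coboundaries\<close>

lemma cocycle_algebra_carrier:
  "f \<in> carrier (cocycle_algebra k G) \<longleftrightarrow> f \<in> cochains k G \<and> coboundary G f = (\<lambda>_. 0)"
  by (simp add: cocycle_algebra_def)

lemma ring_cocycle_algebra: "ring (cocycle_algebra k G)"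
proof (rule ringI)
  show "abelian_group (cocycle_algebra k G)"
  proof (rule abelian_groupI)
    fix f assume f: "f \<in> carrier (cocycle_algebra k G)"
    then have "(\<lambda>xs. - f xs) \<in> carrier (cocycle_algebra k G)"
      by (simp add: cocycle_algebra_carrier fun_eq_iff coboundary_uminus uminus_cochains)
    then show "\<exists>g\<in>carrier (cocycle_algebra k G).
        g \<oplus>\<^bsub>cocycle_algebra k G\<^esub> f = \<zero>\<^bsub>cocycle_algebra k G\<^esub>"
      by (rule bexI[rotated]) (simp add: cocycle_algebra_def)
  qed (auto simp: cocycle_algebra_def coboundary_add fun_eq_iff add_cochains algebra_simps)
  show "monoid (cocycle_algebra k G)"
    by (rule monoidI)
      (simp_all add: cocycle_algebra_def cup_cocycles cup_cochains one_cochain coboundary_one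
        fun_eq_iff cup_assoc cup_one_left cup_one_right)
qed (simp_all add: cocycle_algebra_def fun_eq_iff cup_add_left cup_add_right)

lemma coboundaries_subset: "coboundaries k G \<subseteq> carrier (cocycle_algebra k G)"
  by (auto simp: coboundaries_def cocycle_algebra_carrier coboundary_cochains coboundary_coboundary)

lemma ideal_coboundaries: "ideal (coboundaries k G) (cocycle_algebra k G)"
proof (rule idealI)
  let ?Z = "cocycle_algebra k G"
  interpret ring ?Z by (rule ring_cocycle_algebra)
  show "ring ?Z" by (rule ring_cocycle_algebra)
  have minus: "\<ominus>\<^bsub>?Z\<^esub> f = (\<lambda>xs. - f xs)" if "f \<in> carrier ?Z" for f
  proof (rule minus_equality)
    show "(\<lambda>xs. - f xs) \<in> carrier ?Z"
      using that
      by (simp add: cocycle_algebra_carrier fun_eq_iff coboundary_uminus uminus_cochains)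
  qed (use that in \<open>simp_all add: cocycle_algebra_def\<close>)
  show "subgroup (coboundaries k G) (add_monoid ?Z)"
  proof
    show "coboundaries k G \<subseteq> carrier (add_monoid ?Z)" using coboundaries_subset by simp
    show "\<one>\<^bsub>add_monoid ?Z\<^esub> \<in> coboundaries k G"
      unfolding coboundaries_def by (rule image_eqI[of _ _ "\<lambda>_. 0"]) (simp_all add: cocycle_algebra_def)
    fix f assume "f \<in> coboundaries k G"
    then obtain a where a: "a \<in> cochains k G" "f = coboundary G a" by (auto simp: coboundaries_def)
    have "inv\<^bsub>add_monoid ?Z\<^esub> f = (\<lambda>xs. - f xs)"
      using minus[of f] \<open>f \<in> _\<close> coboundaries_subset by (auto simp: a_inv_def)
    also have "\<dots> = coboundary G (\<lambda>xs. - a xs)"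
      by (simp add: fun_eq_iff coboundary_uminus a)
    finally show "inv\<^bsub>add_monoid ?Z\<^esub> f \<in> coboundaries k G"
      unfolding coboundaries_def using uminus_cochains[OF a(1)] by blast
    fix g assume "g \<in> coboundaries k G"
    then obtain b where b: "b \<in> cochains k G" "g = coboundary G b" by (auto simp: coboundaries_def)
    have "f \<otimes>\<^bsub>add_monoid ?Z\<^esub> g = coboundary G (\<lambda>xs. a xs + b xs)"
      by (simp add: cocycle_algebra_def fun_eq_iff coboundary_add a b)
    then show "f \<otimes>\<^bsub>add_monoid ?Z\<^esub> g \<in> coboundaries k G"
      unfolding coboundaries_def using a b by (simp add: add_cochains)
  qed
  fix f g assume "f \<in> coboundaries k G" and g: "g \<in> carrier ?Z"
  then obtain a where a: "a \<in> cochains k G" "f = coboundary G a" by (auto simp: coboundaries_def)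
  have g': "g \<in> cochains k G" "coboundary G g = (\<lambda>_. 0)" using g by (simp_all add: cocycle_algebra_carrier)
  have out: "cup p q xs = 0" if "p \<in> cochains k G" "q \<in> cochains k G" "xs \<notin> lists (carrier G)" for p q xs
    using cochains_outside[OF cup_cochains[OF that(1,2)] that(3)] .
  have f: "f \<in> cochains k G" using a coboundary_cochains by blast
  have "cup f g = coboundary G (cup a g)"
    by (rule ext) (simp add: coboundary_cup a(2) g' out[OF f[unfolded a(2)] g'(1)])
  then show "f \<otimes>\<^bsub>?Z\<^esub> g \<in> coboundaries k G"
    unfolding coboundaries_def using a g' cup_cochains[of a k G g] by (auto simp: cocycle_algebra_def)
  \<comment> \<open>Since \<open>degree_sign\<close> is an involution, twisting \<open>g\<close>
    beforehand makes the Leibniz rule produce exactly the product of \<open>g\<close> with the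
    coboundary of \<open>a\<close>.\<close>
  have "coboundary G (degree_sign g) = (\<lambda>_. 0)"
    unfolding coboundary_degree_sign g' by (simp add: degree_sign_def)
  then have "cup g f = coboundary G (cup (degree_sign g) a)"
    by (intro ext)
      (simp add: coboundary_cup a(2) g' out[OF g'(1) f[unfolded a(2)]] degree_sign_degree_sign)
  then show "g \<otimes>\<^bsub>?Z\<^esub> f \<in> coboundaries k G"
    unfolding coboundaries_def using cup_cochains[OF degree_sign_cochains[OF g'(1)] a(1)]
    by (auto simp: cocycle_algebra_def)
qed

end

section \<open>Graded quotients\<close>

lemma graded_quotient_sel [simp]:
  "carrier (graded_quotient A I) = carrier (A Quot I)"
  "mult (graded_quotient A I) = mult (A Quot I)"
  "one (graded_quotient A I) = one (A Quot I)"
  "zero (graded_quotient A I) = zero (A Quot I)"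
  "add (graded_quotient A I) = add (A Quot I)"
  "smult (graded_quotient A I) = (\<lambda>c X. \<Union>x\<in>X. I +>\<^bsub>A\<^esub> (c \<odot>\<^bsub>A\<^esub> x))"
  "hcomp (graded_quotient A I) = (\<lambda>n. (\<lambda>x. I +>\<^bsub>A\<^esub> x) ` hcomp A n)"
  by (simp_all add: graded_quotient_def)

lemma ring_graded_quotient:
  assumes "ideal I A"
  shows "ring (graded_quotient A I)"
proof -
  interpret ideal I A by fact
  \<comment> \<open>Both records have the same ring operations, so the identity carries the ring
    axioms over.\<close>
  have "id \<in> ring_iso (A Quot I) (graded_quotient A I)"
    by (auto simp: ring_iso_def ring_hom_def)
  then have "ring ((graded_quotient A I) \<lparr>zero := id \<zero>\<^bsub>A Quot I\<^esub>\<rparr>)"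
    by (rule ring.ring_iso_imp_img_ring[OF quotient_is_ring])
  moreover have "(graded_quotient A I) \<lparr>zero := id \<zero>\<^bsub>A Quot I\<^esub>\<rparr> = graded_quotient A I"
    by (simp add: graded_quotient_def)
  ultimately show ?thesis by (simp only:)
qed

lemma graded_quotient_carrier:
  "X \<in> carrier (graded_quotient A I) \<longleftrightarrow> (\<exists>x\<in>carrier A. X = I +>\<^bsub>A\<^esub> x)"
  by (auto simp: FactRing_def A_RCOSETS_def')

lemma UN_eq_const: "A \<noteq> {} \<Longrightarrow> (\<And>a. a \<in> A \<Longrightarrow> f a = c) \<Longrightarrow> (\<Union>a\<in>A. f a) = c"
  by auto

text \<open>The elements of the quotient are the cosets of the kernel, and these are the fibres of
  \<open>h\<close>. The inverse of the induced map can therefore be written down without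
  representatives: it sends \<open>b\<close> to its fibre.\<close>

lemma graded_quotient_iso:
  fixes A :: "('k, 'b, 'm) graded_algebra_scheme" and B :: "('k, 'c, 'n) graded_algebra_scheme"
  assumes "ring A" and "ring B" and h: "h \<in> ring_hom A B"
    and surj: "h ` carrier A = carrier B"
    and smult_closed: "\<And>c x. x \<in> carrier A \<Longrightarrow> c \<odot>\<^bsub>A\<^esub> x \<in> carrier A"
    and smult: "\<And>c x. x \<in> carrier A \<Longrightarrow> h (c \<odot>\<^bsub>A\<^esub> x) = c \<odot>\<^bsub>B\<^esub> h x"
    and hcomp_closed: "\<And>n. hcomp A n \<subseteq> carrier A"
    and hcomp: "\<And>n. h ` hcomp A n = hcomp B n"
  shows "(\<lambda>b. {a \<in> carrier A. h a = b}) \<in> graded_algebra_iso B (graded_quotient A (a_kernel A B h))"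
proof -
  interpret A: ring A by fact
  interpret B: ring B by fact
  interpret h: ring_hom_ring A B h
    by (rule ring_hom_ringI2[OF assms(1-3)])
  let ?I = "a_kernel A B h" and ?\<phi> = "\<lambda>b. {a \<in> carrier A. h a = b}"
  interpret I: ideal ?I A by (rule h.kernel_is_ideal)
  have coset: "?\<phi> (h a) = ?I +>\<^bsub>A\<^esub> a" if "a \<in> carrier A" for a
    using h.rcos_eq_homeq[OF that] by simp
  have B: "\<exists>a\<in>carrier A. b = h a" if "b \<in> carrier B" for b using surj that by blast
  have "?\<phi> \<in> ring_hom B (graded_quotient A ?I)"
  proof (rule ring_hom_memI)
    fix x assume x: "x \<in> carrier B"
    then obtain a where a: "a \<in> carrier A" "x = h a" using B by blast
    then show "?\<phi> x \<in> carrier (graded_quotient A ?I)"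
      unfolding graded_quotient_carrier using coset by blast
    fix y assume "y \<in> carrier B"
    then obtain b where b: "b \<in> carrier A" "y = h b" using B by blast
    have "?\<phi> (x \<otimes>\<^bsub>B\<^esub> y) = ?I +>\<^bsub>A\<^esub> (a \<otimes>\<^bsub>A\<^esub> b)" "?\<phi> (x \<oplus>\<^bsub>B\<^esub> y) = ?I +>\<^bsub>A\<^esub> (a \<oplus>\<^bsub>A\<^esub> b)"
      using coset[of "a \<otimes>\<^bsub>A\<^esub> b"] coset[of "a \<oplus>\<^bsub>A\<^esub> b"] a b by simp_all
    moreover have "?\<phi> x = ?I +>\<^bsub>A\<^esub> a" "?\<phi> y = ?I +>\<^bsub>A\<^esub> b" using coset a b by simp_all
    ultimately show "?\<phi> (x \<otimes>\<^bsub>B\<^esub> y) = ?\<phi> x \<otimes>\<^bsub>graded_quotient A ?I\<^esub> ?\<phi> y"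
      "?\<phi> (x \<oplus>\<^bsub>B\<^esub> y) = ?\<phi> x \<oplus>\<^bsub>graded_quotient A ?I\<^esub> ?\<phi> y"
      using a b by (simp_all add: FactRing_def I.rcoset_mult_add I.a_rcos_sum)
  next
    show "?\<phi> \<one>\<^bsub>B\<^esub> = \<one>\<^bsub>graded_quotient A ?I\<^esub>"
      using coset[OF A.one_closed] by (simp add: FactRing_def)
  qed
  moreover have "bij_betw ?\<phi> (carrier B) (carrier (graded_quotient A ?I))"
    unfolding bij_betw_def
  proof
    show "inj_on ?\<phi> (carrier B)"
    proof (rule inj_onI)
      fix x y assume "x \<in> carrier B" "?\<phi> x = ?\<phi> y"
      then show "x = y" using B[of x] by blast
    qed
    show "?\<phi> ` carrier B = carrier (graded_quotient A ?I)"
    proof (intro equalityI subsetI)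
      fix X assume "X \<in> ?\<phi> ` carrier B"
      then show "X \<in> carrier (graded_quotient A ?I)"
        unfolding graded_quotient_carrier using coset B by blast
    next
      fix X assume "X \<in> carrier (graded_quotient A ?I)"
      then obtain a where "a \<in> carrier A" "X = ?\<phi> (h a)"
        unfolding graded_quotient_carrier using coset by metis
      then show "X \<in> ?\<phi> ` carrier B" using h.hom_closed by blast
    qed
  qed
  moreover have "?\<phi> (c \<odot>\<^bsub>B\<^esub> x) = c \<odot>\<^bsub>graded_quotient A ?I\<^esub> ?\<phi> x" if "x \<in> carrier B" for c x
  proof -
    have *: "?I +>\<^bsub>A\<^esub> (c \<odot>\<^bsub>A\<^esub> a) = ?\<phi> (c \<odot>\<^bsub>B\<^esub> x)" if "a \<in> ?\<phi> x" for a
      using that coset[OF smult_closed[of a c]] smult[of a c] by simp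
    have "?\<phi> x \<noteq> {}" using B[OF that] by blast
    then have "(\<Union>a\<in>?\<phi> x. ?I +>\<^bsub>A\<^esub> (c \<odot>\<^bsub>A\<^esub> a)) = ?\<phi> (c \<odot>\<^bsub>B\<^esub> x)"
      by (rule UN_eq_const) (rule *)
    then show ?thesis by simp
  qed
  moreover have "?\<phi> ` hcomp B n = hcomp (graded_quotient A ?I) n" for n
  proof -
    have "?\<phi> ` hcomp B n = (\<lambda>a. ?\<phi> (h a)) ` hcomp A n"
      unfolding hcomp[symmetric] image_image ..
    also have "\<dots> = (\<lambda>a. ?I +>\<^bsub>A\<^esub> a) ` hcomp A n"
      using coset hcomp_closed by (intro image_cong) auto
    finally show ?thesis by simp
  qed
  ultimately show ?thesis by (simp add: graded_algebra_iso_def ring_iso_def)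
qed

section \<open>Restriction to a subgroup\<close>

definition restrict_cochain :: "'g set \<Rightarrow> ('g list \<Rightarrow> 'k::field) \<Rightarrow> 'g list \<Rightarrow> 'k" where
  "restrict_cochain H f xs = (if xs \<in> lists H then f xs else 0)"

context
  fixes k :: "'k::field itself" and G :: "('g, 'm) monoid_scheme" and H :: "'g set"
  assumes grp: "group G" and sub: "subgroup H G"
begin

interpretation group G by (rule grp)

abbreviation (input) "GH \<equiv> G\<lparr>carrier := H\<rparr>"

interpretation H: group GH by (rule subgroup.subgroup_is_group[OF sub grp])

lemma restrict_cochains: "f \<in> cochains k G \<Longrightarrow> restrict_cochain H f \<in> cochains k GH"
  unfolding cochains_def restrict_cochain_def by auto

lemma restrict_coboundary:
  "coboundary GH (restrict_cochain H f) = restrict_cochain H (coboundary G f)"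
proof
  fix xs
  have HG: "H \<subseteq> carrier G" using subgroup.subset[OF sub] .
  show "coboundary GH (restrict_cochain H f) xs = restrict_cochain H (coboundary G f) xs"
  proof (cases "xs \<noteq> [] \<and> xs \<in> lists H")
    case True
    have xs: "xs \<in> lists (carrier G)" using True HG lists_mono by blast
    have mem: "take i xs @ [xs ! i \<otimes>\<^bsub>G\<^esub> xs ! Suc i] @ drop (i + 2) xs \<in> lists H"
      if "i < length xs - 1" for i
      using True that subgroup.m_closed[OF sub] by (auto dest: in_set_takeD in_set_dropD)
    have "butlast xs \<in> lists H" "tl xs \<in> lists H"
      using True by (auto dest: in_set_butlastD list.set_sel(2))
    with True xs mem show ?thesis
      by (simp add: coboundary_def restrict_cochain_def)
  qed (auto simp: coboundary_def restrict_cochain_def)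
qed

text \<open>A list lies over \<open>H\<close> iff both pieces of each of its splittings do, so
  cutting off to 0 respects the product already on cochains.\<close>

lemma restrict_cup: "restrict_cochain H (cup f g) xs = cup (restrict_cochain H f) (restrict_cochain H g) xs"
proof -
  have iff: "xs \<in> lists H \<longleftrightarrow> take i xs \<in> lists H \<and> drop i xs \<in> lists H" for i
    by (simp flip: append_in_lists_conv)
  have "(if xs \<in> lists H then f (take i xs) * g (drop i xs) else 0) =
      restrict_cochain H f (take i xs) * restrict_cochain H g (drop i xs)" for i
    unfolding iff[of i] restrict_cochain_def by simp
  then show ?thesis by (simp add: cup_def restrict_cochain_def[of H "cup f g"] flip: sum.If_cases)
    (metis (no_types, lifting) sum.cong sum.neutral)
qed

lemma restrict_cocycle:
  "f \<in> carrier (cocycle_algebra k G) \<Longrightarrow> restrict_cochain H f \<in> carrier (cocycle_algebra k GH)"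
  unfolding cocycle_algebra_carrier H.cocycle_algebra_carrier
  by (simp add: restrict_cochains restrict_coboundary) (simp add: restrict_cochain_def fun_eq_iff)

lemma restrict_hom:
  "restrict_cochain H \<in> ring_hom (cocycle_algebra k G) (cocycle_algebra k GH)"
proof (rule ring_hom_memI)
  show "restrict_cochain H f \<in> carrier (cocycle_algebra k GH)" if "f \<in> carrier (cocycle_algebra k G)" for f
    using that by (rule restrict_cocycle)
next
  fix f g :: "'g list \<Rightarrow> 'k"
  have "restrict_cochain H (cup f g) = cup (restrict_cochain H f) (restrict_cochain H g)"
    by (rule ext) (rule restrict_cup)
  then show "restrict_cochain H (f \<otimes>\<^bsub>cocycle_algebra k G\<^esub> g) =
      restrict_cochain H f \<otimes>\<^bsub>cocycle_algebra k GH\<^esub> restrict_cochain H g"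
    by (simp add: cocycle_algebra_def)
qed (auto simp: cocycle_algebra_def restrict_cochain_def)

end

section \<open>Passage to cohomology\<close>

lemma quotient_ring_hom:
  assumes I: "ideal I Z" and R: "ring R" and r: "r \<in> ring_hom Z R"
    and ker: "\<And>x. x \<in> I \<Longrightarrow> r x = \<zero>\<^bsub>R\<^esub>"
  shows "\<And>x. x \<in> carrier Z \<Longrightarrow> the_elem (r ` (I +>\<^bsub>Z\<^esub> x)) = r x"
    and "(\<lambda>X. the_elem (r ` X)) \<in> ring_hom (graded_quotient Z I) R"
proof -
  interpret ideal I Z by fact
  interpret R: ring R by fact
  interpret r: ring_hom_ring Z R r by (rule ring_hom_ringI2[OF ring_axioms R r])
  show r_coset: "the_elem (r ` (I +>\<^bsub>Z\<^esub> x)) = r x" if x: "x \<in> carrier Z" for x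
  proof -
    have "r ` (I +>\<^bsub>Z\<^esub> x) \<subseteq> {r x}"
    proof (rule image_subsetI)
      fix y assume "y \<in> I +>\<^bsub>Z\<^esub> x"
      then obtain i where i: "i \<in> I" "y = i \<oplus>\<^bsub>Z\<^esub> x" by (auto simp: a_r_coset_def')
      then show "r y \<in> {r x}" using x ker[OF i(1)] a_Hcarr[OF i(1)] by simp
    qed
    moreover have "r x \<in> r ` (I +>\<^bsub>Z\<^esub> x)" by (rule imageI) (rule a_rcos_self[OF x])
    ultimately have "r ` (I +>\<^bsub>Z\<^esub> x) = {r x}" by (intro equalityI) simp_all
    then show ?thesis by simp
  qed
  show "(\<lambda>X. the_elem (r ` X)) \<in> ring_hom (graded_quotient Z I) R"
  proof (rule ring_hom_memI)
    fix X assume "X \<in> carrier (graded_quotient Z I)"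
    then obtain x where x: "x \<in> carrier Z" "X = I +>\<^bsub>Z\<^esub> x" unfolding graded_quotient_carrier by blast
    then show "the_elem (r ` X) \<in> carrier R" by (simp add: r_coset)
    fix Y assume "Y \<in> carrier (graded_quotient Z I)"
    then obtain y where y: "y \<in> carrier Z" "Y = I +>\<^bsub>Z\<^esub> y" unfolding graded_quotient_carrier by blast
    show "the_elem (r ` (X \<otimes>\<^bsub>graded_quotient Z I\<^esub> Y)) = the_elem (r ` X) \<otimes>\<^bsub>R\<^esub> the_elem (r ` Y)"
      using x y by (simp add: FactRing_def rcoset_mult_add r_coset)
    show "the_elem (r ` (X \<oplus>\<^bsub>graded_quotient Z I\<^esub> Y)) = the_elem (r ` X) \<oplus>\<^bsub>R\<^esub> the_elem (r ` Y)"
      using x y by (simp add: FactRing_def a_rcos_sum r_coset)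
  next
    show "the_elem (r ` \<one>\<^bsub>graded_quotient Z I\<^esub>) = \<one>\<^bsub>R\<^esub>"
      by (simp add: FactRing_def r_coset)
  qed
qed

text \<open>The scalar action on the quotient is a union over all representatives. These differ by
  coboundaries, which are stable under scaling, so all members of the union agree.\<close>

lemma smult_cohomology:
  assumes "group G" and f: "f \<in> carrier (cocycle_algebra k G)"
  shows "c \<odot>\<^bsub>cohomology k G\<^esub> (coboundaries k G +>\<^bsub>cocycle_algebra k G\<^esub> f) =
    coboundaries k G +>\<^bsub>cocycle_algebra k G\<^esub> (\<lambda>xs. c * f xs)"
proof -
  interpret group G by fact
  let ?Z = "cocycle_algebra k G" and ?C = "coboundaries k G"
  interpret I: ideal ?C ?Z by (rule ideal_coboundaries)
  have cf: "(\<lambda>xs. c * f xs) \<in> carrier ?Z"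
    using f by (simp add: cocycle_algebra_carrier fun_eq_iff coboundary_scale scale_cochains)
  have *: "?C +>\<^bsub>?Z\<^esub> (c \<odot>\<^bsub>?Z\<^esub> g) = ?C +>\<^bsub>?Z\<^esub> (\<lambda>xs. c * f xs)" if g: "g \<in> ?C +>\<^bsub>?Z\<^esub> f" for g
  proof -
    obtain b where b: "b \<in> cochains k G" "g = (\<lambda>xs. coboundary G b xs + f xs)"
      using g by (auto simp: a_r_coset_def' coboundaries_def cocycle_algebra_def)
    then have "c \<odot>\<^bsub>?Z\<^esub> g = coboundary G (\<lambda>xs. c * b xs) \<oplus>\<^bsub>?Z\<^esub> (\<lambda>xs. c * f xs)"
      by (simp add: cocycle_algebra_def fun_eq_iff coboundary_scale algebra_simps)
    also have "\<dots> \<in> ?C +>\<^bsub>?Z\<^esub> (\<lambda>xs. c * f xs)"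
      unfolding a_r_coset_def' coboundaries_def using b(1) by (auto intro: scale_cochains)
    finally show ?thesis by (rule I.a_repr_independence[OF _ cf I.a_subgroup, symmetric])
  qed
  have "?C +>\<^bsub>?Z\<^esub> f \<noteq> {}" using I.a_rcos_self[OF f] by blast
  then have "(\<Union>g\<in>?C +>\<^bsub>?Z\<^esub> f. ?C +>\<^bsub>?Z\<^esub> (c \<odot>\<^bsub>?Z\<^esub> g)) = ?C +>\<^bsub>?Z\<^esub> (\<lambda>xs. c * f xs)"
    by (rule UN_eq_const) (rule *)
  then show ?thesis by (simp add: cohomology_def)
qed

text \<open>Reduces the isomorphism to statements about cochains. The vanishing clause of
  \<open>surj\<close> lets a cocycle of degree n lift to one of degree n, as the grading demands.
  That \<open>z\<close> restricts to zero puts the ideal into the kernel of restriction;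
  \<open>ker\<close> gives the other inclusion.\<close>

lemma restriction_iso:
  fixes k :: "'k::field itself" and G :: "('g, 'm) monoid_scheme" and H :: "'g set"
  defines "ZG \<equiv> cocycle_algebra k G" and "ZH \<equiv> cocycle_algebra k (G\<lparr>carrier := H\<rparr>)"
  assumes grp: "group G" and sub: "subgroup H G"
    and surj: "\<And>f. f \<in> carrier ZH \<Longrightarrow>
      \<exists>F\<in>carrier ZG. \<exists>b\<in>cochains k (G\<lparr>carrier := H\<rparr>).
        (\<forall>xs. f xs = coboundary (G\<lparr>carrier := H\<rparr>) b xs + restrict_cochain H F xs) \<and>
        (\<forall>m. (\<forall>xs. length xs = m \<longrightarrow> f xs = 0) \<longrightarrow> (\<forall>xs. length xs = m \<longrightarrow> F xs = 0))"
    and z: "z \<in> carrier ZG" "restrict_cochain H z = (\<lambda>_. 0)"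
    and ker: "\<And>F b. F \<in> carrier ZG \<Longrightarrow> b \<in> cochains k (G\<lparr>carrier := H\<rparr>) \<Longrightarrow>
      restrict_cochain H F = coboundary (G\<lparr>carrier := H\<rparr>) b \<Longrightarrow>
      \<exists>u\<in>carrier ZG. \<exists>v\<in>cochains k G. \<forall>xs. F xs = coboundary G v xs + cup z u xs"
  shows "\<exists>\<phi>. \<phi> \<in> graded_algebra_iso (cohomology k (G\<lparr>carrier := H\<rparr>))
    (graded_quotient (cohomology k G) (Idl\<^bsub>cohomology k G\<^esub> {coboundaries k G +>\<^bsub>ZG\<^esub> z}))"
proof -
  let ?GH = "G\<lparr>carrier := H\<rparr>"
  interpret G: group G by fact
  interpret H: group ?GH by (rule subgroup.subgroup_is_group[OF sub grp])
  let ?CG = "coboundaries k G" and ?CH = "coboundaries k ?GH"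
  let ?A = "cohomology k G" and ?B = "cohomology k ?GH"
  interpret CG: ideal ?CG ZG unfolding ZG_def by (rule G.ideal_coboundaries)
  interpret CH: ideal ?CH ZH unfolding ZH_def by (rule H.ideal_coboundaries)
  have A: "?A = graded_quotient ZG ?CG" and B: "?B = graded_quotient ZH ?CH"
    by (simp_all add: cohomology_def ZG_def ZH_def)
  interpret A: ring ?A unfolding A by (rule ring_graded_quotient) unfold_locales
  interpret B: ring ?B unfolding B by (rule ring_graded_quotient) unfold_locales
  let ?res = "restrict_cochain H"
  define r where "r f = ?CH +>\<^bsub>ZH\<^esub> ?res f" for f
  define h where "h X = the_elem (r ` X)" for X
  have zero: "?CH +>\<^bsub>ZH\<^esub> f = \<zero>\<^bsub>?B\<^esub> \<longleftrightarrow> f \<in> ?CH" if "f \<in> carrier ZH" for f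
    using CH.a_rcos_const CH.a_rcos_self[OF that] by (auto simp: B FactRing_def)
  have "(\<lambda>f. ?CH +>\<^bsub>ZH\<^esub> f) \<in> ring_hom ZH ?B"
    using CH.rcos_ring_hom by (simp add: ring_hom_def B)
  then have r: "r \<in> ring_hom ZG ?B"
    using ring_hom_trans[OF restrict_hom[OF grp sub]]
    by (auto simp: r_def[abs_def] ZG_def ZH_def comp_def)
  have r_closed: "?res f \<in> carrier ZH" if "f \<in> carrier ZG" for f
    using restrict_cocycle[OF grp sub] that by (simp add: ZG_def ZH_def)
  have r_zero: "r f = \<zero>\<^bsub>?B\<^esub>" if f: "f \<in> ?CG" for f
  proof -
    obtain b where b: "b \<in> cochains k G" "f = coboundary G b" using f by (auto simp: coboundaries_def)
    then have "?res f \<in> ?CH"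
      unfolding coboundaries_def b(2) restrict_coboundary[OF grp sub, symmetric]
      by (intro imageI restrict_cochains[OF grp sub])
    then show ?thesis using zero[OF r_closed] CG.a_Hcarr[OF f] by (simp add: r_def)
  qed
  note q = quotient_ring_hom[OF CG.ideal_axioms B.ring_axioms r r_zero]
  have h: "h (?CG +>\<^bsub>ZG\<^esub> f) = r f" if "f \<in> carrier ZG" for f
    unfolding h_def by (rule q(1)[OF _ that])
  have h_hom: "h \<in> ring_hom ?A ?B" using q(2) by (simp add: h_def[abs_def] A)
  have carA: "X \<in> carrier ?A \<longleftrightarrow> (\<exists>f\<in>carrier ZG. X = ?CG +>\<^bsub>ZG\<^esub> f)" for X
    unfolding A graded_quotient_carrier ..
  have carB: "X \<in> carrier ?B \<longleftrightarrow> (\<exists>f\<in>carrier ZH. X = ?CH +>\<^bsub>ZH\<^esub> f)" for X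
    unfolding B graded_quotient_carrier ..
  have lift: "\<exists>F\<in>carrier ZG. ?CH +>\<^bsub>ZH\<^esub> f = r F \<and>
      (\<forall>m. (\<forall>xs. length xs = m \<longrightarrow> f xs = 0) \<longrightarrow> (\<forall>xs. length xs = m \<longrightarrow> F xs = 0))"
    if f: "f \<in> carrier ZH" for f
  proof -
    obtain F b where F: "F \<in> carrier ZG" and b: "b \<in> cochains k ?GH"
      and eq: "\<forall>xs. f xs = coboundary ?GH b xs + ?res F xs"
      and deg: "\<forall>m. (\<forall>xs. length xs = m \<longrightarrow> f xs = 0) \<longrightarrow> (\<forall>xs. length xs = m \<longrightarrow> F xs = 0)"
      using surj[OF f] by blast
    have "f = coboundary ?GH b \<oplus>\<^bsub>ZH\<^esub> ?res F"
      using eq by (simp add: ZH_def cocycle_algebra_def fun_eq_iff)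
    then have "f \<in> ?CH +>\<^bsub>ZH\<^esub> ?res F"
      using b by (auto simp: a_r_coset_def' coboundaries_def)
    then have "?CH +>\<^bsub>ZH\<^esub> f = r F"
      unfolding r_def by (rule CH.a_repr_independence[OF _ r_closed[OF F] CH.a_subgroup, symmetric])
    with F deg show ?thesis by blast
  qed
  interpret h: ring_hom_ring ?A ?B h
    by (rule ring_hom_ringI2[OF A.ring_axioms B.ring_axioms h_hom])
  have smult_closed: "(\<lambda>xs. c * f xs) \<in> carrier ZG" if "f \<in> carrier ZG" for c f
    using that
    by (simp add: ZG_def G.cocycle_algebra_carrier fun_eq_iff coboundary_scale scale_cochains)
  have smultA: "c \<odot>\<^bsub>?A\<^esub> (?CG +>\<^bsub>ZG\<^esub> f) = ?CG +>\<^bsub>ZG\<^esub> (\<lambda>xs. c * f xs)" if "f \<in> carrier ZG" for c f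
    using smult_cohomology[OF grp] that by (simp add: ZG_def)
  have smultB: "c \<odot>\<^bsub>?B\<^esub> (?CH +>\<^bsub>ZH\<^esub> f) = ?CH +>\<^bsub>ZH\<^esub> (\<lambda>xs. c * f xs)" if "f \<in> carrier ZH" for c f
    using smult_cohomology[OF H.group_axioms] that by (simp add: ZH_def)
  have "(\<lambda>b. {a \<in> carrier ?A. h a = b}) \<in> graded_algebra_iso ?B (graded_quotient ?A (a_kernel ?A ?B h))"
  proof (rule graded_quotient_iso[OF A.ring_axioms B.ring_axioms h_hom])
    show "h ` carrier ?A = carrier ?B"
    proof (intro equalityI subsetI)
      fix Y assume "Y \<in> carrier ?B"
      then obtain f where "f \<in> carrier ZH" "Y = ?CH +>\<^bsub>ZH\<^esub> f" unfolding carB by blast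
      then obtain F where "F \<in> carrier ZG" "Y = r F" using lift by blast
      then have "Y = h (?CG +>\<^bsub>ZG\<^esub> F)" "?CG +>\<^bsub>ZG\<^esub> F \<in> carrier ?A" using h carA by auto
      then show "Y \<in> h ` carrier ?A" by blast
    qed auto
    fix c X assume "X \<in> carrier ?A"
    then obtain f where f: "f \<in> carrier ZG" "X = ?CG +>\<^bsub>ZG\<^esub> f" unfolding carA by blast
    show "c \<odot>\<^bsub>?A\<^esub> X \<in> carrier ?A"
      unfolding f(2) smultA[OF f(1)] carA using smult_closed[OF f(1)] by blast
    have "?res (\<lambda>xs. c * f xs) = (\<lambda>xs. c * ?res f xs)"
      by (rule ext) (simp add: restrict_cochain_def)
    then show "h (c \<odot>\<^bsub>?A\<^esub> X) = c \<odot>\<^bsub>?B\<^esub> h X"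
      using f smult_closed[OF f(1)] r_closed[OF f(1)] by (simp add: smultA smultB h r_def)
  next
    fix n
    have sub: "hcomp ZG n \<subseteq> carrier ZG" by (auto simp: ZG_def cocycle_algebra_def)
    then show "hcomp ?A n \<subseteq> carrier ?A" using carA by (auto simp: A)
    show "h ` hcomp ?A n = hcomp ?B n"
    proof (intro equalityI subsetI)
      fix Y assume "Y \<in> h ` hcomp ?A n"
      then obtain f where f: "f \<in> hcomp ZG n" "Y = h (?CG +>\<^bsub>ZG\<^esub> f)" by (auto simp: A)
      then have "?res f \<in> hcomp ZH n"
        using r_closed[of f] sub
        by (auto simp: ZG_def ZH_def cocycle_algebra_def restrict_cochain_def)
      then show "Y \<in> hcomp ?B n" using f sub h by (auto simp: B r_def)
    next
      fix Y assume "Y \<in> hcomp ?B n"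
      then obtain f where f: "f \<in> hcomp ZH n" "Y = ?CH +>\<^bsub>ZH\<^esub> f" by (auto simp: B)
      then have "f \<in> carrier ZH" by (auto simp: ZH_def cocycle_algebra_def)
      then obtain F where F: "F \<in> carrier ZG" "Y = r F"
        and deg: "\<forall>m. (\<forall>xs. length xs = m \<longrightarrow> f xs = 0) \<longrightarrow> (\<forall>xs. length xs = m \<longrightarrow> F xs = 0)"
        using lift f(2) by blast
      have "length xs = n" if "F xs \<noteq> 0" for xs
      proof (rule ccontr)
        assume "length xs \<noteq> n"
        then have "\<forall>ys. length ys = length xs \<longrightarrow> f ys = 0"
          using f(1) by (auto simp: ZH_def cocycle_algebra_def)
        then have "F xs = 0" using deg by blast
        with that show False by simp
      qed
      then have "F \<in> hcomp ZG n" using F(1) by (auto simp: ZG_def cocycle_algebra_def)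
      then show "Y \<in> h ` hcomp ?A n" using F h by (auto simp: A)
    qed
  qed
  moreover have "a_kernel ?A ?B h = Idl\<^bsub>?A\<^esub> {?CG +>\<^bsub>ZG\<^esub> z}"
  proof
    have zA: "?CG +>\<^bsub>ZG\<^esub> z \<in> carrier ?A" using z(1) carA by blast
    have res_z: "?res z = \<zero>\<^bsub>ZH\<^esub>" unfolding z(2) by (simp add: ZH_def cocycle_algebra_def)
    have "?res z \<in> ?CH"
      unfolding res_z by (rule additive_subgroup.zero_closed[OF CH.additive_subgroup_axioms])
    then have "r z = \<zero>\<^bsub>?B\<^esub>" unfolding r_def zero[OF r_closed[OF z(1)]] .
    then have "?CG +>\<^bsub>ZG\<^esub> z \<in> a_kernel ?A ?B h" using zA unfolding a_kernel_def' by (simp add: h[OF z(1)])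
    then show "Idl\<^bsub>?A\<^esub> {?CG +>\<^bsub>ZG\<^esub> z} \<subseteq> a_kernel ?A ?B h"
      by (intro A.genideal_minimal[OF h.kernel_is_ideal]) simp
    have J: "ideal (Idl\<^bsub>?A\<^esub> {?CG +>\<^bsub>ZG\<^esub> z}) ?A" using zA by (intro A.genideal_ideal) simp
    show "a_kernel ?A ?B h \<subseteq> Idl\<^bsub>?A\<^esub> {?CG +>\<^bsub>ZG\<^esub> z}"
    proof
      fix X assume "X \<in> a_kernel ?A ?B h"
      then have X: "X \<in> carrier ?A" "h X = \<zero>\<^bsub>?B\<^esub>" unfolding a_kernel_def' by blast+
      from X(1) obtain F where F: "F \<in> carrier ZG" "X = ?CG +>\<^bsub>ZG\<^esub> F" unfolding carA by blast
      have "r F = \<zero>\<^bsub>?B\<^esub>" using X(2) unfolding F(2) h[OF F(1)] .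
      then have "?res F \<in> ?CH" unfolding r_def zero[OF r_closed[OF F(1)]] .
      then obtain b where b: "b \<in> cochains k ?GH" "?res F = coboundary ?GH b"
        unfolding coboundaries_def by blast
      obtain u v where u: "u \<in> carrier ZG" and v: "v \<in> cochains k G"
        and eq: "\<forall>xs. F xs = coboundary G v xs + cup z u xs"
        using ker[OF F(1) b] by blast
      have "F = coboundary G v \<oplus>\<^bsub>ZG\<^esub> (z \<otimes>\<^bsub>ZG\<^esub> u)"
        using eq by (simp add: ZG_def cocycle_algebra_def fun_eq_iff)
      then have "F \<in> ?CG +>\<^bsub>ZG\<^esub> (z \<otimes>\<^bsub>ZG\<^esub> u)"
        using v by (auto simp: a_r_coset_def' coboundaries_def)
      then have "X = ?CG +>\<^bsub>ZG\<^esub> (z \<otimes>\<^bsub>ZG\<^esub> u)"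
        unfolding F(2) using z(1) u by (intro CG.a_repr_independence[OF _ _ CG.a_subgroup, symmetric]) auto
      also have "\<dots> = (?CG +>\<^bsub>ZG\<^esub> z) \<otimes>\<^bsub>?A\<^esub> (?CG +>\<^bsub>ZG\<^esub> u)"
        using z(1) u by (simp add: A FactRing_def CG.rcoset_mult_add)
      also have "\<dots> \<in> Idl\<^bsub>?A\<^esub> {?CG +>\<^bsub>ZG\<^esub> z}"
      proof (rule ideal.I_r_closed[OF J])
        show "?CG +>\<^bsub>ZG\<^esub> z \<in> Idl\<^bsub>?A\<^esub> {?CG +>\<^bsub>ZG\<^esub> z}" by (rule A.genideal_self'[OF zA])
        show "?CG +>\<^bsub>ZG\<^esub> u \<in> carrier ?A" unfolding carA using u by blast
      qed
      finally show "X \<in> Idl\<^bsub>?A\<^esub> {?CG +>\<^bsub>ZG\<^esub> z}" .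
    qed
  qed
  ultimately show ?thesis by (auto simp only:)
qed

section \<open>Infinite cyclic quotients\<close>

text \<open>The indefinite sum of \<open>u\<close> vanishing at 0, on both sides of 0: a right
  inverse of the difference operator for functions on the integers. At most one of the two sums is
  nonempty.\<close>

definition antidiff :: "(int \<Rightarrow> 'k::ab_group_add) \<Rightarrow> int \<Rightarrow> 'k" where
  "antidiff u i = (\<Sum>j\<in>{0..<i}. u j) - (\<Sum>j\<in>{i..<0}. u j)"

lemma antidiff_step: "antidiff u (i + 1) = antidiff u i + u i"
proof (cases "0 \<le> i")
  case True
  then have "{0..<i + 1} = insert i {0..<i}" "{i..<0} = {}" "{i + 1..<0} = {}" by auto
  then show ?thesis by (simp add: antidiff_def)
next
  case False
  then have "{i..<0} = insert i {i + 1..<0}" "{0..<i} = {}" "{0..<i + 1} = {}" by auto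
  then show ?thesis by (simp add: antidiff_def)
qed

lemma prods_carrier_update [simp]: "prods (G\<lparr>carrier := H\<rparr>) x xs = prods G x xs"
  by (induction xs arbitrary: x) simp_all

lemma (in group) diffs_subgroup:
  assumes "subgroup H G" "ys \<in> lists H"
  shows "diffs (G\<lparr>carrier := H\<rparr>) ys = diffs G ys"
  using assms(2)
  by (induction ys rule: induct_list012) (simp_all add: m_inv_consistent[OF assms(1)])

text \<open>The element \<open>s\<close> splits the character \<open>ht\<close>, so the group is the
  semidirect product of the kernel of \<open>ht\<close> with an infinite cyclic group.\<close>

locale height_group = group G for G (structure) +
  fixes ht :: "'a \<Rightarrow> int" and s :: 'a
  assumes ht_mult: "\<And>x y. x \<in> carrier G \<Longrightarrow> y \<in> carrier G \<Longrightarrow> ht (x \<otimes> y) = ht x + ht y"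
    and s_closed [simp]: "s \<in> carrier G" and ht_s: "ht s = 1"
begin

definition Ker :: "'a set" where
  "Ker = {g \<in> carrier G. ht g = 0}"

abbreviation trans :: "'a \<Rightarrow> 'a list \<Rightarrow> 'a list" where
  "trans g \<equiv> map (\<lambda>x. g \<otimes> x)"

text \<open>These functions live on tuples of the whole group, which is a free
  \<open>Ker\<close>-set. They still compute the cohomology of \<open>Ker\<close>, and unlike
  cochains on \<open>Ker\<close> itself they can be translated by \<open>s\<close>.\<close>

definition ker_inv :: "('a list \<Rightarrow> 'k) \<Rightarrow> bool" where
  "ker_inv F \<longleftrightarrow> (\<forall>b\<in>Ker. \<forall>gs\<in>lists (carrier G). F (trans b gs) = F gs)"

text \<open>Invariance in degree \<open>n\<close>, that is, on lists of length \<open>n + 1\<close>.\<close>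

definition grp_inv :: "nat \<Rightarrow> ('a list \<Rightarrow> 'k) \<Rightarrow> bool" where
  "grp_inv n F \<longleftrightarrow>
    (\<forall>g\<in>carrier G. \<forall>gs\<in>lists (carrier G). length gs = Suc n \<longrightarrow> F (trans g gs) = F gs)"

definition closed_in :: "nat \<Rightarrow> ('a list \<Rightarrow> 'k::comm_ring_1) \<Rightarrow> bool" where
  "closed_in n F \<longleftrightarrow> (\<forall>gs\<in>lists (carrier G). length gs = Suc (Suc n) \<longrightarrow> hbd F gs = 0)"

lemma ht_one [simp]: "ht \<one> = 0"
proof -
  have "ht (\<one> \<otimes> \<one>) = ht \<one> + ht \<one>" by (rule ht_mult) simp_all
  then show ?thesis by simp
qed

lemma ht_inv: "x \<in> carrier G \<Longrightarrow> ht (inv x) = - ht x"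
proof -
  assume x: "x \<in> carrier G"
  then have "ht (x \<otimes> inv x) = ht x + ht (inv x)" by (intro ht_mult) simp_all
  with x show ?thesis by (simp del: ht_mult)
qed

lemma ht_int_pow: "ht (s [^] (i::int)) = i"
proof -
  have nat: "ht (s [^] (n::nat)) = int n" for n
    by (induction n) (simp_all add: ht_mult ht_s)
  show ?thesis
  proof (cases i rule: int_cases2)
    case (nonneg n)
    then show ?thesis using nat[of n] by (simp add: int_pow_int)
  next
    case (nonpos n)
    then show ?thesis using nat[of n] by (simp add: int_pow_neg int_pow_int ht_inv)
  qed
qed

lemma subgroup_Ker: "subgroup Ker G"
  by (rule subgroupI) (auto simp: Ker_def ht_mult ht_inv intro: exI[of _ \<one>])

lemma trans_in_lists [simp]: "gs \<in> lists (carrier G) \<Longrightarrow> g \<in> carrier G \<Longrightarrow> trans g gs \<in> lists (carrier G)"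
  by auto

lemma trans_trans:
  "gs \<in> lists (carrier G) \<Longrightarrow> g \<in> carrier G \<Longrightarrow> h \<in> carrier G \<Longrightarrow> trans g (trans h gs) = trans (g \<otimes> h) gs"
  by (auto simp: m_assoc)

lemma trans_one: "gs \<in> lists (carrier G) \<Longrightarrow> trans \<one> gs = gs"
  by (induction gs) auto

lemma ker_inv_ht:
  assumes "ker_inv F" "gs \<in> lists (carrier G)" "g \<in> carrier G" "h \<in> carrier G" "ht g = ht h"
  shows "F (trans g gs) = F (trans h gs)"
proof -
  have "g \<otimes> inv h \<in> Ker" using assms by (simp add: Ker_def ht_mult ht_inv)
  then have "F (trans (g \<otimes> inv h) (trans h gs)) = F (trans h gs)"
    using assms unfolding ker_inv_def by (simp del: map_map)
  then show ?thesis using assms by (simp add: trans_trans m_assoc del: map_map)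
qed

text \<open>Each \<open>g\<close> has the same height as \<open>s [^] ht g\<close>, which reduces
  invariance to powers of \<open>s\<close>. Both hypotheses concern degree \<open>n\<close> only,
  because one summand of the cochain in the later application is known to be invariant in that
  degree only.\<close>

lemma grp_invI:
  assumes F: "\<And>g h gs. gs \<in> lists (carrier G) \<Longrightarrow> length gs = Suc n \<Longrightarrow> g \<in> carrier G \<Longrightarrow>
      h \<in> carrier G \<Longrightarrow> ht g = ht h \<Longrightarrow> F (trans g gs) = F (trans h gs)"
    and s: "\<And>gs. gs \<in> lists (carrier G) \<Longrightarrow> length gs = Suc n \<Longrightarrow> F (trans s gs) = F gs"
  shows "grp_inv n F"
  unfolding grp_inv_def
proof (intro ballI impI)
  fix g gs assume g: "g \<in> carrier G" and gs: "gs \<in> lists (carrier G)" "length gs = Suc n"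
  have step: "F (trans (s [^] (i + 1)) gs) = F (trans (s [^] i) gs)" for i :: int
  proof -
    have "s [^] (i + 1) = s \<otimes> s [^] i" by (metis add.commute int_pow_1 int_pow_mult s_closed)
    then have *: "trans (s [^] (i + 1)) gs = trans s (trans (s [^] i) gs)"
      using gs by (simp add: trans_trans del: map_map)
    show ?thesis unfolding * using gs by (intro s) (simp_all del: map_map)
  qed
  have "F (trans (s [^] i) gs) = F gs" for i :: int
  proof (induction i rule: int_induct[where k = 0])
    case base
    show ?case using gs by (simp add: trans_one)
  next
    case (step1 i)
    then show ?case using step[of i] by simp
  next
    case (step2 i)
    then show ?case using step[of "i - 1"] by simp
  qed
  then show "F (trans g gs) = F gs"
    using F[OF gs g, of "s [^] ht g"] by (simp add: ht_int_pow)
qed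

lemma ker_inv_diff: "ker_inv F \<Longrightarrow> ker_inv F' \<Longrightarrow> ker_inv (\<lambda>gs. F gs - F' gs)"
  by (simp add: ker_inv_def)

lemma ker_inv_hbd:
  assumes "ker_inv F" shows "ker_inv (hbd F)"
  unfolding ker_inv_def
proof (intro ballI)
  fix b gs assume "b \<in> Ker" "gs \<in> lists (carrier G)"
  then show "hbd F (trans b gs) = hbd F gs"
    unfolding hbd_map using assms by (intro hbd_cong) (auto simp: ker_inv_def)
qed

lemma ker_inv_trans:
  assumes "ker_inv F" "g \<in> carrier G" shows "ker_inv (\<lambda>gs. F (trans g gs))"
  unfolding ker_inv_def
proof (intro ballI)
  fix b gs assume b: "b \<in> Ker" and gs: "gs \<in> lists (carrier G)"
  then have "F (trans (g \<otimes> b) gs) = F (trans g gs)"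
    using assms by (intro ker_inv_ht) (auto simp: Ker_def ht_mult)
  then show "F (trans g (trans b gs)) = F (trans g gs)"
    using b gs assms(2) by (simp add: trans_trans Ker_def del: map_map)
qed

text \<open>Let u(i) be the value of \<open>F\<close> at the translate of \<open>gs\<close> by the
  power of \<open>s\<close> that gives its first entry the height i. Replacing \<open>gs\<close> by
  its translate by \<open>s\<close> leaves u unchanged and raises the height of the first entry by
  one, so the indefinite sum of u at that height has the difference \<open>F\<close>. The empty list
  is fixed by translations, whence \<open>F [] = 0\<close>.\<close>

lemma shift_surj:
  assumes F: "ker_inv F" and "F [] = (0::'k::field)"
  obtains K where "ker_inv K" "K [] = 0"
    "\<And>gs. gs \<in> lists (carrier G) \<Longrightarrow> K (trans s gs) - K gs = F gs"
proof -
  let ?u = "\<lambda>gs i. F (trans (s [^] (i - ht (hd gs))) gs)"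
  define K where "K gs = (if gs = [] then 0 else antidiff (?u gs) (ht (hd gs)))" for gs
  have "K [] = 0" by (simp add: K_def)
  moreover have "ker_inv K"
    unfolding ker_inv_def
  proof (intro ballI)
    fix b gs assume b: "b \<in> Ker" and gs: "gs \<in> lists (carrier G)"
    show "K (trans b gs) = K gs"
    proof (cases gs)
      case (Cons g hs)
      have hd: "ht (hd (trans b gs)) = ht (hd gs)"
        using b gs Cons by (simp add: ht_mult Ker_def)
      have "F (trans (s [^] i) (trans b gs)) = F (trans (s [^] i) gs)" for i :: int
        by (rule ker_inv_trans[OF F, unfolded ker_inv_def, rule_format, OF _ b gs]) simp
      then have "?u (trans b gs) = ?u gs" unfolding hd by (intro ext)
      then show ?thesis using Cons hd by (simp add: K_def)
    qed simp
  qed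
  moreover have "K (trans s gs) - K gs = F gs" if gs: "gs \<in> lists (carrier G)" for gs
  proof (cases gs)
    case Nil
    then show ?thesis using assms by (simp add: K_def)
  next
    case (Cons g hs)
    have hd: "ht (hd (trans s gs)) = ht (hd gs) + 1"
      using gs Cons by (simp add: ht_mult ht_s)
    have *: "trans (s [^] (i - (ht (hd gs) + 1))) (trans s gs) = trans (s [^] (i - ht (hd gs))) gs" for i
    proof -
      have "s [^] (i - (ht (hd gs) + 1)) \<otimes> s = s [^] (i - ht (hd gs))"
        using int_pow_mult[OF s_closed, of "i - (ht (hd gs) + 1)" 1] by (simp add: int_pow_1)
      then show ?thesis using gs by (simp only: trans_trans int_pow_closed s_closed)
    qed
    have "?u (trans s gs) = ?u gs" unfolding hd * by (rule HOL.refl)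
    then have "K (trans s gs) = antidiff (?u gs) (ht (hd gs) + 1)"
      using Cons hd by (simp add: K_def)
    then show ?thesis using gs Cons by (simp add: K_def antidiff_step trans_one)
  qed
  ultimately show ?thesis using that[of K] by simp
qed

text \<open>The hypothesis of the Wang argument: \<open>s\<close> acts trivially on the cohomology of the kernel.\<close>

definition trivial_monodromy :: "'k::field itself \<Rightarrow> bool" where
  "trivial_monodromy k \<longleftrightarrow> (\<forall>n. \<forall>F :: 'a list \<Rightarrow> 'k. ker_inv F \<longrightarrow> closed_in n F \<longrightarrow>
    (\<exists>K. ker_inv K \<and> K [] = 0 \<and>
      (\<forall>gs\<in>lists (carrier G). length gs = Suc n \<longrightarrow> F (trans s gs) - F gs = hbd K gs)))"

text \<open>Write T for translation by \<open>s\<close>. Solve first (T - 1) F = d K by hypothesis,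
  then (T - 1) W = K by \<open>shift_surj\<close>. As T commutes with d, the cochain F - d W is
  fixed by T.\<close>

lemma cohomologous_grp_inv:
  fixes F :: "'a list \<Rightarrow> 'k::field"
  assumes "trivial_monodromy TYPE('k)" and F: "ker_inv F" "closed_in n F"
  obtains U W where "ker_inv W" "W [] = 0" "grp_inv n U" "closed_in n U"
    "\<And>gs. U gs = F gs - hbd W gs"
proof -
  obtain K where K: "ker_inv K" "K [] = 0"
    and FK: "\<And>gs. gs \<in> lists (carrier G) \<Longrightarrow> length gs = Suc n \<Longrightarrow> F (trans s gs) - F gs = hbd K gs"
    using assms unfolding trivial_monodromy_def by meson
  obtain W where W: "ker_inv W" "W [] = 0"
    and KW: "\<And>gs. gs \<in> lists (carrier G) \<Longrightarrow> W (trans s gs) - W gs = K gs"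
    using shift_surj[OF K] by metis
  let ?U = "\<lambda>gs. F gs - hbd W gs"
  have U: "ker_inv ?U" by (intro ker_inv_diff F ker_inv_hbd W)
  have "grp_inv n ?U"
  proof (rule grp_invI)
    fix gs assume gs: "gs \<in> lists (carrier G)" "length gs = Suc n"
    have "hbd W (trans s gs) - hbd W gs = hbd (\<lambda>ys. W (trans s ys) - W ys) gs"
      by (simp only: hbd_map hbd_diff)
    also have "\<dots> = hbd K gs" by (rule hbd_cong[OF gs(1)]) (rule KW)
    finally show "?U (trans s gs) = ?U gs" using FK[OF gs] by (simp add: algebra_simps)
  qed (rule ker_inv_ht[OF U])
  moreover have "closed_in n ?U" using F(2) unfolding closed_in_def by (simp add: hbd_diff)
  ultimately show ?thesis using that W by blast
qed

section \<open>From cochains of the kernel to invariant cochains of the group\<close>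

definition retr :: "'a \<Rightarrow> 'a" where
  "retr g = g \<otimes> s [^] (- ht g)"

lemma retr_in_Ker: "g \<in> carrier G \<Longrightarrow> retr g \<in> Ker"
  by (simp add: retr_def Ker_def ht_mult ht_int_pow)

lemma retr_Ker: "b \<in> Ker \<Longrightarrow> retr b = b"
  by (simp add: retr_def Ker_def)

text \<open>The power of \<open>s\<close> in \<open>retr\<close> stands on the right, so left
  multiplication by \<open>Ker\<close> passes through. Equivariance is what makes the pullback along
  \<open>retr\<close> of a homogeneous cochain \<open>Ker\<close>-invariant.\<close>

lemma retr_mult: "b \<in> Ker \<Longrightarrow> g \<in> carrier G \<Longrightarrow> retr (b \<otimes> g) = b \<otimes> retr g"
  by (simp add: retr_def Ker_def ht_mult m_assoc)

lemma map_retr_in_lists: "gs \<in> lists (carrier G) \<Longrightarrow> map retr gs \<in> lists Ker"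
  using retr_in_Ker by auto

lemma Ker_subset: "Ker \<subseteq> carrier G"
  by (auto simp: Ker_def)

lemma lists_Ker: "gs \<in> lists Ker \<Longrightarrow> gs \<in> lists (carrier G)"
  using Ker_subset by auto

lemma map_retr_Ker: "gs \<in> lists Ker \<Longrightarrow> map retr gs = gs"
  by (induction gs) (auto simp: retr_Ker)

abbreviation "GK \<equiv> G\<lparr>carrier := Ker\<rparr>"

sublocale K: group GK
  by (rule subgroup.subgroup_is_group[OF subgroup_Ker group_axioms])

lemma ker_inv_homog_retr: "ker_inv (\<lambda>gs. homog GK f (map retr gs))"
  unfolding ker_inv_def
proof (intro ballI)
  fix b gs assume b: "b \<in> Ker" and gs: "gs \<in> lists (carrier G)"
  have *: "map retr (trans b gs) = trans b (map retr gs)"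
    using b gs by (auto simp: retr_mult)
  show "homog GK f (map retr (trans b gs)) = homog GK f (map retr gs)"
    unfolding *
    using K.homog_map_mult[of "map retr gs" b f] b map_retr_in_lists[OF gs] by (simp del: map_map)
qed

lemma hbd_homog_retr:
  "gs \<in> lists (carrier G) \<Longrightarrow>
    hbd (\<lambda>gs. homog GK f (map retr gs)) gs = homog GK (coboundary GK f) (map retr gs)"
  using K.hbd_homog[of "map retr gs" f] map_retr_in_lists[of gs] by (simp add: hbd_map)

lemma homog_inhomog_grp_inv:
  assumes "grp_inv n U" "gs \<in> lists (carrier G)" "length gs = Suc n"
    and "\<And>xs. xs \<in> lists (carrier G) \<Longrightarrow> length xs = n \<Longrightarrow> f xs = U (prods G \<one> xs)"
  shows "homog G f gs = U gs"
proof -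
  have "gs \<noteq> []" using assms by auto
  then have "homog G f gs = homog G (\<lambda>xs. U (prods G \<one> xs)) gs"
    using assms diffs_in_lists[of gs] by (simp add: homog_def)
  also have "\<dots> = U gs" using assms(1-3) unfolding grp_inv_def by (intro homog_inhomog[where n = n]) auto
  finally show ?thesis .
qed

lemma restriction_surj:
  fixes k :: "'k::field itself"
  assumes triv: "trivial_monodromy k" and f: "f \<in> carrier (cocycle_algebra k GK)"
  shows "\<exists>F\<in>carrier (cocycle_algebra k G). \<exists>b\<in>cochains k GK.
    (\<forall>xs. f xs = coboundary GK b xs + restrict_cochain Ker F xs) \<and>
    (\<forall>m. (\<forall>xs. length xs = m \<longrightarrow> f xs = 0) \<longrightarrow> (\<forall>xs. length xs = m \<longrightarrow> F xs = 0))"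
proof -
  have triv': "trivial_monodromy TYPE('k)" using triv by (simp add: trivial_monodromy_def)
  have f': "f \<in> cochains k GK" "coboundary GK f = (\<lambda>_. 0)"
    using f by (simp_all add: K.cocycle_algebra_carrier)
  let ?Fh = "\<lambda>gs. homog GK f (map retr gs)"
  have closed: "hbd ?Fh gs = 0" if "gs \<in> lists (carrier G)" for gs
    using that by (simp only: hbd_homog_retr f'(2)) (simp add: homog_def)
  \<comment> \<open>Choosing zero in the degrees where \<open>f\<close> vanishes keeps the glued
    cochains of bounded degree and yields the degree clause of the conclusion.\<close>
  define good where "good n U W \<longleftrightarrow> ker_inv W \<and> W [] = 0 \<and> grp_inv n U \<and> closed_in n U \<and>
      (\<forall>gs\<in>lists (carrier G). length gs = Suc n \<longrightarrow> U gs = ?Fh gs - hbd W gs) \<and>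
      ((\<forall>xs. length xs = n \<longrightarrow> f xs = 0) \<longrightarrow> U = (\<lambda>_. 0) \<and> W = (\<lambda>_. 0))" for n U W
  have "\<exists>U W. good n U W" for n
  proof (cases "\<forall>xs. length xs = n \<longrightarrow> f xs = 0")
    case True
    show ?thesis
      by (intro exI[of _ "\<lambda>_. 0"])
        (use True in \<open>simp add: good_def ker_inv_def grp_inv_def closed_in_def homog_def\<close>)
  next
    case False
    have "closed_in n ?Fh" using closed by (simp add: closed_in_def)
    from cohomologous_grp_inv[OF triv' ker_inv_homog_retr this]
    obtain U W where "ker_inv W" "W [] = 0" "grp_inv n U" "closed_in n U"
      "\<And>gs. U gs = ?Fh gs - hbd W gs" by blast
    with False show ?thesis by - (rule exI[of _ U], rule exI[of _ W], auto simp: good_def)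
  qed
  then obtain U W where "\<And>n. good n (U n) (W n)" by metis
  then have UW: "\<And>n. ker_inv (W n)" "\<And>n. W n [] = 0" "\<And>n. grp_inv n (U n)"
    "\<And>n. closed_in n (U n)"
    "\<And>n gs. gs \<in> lists (carrier G) \<Longrightarrow> length gs = Suc n \<Longrightarrow> U n gs = ?Fh gs - hbd (W n) gs"
    and vanish: "\<And>n. \<forall>xs. length xs = n \<longrightarrow> f xs = 0 \<Longrightarrow> U n = (\<lambda>_. 0) \<and> W n = (\<lambda>_. 0)"
    unfolding good_def by simp_all
  define F where "F xs = (if xs \<in> lists (carrier G) then U (length xs) (prods G \<one> xs) else 0)" for xs
  \<comment> \<open>\<open>W n\<close> enters degree n only through its values on lists of length n,
    that is as a cochain of degree n - 1. So the component of \<open>b\<close> of degree m comes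
    from \<open>W (Suc m)\<close>.\<close>
  define b where "b xs = (if xs \<in> lists Ker then W (Suc (length xs)) (prods G \<one> xs) else 0)" for xs
  obtain N where N: "\<And>xs. f xs \<noteq> 0 \<Longrightarrow> length xs \<le> N" using f'(1) by (auto simp: cochains_def)
  have big: "U n = (\<lambda>_. 0) \<and> W n = (\<lambda>_. 0)" if "n > N" for n
    by (rule vanish) (use N that in \<open>meson not_le\<close>)
  have "F \<in> cochains k G"
  proof (rule cochainsI[where N = N])
    fix xs assume nz: "F xs \<noteq> 0"
    then have "\<not> length xs > N" using big by (auto simp: F_def split: if_splits)
    with nz show "xs \<in> lists (carrier G) \<and> length xs \<le> N" by (simp add: F_def split: if_splits)
  qed
  moreover have homogF: "homog G F gs = U n gs" if "gs \<in> lists (carrier G)" "length gs = Suc n" for gs n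
    using UW(3) that by (rule homog_inhomog_grp_inv) (simp add: F_def)
  have "coboundary G F xs = 0" for xs
  proof (cases "xs \<in> lists (carrier G) \<and> xs \<noteq> []")
    case True
    then obtain n where n: "length xs = Suc n" by (cases xs) auto
    have p: "prods G \<one> xs \<in> lists (carrier G)" using True prods_in_lists by simp
    have "coboundary G F xs = hbd (homog G F) (prods G \<one> xs)" using True by (simp add: coboundary_prods)
    also have "\<dots> = hbd (U n) (prods G \<one> xs)"
      by (rule hbd_cong[OF p]) (use n in \<open>simp add: homogF\<close>)
    also have "\<dots> = 0" using UW(4)[of n] p n by (simp add: closed_in_def)
    finally show ?thesis .
  qed (auto simp: coboundary_def)
  ultimately have "F \<in> carrier (cocycle_algebra k G)" by (simp add: cocycle_algebra_carrier fun_eq_iff)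
  moreover have "b \<in> cochains k GK"
  proof (rule cochainsI[where N = N])
    fix xs assume nz: "b xs \<noteq> 0"
    then have "\<not> Suc (length xs) > N" using big by (auto simp: b_def split: if_splits)
    with nz show "xs \<in> lists (carrier GK) \<and> length xs \<le> N" by (simp add: b_def split: if_splits)
  qed
  moreover have "f xs = coboundary GK b xs + restrict_cochain Ker F xs" for xs
  proof (cases "xs \<in> lists Ker")
    case True
    let ?p = "prods G \<one> xs" and ?n = "length xs"
    have p: "?p \<in> lists Ker" using K.prods_in_lists[of xs \<one>] True subgroup.one_closed[OF subgroup_Ker] by simp
    have Fh: "?Fh ?p = f xs"
      using map_retr_Ker[OF p] K.homog_prods[of xs \<one> f] True subgroup.one_closed[OF subgroup_Ker] by simp
    \<comment> \<open>For \<open>?n = 0\<close> the list \<open>ys\<close> is empty and both sides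
      vanish because \<open>W 0 [] = 0\<close>.\<close>
    have "W ?n ys = homog GK b ys" if ys: "ys \<in> lists Ker" "length ys = ?n" for ys
    proof (cases ys)
      case (Cons y zs)
      let ?b = "\<lambda>zs. W ?n (prods GK \<one>\<^bsub>GK\<^esub> zs)"
      have "homog GK ?b ys = W ?n ys"
      proof (rule K.homog_inhomog[where n = "length zs"])
        fix g hs assume "g \<in> carrier GK" "hs \<in> lists (carrier GK)"
        then show "W ?n (map (\<lambda>x. g \<otimes>\<^bsub>GK\<^esub> x) hs) = W ?n hs"
          using UW(1)[of ?n] lists_Ker[of hs] by (simp add: ker_inv_def)
      qed (use ys Cons in simp_all)
      moreover have "homog GK b ys = homog GK ?b ys"
        using ys Cons K.diffs_in_lists[of ys] by (simp add: homog_def b_def Suc_diff_1 flip: ys(2))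
      ultimately show ?thesis by simp
    qed (use UW(2) in simp)
    then have "hbd (W ?n) ?p = hbd (homog GK b) ?p" by (intro hbd_cong[OF p]) simp
    also have "\<dots> = coboundary GK b xs" using K.coboundary_prods[of xs b] True by simp
    finally show ?thesis
      using UW(5)[of ?p ?n] Fh lists_Ker[OF p] lists_Ker[OF True] True
      by (simp add: restrict_cochain_def F_def)
  qed (use cochains_outside[OF f'(1)] in \<open>auto simp: restrict_cochain_def coboundary_outside\<close>)
  moreover have "F xs = 0" if "\<forall>xs. length xs = m \<longrightarrow> f xs = 0" "length xs = m" for m xs
    using vanish[OF that(1)] that(2) by (simp add: F_def)
  ultimately show ?thesis by blast
qed

text \<open>Only the omission of the first vertex changes the leading height. The other faces carry
  the constant factor \<open>ht g\<close>, and by closedness of \<open>U\<close> they sum up to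
  \<open>U (h # gs)\<close>.\<close>

lemma hbd_ht_mult:
  assumes "hbd U (g # h # gs) = 0"
  shows "hbd (\<lambda>ys. of_int (ht (hd ys)) * U ys) (g # h # gs) =
    (of_int (ht h) - of_int (ht g)) * U (h # gs)"
proof -
  have "hbd (\<lambda>ys. of_int (ht (hd ys)) * U ys) (g # h # gs) =
      of_int (ht h) * U (h # gs) - of_int (ht g) * hbd (\<lambda>ys. U (g # ys)) (h # gs)"
    by (simp add: hbd_Cons[of _ g] hbd_scale)
  also have "hbd (\<lambda>ys. U (g # ys)) (h # gs) = U (h # gs)"
    using assms by (simp add: hbd_Cons[of _ g])
  finally show ?thesis by (simp add: algebra_simps)
qed

text \<open>If \<open>S\<close> is the shift difference of \<open>h\<close> and \<open>S = U + dW\<close> with \<open>U\<close> invariant, then the shift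
  difference of \<open>h - ht \<cdot> U\<close> is exact, and \<open>d (ht \<cdot> U)\<close> is the cup product of \<open>ht\<close> and \<open>U\<close>.\<close>

lemma exact_on_kernel:
  fixes F h :: "'a list \<Rightarrow> 'k::field"
  assumes triv: "trivial_monodromy TYPE('k)"
    and F: "grp_inv (Suc n) F"
    and h: "ker_inv h" "h [] = 0"
    and Fh: "\<And>gs. gs \<in> lists (carrier G) \<Longrightarrow> length gs = Suc (Suc n) \<Longrightarrow> F gs = hbd h gs"
  obtains U V where "grp_inv n U" "closed_in n U" "grp_inv n V"
    "\<And>x y gs. x # y # gs \<in> lists (carrier G) \<Longrightarrow> length gs = n \<Longrightarrow>
      F (x # y # gs) = hbd V (x # y # gs) + (of_int (ht y) - of_int (ht x)) * U (y # gs)"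
proof -
  let ?S = "\<lambda>gs. h (trans s gs) - h gs"
  have S: "ker_inv ?S" by (intro ker_inv_diff ker_inv_trans h) simp
  \<comment> \<open>Although \<open>h\<close> is not closed, its shift difference is: the coboundary
    of \<open>h\<close> is \<open>F\<close>, which translation by \<open>s\<close> fixes.\<close>
  have "closed_in n ?S"
    unfolding closed_in_def
  proof (intro ballI impI)
    fix gs assume gs: "gs \<in> lists (carrier G)" "length gs = Suc (Suc n)"
    have "hbd ?S gs = hbd h (trans s gs) - hbd h gs" by (simp only: hbd_map hbd_diff)
    also have "\<dots> = F (trans s gs) - F gs" using gs Fh[of gs] Fh[of "trans s gs"] by simp
    also have "\<dots> = 0" using F gs unfolding grp_inv_def by simp
    finally show "hbd ?S gs = 0" .
  qed
  from cohomologous_grp_inv[OF triv S this] obtain U W where W: "ker_inv W" "W [] = 0"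
    and U: "grp_inv n U" "closed_in n U" and UW: "\<And>gs. U gs = ?S gs - hbd W gs" by blast
  obtain W' where W': "ker_inv W'" "W' [] = 0"
    and WW': "\<And>gs. gs \<in> lists (carrier G) \<Longrightarrow> W' (trans s gs) - W' gs = W gs"
    using shift_surj[OF W] by metis
  \<comment> \<open>Subtracting this coboundary leaves the coboundary of \<open>h\<close> unchanged
    and turns its shift difference \<open>?S\<close> into \<open>U\<close> on the nose.\<close>
  let ?h = "\<lambda>gs. h gs - hbd W' gs" and ?l = "\<lambda>gs. of_int (ht (hd gs)) * U gs"
  let ?V = "\<lambda>gs. ?h gs - ?l gs"
  have h': "ker_inv ?h" by (intro ker_inv_diff h ker_inv_hbd W')
  have "grp_inv n ?V"
  proof (rule grp_invI)
    fix gs x y assume gs: "gs \<in> lists (carrier G)" "length gs = Suc n"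
      and x: "x \<in> carrier G" and y: "y \<in> carrier G" and xy: "ht x = ht y"
    have ne: "gs \<noteq> []" and hd: "hd gs \<in> carrier G" using gs by (cases gs, auto)+
    have "?l (trans x gs) = ?l (trans y gs)"
      using U(1) gs x y xy ne hd unfolding grp_inv_def by (simp add: hd_map ht_mult)
    then show "?V (trans x gs) = ?V (trans y gs)"
      using ker_inv_ht[OF h' gs(1) x y xy] by simp
  next
    fix gs assume gs: "gs \<in> lists (carrier G)" "length gs = Suc n"
    have ne: "gs \<noteq> []" and hd: "hd gs \<in> carrier G" using gs by (cases gs, auto)+
    have "hbd W' (trans s gs) - hbd W' gs = hbd (\<lambda>ys. W' (trans s ys) - W' ys) gs"
      by (simp only: hbd_map hbd_diff)
    also have "\<dots> = hbd W gs" by (rule hbd_cong[OF gs(1)]) (rule WW')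
    \<comment> \<open>Translation by \<open>s\<close> raises the leading height by one, so
      \<open>?l\<close> also grows by exactly \<open>U\<close> and the two changes cancel in
      \<open>?V\<close>.\<close>
    finally have 1: "?h (trans s gs) = ?h gs + U gs" unfolding UW by (simp add: algebra_simps)
    have "U (trans s gs) = U gs" using U(1) gs unfolding grp_inv_def by simp
    then have "?l (trans s gs) = ?l gs + U gs"
      using ne hd by (simp add: hd_map ht_mult ht_s algebra_simps)
    with 1 show "?V (trans s gs) = ?V gs" by simp
  qed
  moreover have "F (x # y # gs) = hbd ?V (x # y # gs) + (of_int (ht y) - of_int (ht x)) * U (y # gs)"
    if gs: "x # y # gs \<in> lists (carrier G)" "length gs = n" for x y gs
  proof -
    have "hbd U (x # y # gs) = 0" using U(2) gs unfolding closed_in_def by simp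
    then have "hbd ?l (x # y # gs) = (of_int (ht y) - of_int (ht x)) * U (y # gs)"
      by (rule hbd_ht_mult)
    moreover have "hbd ?V (x # y # gs) = F (x # y # gs) - hbd ?l (x # y # gs)"
      using Fh[of "x # y # gs"] gs unfolding hbd_diff by simp
    ultimately show ?thesis by simp
  qed
  ultimately show ?thesis using that[of U ?V] U by blast
qed

section \<open>The height class and the kernel of restriction\<close>

definition ht_cochain :: "'a list \<Rightarrow> 'k::field" where
  "ht_cochain xs = (case xs of [g] \<Rightarrow> if g \<in> carrier G then of_int (ht g) else 0 | _ \<Rightarrow> 0)"

lemma ht_cochain_cocycle:
  fixes k :: "'k::field itself"
  shows "ht_cochain \<in> carrier (cocycle_algebra k G)"
proof -
  have "ht_cochain \<in> cochains k G"
    by (rule cochainsI[where N = 1]) (auto simp: ht_cochain_def split: list.splits if_splits)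
  moreover have "coboundary G ht_cochain xs = (0::'k::field)" for xs
  proof (cases "length xs = 2 \<and> xs \<in> lists (carrier G)")
    case True
    then obtain x y where "xs = [x, y]" "x \<in> carrier G" "y \<in> carrier G"
      by (auto simp: length_Suc_conv numeral_2_eq_2)
    then show ?thesis by (simp add: coboundary_def ht_cochain_def ht_mult)
  next
    case False
    show ?thesis
    proof (cases "xs \<in> lists (carrier G)")
      case True
      show ?thesis
        by (rule coboundary_vanishes)
          (use True False in \<open>auto simp: ht_cochain_def split: list.splits\<close>)
    qed (rule coboundary_outside)
  qed
  ultimately show ?thesis by (simp add: cocycle_algebra_carrier fun_eq_iff)
qed

text \<open>\<open>ht_cochain\<close> is concentrated in degree 1, so only the splitting after the
  first entry contributes.\<close>

lemma cup_ht_cochain: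
  fixes u :: "'a list \<Rightarrow> 'k::field"
  shows "cup ht_cochain u (x # xs) = ht_cochain [x] * u xs"
proof -
  have "cup ht_cochain u (x # xs) = ht_cochain [] * u (x # xs) + cup (\<lambda>zs. ht_cochain (x # zs)) u xs"
    by (rule cup_Cons)
  also have "cup (\<lambda>zs. ht_cochain (x # zs)) u xs = ht_cochain [x] * u xs"
  proof (cases xs)
    case (Cons y ys)
    have "ht_cochain (x # y # zs) = (0::'k)" for zs by (simp add: ht_cochain_def)
    then show ?thesis using Cons by (simp add: cup_Cons)
  qed (simp add: cup_Nil)
  also have "ht_cochain [] = (0::'k)" by (simp add: ht_cochain_def)
  finally show ?thesis by simp
qed

lemma restriction_kernel:
  fixes k :: "'k::field itself"
  assumes triv: "trivial_monodromy k" and F: "F \<in> carrier (cocycle_algebra k G)"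
    and b: "b \<in> cochains k GK" and Fb: "restrict_cochain Ker F = coboundary GK b"
  shows "\<exists>u\<in>carrier (cocycle_algebra k G). \<exists>v\<in>cochains k G.
    \<forall>xs. F xs = coboundary G v xs + cup ht_cochain u xs"
proof -
  have triv': "trivial_monodromy TYPE('k)" using triv by (simp add: trivial_monodromy_def)
  have F': "F \<in> cochains k G" "coboundary G F = (\<lambda>_. 0)"
    using F by (simp_all add: cocycle_algebra_carrier)
  let ?Fh = "homog G F" and ?Bh = "\<lambda>gs. homog GK b (map retr gs)"
  \<comment> \<open>Pulled back along \<open>retr\<close>, the cochain \<open>b\<close> bounds
    \<open>?Fh\<close> composed with \<open>retr\<close>. The prism term is the homotopy from there
    back to \<open>?Fh\<close>, so \<open>h\<close> bounds \<open>?Fh\<close> on all of the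
    group.\<close>
  define h where "h gs = ?Bh gs - prism retr ?Fh gs" for gs
  have retr: "retr \<in> carrier G \<rightarrow> carrier G" using retr_in_Ker Ker_subset by auto
  have "ker_inv (prism retr ?Fh)"
    unfolding ker_inv_def
  proof (intro ballI)
    fix c gs assume c: "c \<in> Ker" and gs: "gs \<in> lists (carrier G)"
    then have cG: "c \<in> carrier G" using Ker_subset by blast
    have "prism retr ?Fh (trans c gs) = prism retr (\<lambda>ys. ?Fh (trans c ys)) gs"
      by (rule prism_map[OF gs]) (rule retr_mult[OF c])
    also have "\<dots> = prism retr ?Fh gs"
      by (rule prism_cong[OF gs retr]) (rule homog_map_mult[OF _ cG])
    finally show "prism retr ?Fh (trans c gs) = prism retr ?Fh gs" .
  qed
  then have h: "ker_inv h" "h [] = 0"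
    unfolding h_def by (auto intro: ker_inv_diff ker_inv_homog_retr)
  have Fh: "?Fh gs = hbd h gs" if gs: "gs \<in> lists (carrier G)" for gs
  proof -
    have r: "map retr gs \<in> lists Ker" using map_retr_in_lists[OF gs] .
    have "hbd ?Bh gs = homog GK (restrict_cochain Ker F) (map retr gs)"
      using gs by (simp only: hbd_homog_retr Fb)
    also have "\<dots> = ?Fh (map retr gs)"
      using K.diffs_in_lists[of "map retr gs"] r diffs_subgroup[OF subgroup_Ker r]
      by (simp add: homog_def restrict_cochain_def)
    finally have B: "hbd ?Bh gs = ?Fh (map retr gs)" .
    have "prism retr (hbd ?Fh) gs = prism retr (\<lambda>_. 0) gs"
      by (rule prism_cong[OF gs retr]) (simp add: hbd_homog F'(2), simp add: homog_def)
    also have "\<dots> = 0" using prism_diff[of retr "\<lambda>_. 0" "\<lambda>_. 0" gs] by simp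
    finally have "hbd (prism retr ?Fh) gs = ?Fh (map retr gs) - ?Fh gs"
      using prism_homotopy[of retr ?Fh gs] by simp
    then show ?thesis unfolding h_def[abs_def] hbd_diff B by simp
  qed
  have Finv: "grp_inv n ?Fh" for n
    unfolding grp_inv_def using homog_map_mult by blast
  \<comment> \<open>The cochains \<open>U\<close> and \<open>V\<close> of degree n are attached to
    the component of \<open>F\<close> of degree n + 1, hence \<open>Suc n\<close> in the vanishing
    clause, which bounds the degrees of \<open>u\<close> and \<open>v\<close>.\<close>
  define good where "good n U V \<longleftrightarrow> grp_inv n U \<and> closed_in n U \<and> grp_inv n V \<and>
      (\<forall>x y gs. x # y # gs \<in> lists (carrier G) \<longrightarrow> length gs = n \<longrightarrow>
        ?Fh (x # y # gs) = hbd V (x # y # gs) + (of_int (ht y) - of_int (ht x)) * U (y # gs)) \<and>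
      ((\<forall>xs. length xs = Suc n \<longrightarrow> F xs = 0) \<longrightarrow> U = (\<lambda>_. 0) \<and> V = (\<lambda>_. 0))" for n U V
  have "\<exists>U V. good n U V" for n
  proof (cases "\<forall>xs. length xs = Suc n \<longrightarrow> F xs = 0")
    case True
    show ?thesis
      by (intro exI[of _ "\<lambda>_. 0"])
        (use True in \<open>simp add: good_def grp_inv_def closed_in_def homog_def\<close>)
  next
    case False
    from exact_on_kernel[OF triv' Finv[of "Suc n"] h Fh]
    obtain U V where "grp_inv n U" "closed_in n U" "grp_inv n V"
      "\<And>x y gs. x # y # gs \<in> lists (carrier G) \<Longrightarrow> length gs = n \<Longrightarrow>
        ?Fh (x # y # gs) = hbd V (x # y # gs) + (of_int (ht y) - of_int (ht x)) * U (y # gs)"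
      by metis
    with False show ?thesis by - (rule exI[of _ U], rule exI[of _ V], auto simp: good_def)
  qed
  then obtain U V where "\<And>n. good n (U n) (V n)" by metis
  then have UV: "\<And>n. grp_inv n (U n)" "\<And>n. closed_in n (U n)" "\<And>n. grp_inv n (V n)"
    and eq: "\<And>n x y gs. x # y # gs \<in> lists (carrier G) \<Longrightarrow> length gs = n \<Longrightarrow>
        ?Fh (x # y # gs) = hbd (V n) (x # y # gs) + (of_int (ht y) - of_int (ht x)) * U n (y # gs)"
    and vanish: "\<And>n. \<forall>xs. length xs = Suc n \<longrightarrow> F xs = 0 \<Longrightarrow> U n = (\<lambda>_. 0) \<and> V n = (\<lambda>_. 0)"
    unfolding good_def by simp_all
  define u where "u xs = (if xs \<in> lists (carrier G) then U (length xs) (prods G \<one> xs) else 0)" for xs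
  define v where "v xs = (if xs \<in> lists (carrier G) then V (length xs) (prods G \<one> xs) else 0)" for xs
  obtain N where N: "\<And>xs. F xs \<noteq> 0 \<Longrightarrow> length xs \<le> N" using F'(1) by (auto simp: cochains_def)
  have big: "U n = (\<lambda>_. 0) \<and> V n = (\<lambda>_. 0)" if n: "n > N" for n
  proof (rule vanish, intro allI impI)
    fix xs :: "'a list" assume "length xs = Suc n"
    then show "F xs = 0" using N[of xs] n by linarith
  qed
  have u: "u \<in> cochains k G"
  proof (rule cochainsI[where N = N])
    fix xs assume nz: "u xs \<noteq> 0"
    then have "\<not> length xs > N" using big by (auto simp: u_def split: if_splits)
    with nz show "xs \<in> lists (carrier G) \<and> length xs \<le> N" by (simp add: u_def split: if_splits)
  qed
  have v: "v \<in> cochains k G"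
  proof (rule cochainsI[where N = N])
    fix xs assume nz: "v xs \<noteq> 0"
    then have "\<not> length xs > N" using big by (auto simp: v_def split: if_splits)
    with nz show "xs \<in> lists (carrier G) \<and> length xs \<le> N" by (simp add: v_def split: if_splits)
  qed
  have homogu: "homog G u gs = U n gs" if "gs \<in> lists (carrier G)" "length gs = Suc n" for gs n
    using UV(1) that by (rule homog_inhomog_grp_inv) (simp add: u_def)
  have homogv: "homog G v gs = V n gs" if "gs \<in> lists (carrier G)" "length gs = Suc n" for gs n
    using UV(3) that by (rule homog_inhomog_grp_inv) (simp add: v_def)
  have "coboundary G u xs = 0" for xs
  proof (cases "xs \<in> lists (carrier G) \<and> xs \<noteq> []")
    case True
    then obtain n where n: "length xs = Suc n" by (cases xs) auto
    have p: "prods G \<one> xs \<in> lists (carrier G)" using True prods_in_lists by simp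
    have "coboundary G u xs = hbd (homog G u) (prods G \<one> xs)" using True by (simp add: coboundary_prods)
    also have "\<dots> = hbd (U n) (prods G \<one> xs)"
      by (rule hbd_cong[OF p]) (use n in \<open>simp add: homogu\<close>)
    also have "\<dots> = 0" using UV(2)[of n] p n by (simp add: closed_in_def)
    finally show ?thesis .
  qed (auto simp: coboundary_def)
  then have "u \<in> carrier (cocycle_algebra k G)" using u by (simp add: cocycle_algebra_carrier fun_eq_iff)
  moreover have "F xs = coboundary G v xs + cup ht_cochain u xs" for xs
  proof (cases "xs \<in> lists (carrier G)")
    case True
    have p: "prods G \<one> xs \<in> lists (carrier G)" using True prods_in_lists by simp
    have F_xs: "F xs = ?Fh (prods G \<one> xs)" using True by (simp add: homog_prods)
    show ?thesis
    proof (cases xs)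
      \<comment> \<open>In degree 0 there is nothing to divide by: \<open>?Fh\<close> is the
        coboundary of \<open>h\<close>, which on one vertex is \<open>h [] = 0\<close>.\<close>
      case Nil
      have "F xs = ?Fh [\<one>]" using F_xs by (simp only: Nil prods.simps)
      also have "\<dots> = hbd h [\<one>]" by (rule Fh) simp
      also have "\<dots> = 0" by (simp add: hbd_Cons h)
      finally show ?thesis using Nil by (simp add: coboundary_def cup_Nil ht_cochain_def)
    next
      case (Cons x ys)
      let ?n = "length ys"
      obtain gs where gs: "prods G x ys = x # gs" "length gs = ?n"
        by (cases ys) auto
      have x: "x \<in> carrier G" and ys: "ys \<in> lists (carrier G)" using True Cons by auto
      have ps: "prods G \<one> xs = \<one> # x # gs" using Cons x gs by simp
      \<comment> \<open>The path starts at the neutral element, of height 0, so the height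
        difference is \<open>ht x\<close>, the value of \<open>ht_cochain\<close> on the first
        entry.\<close>
      have "F xs = hbd (V ?n) (prods G \<one> xs) + of_int (ht x) * U ?n (prods G x ys)"
        unfolding F_xs using eq[of \<one> x gs ?n] p gs by (simp add: ps)
      also have "hbd (V ?n) (prods G \<one> xs) = hbd (homog G v) (prods G \<one> xs)"
        by (rule hbd_cong[OF p]) (use Cons in \<open>simp add: homogv\<close>)
      also have "\<dots> = coboundary G v xs" using True by (simp add: coboundary_prods)
      also have "U ?n (prods G x ys) = u ys"
        using homogu[of "prods G x ys" ?n] homog_prods[OF ys x, of u] prods_in_lists[OF ys x] by simp
      finally show ?thesis using Cons x by (simp add: cup_ht_cochain ht_cochain_def)
    qed
  next
    case False
    have "cup ht_cochain u xs = 0"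
      using cochains_outside[OF cup_cochains[of ht_cochain k G u] False] u ht_cochain_cocycle[of k]
      by (simp add: cocycle_algebra_carrier)
    then show ?thesis using False cochains_outside[OF F'(1) False] by (simp add: coboundary_outside)
  qed
  ultimately show ?thesis using v by blast
qed

lemma cohomology_kernel_iso:
  fixes k :: "'k::field itself"
  assumes "trivial_monodromy k"
  shows "\<exists>\<phi>. \<phi> \<in> graded_algebra_iso (cohomology k (G\<lparr>carrier := Ker\<rparr>))
    (graded_quotient (cohomology k G)
      (Idl\<^bsub>cohomology k G\<^esub> {hom_class k G (\<lambda>g. of_int (ht g))}))"
proof -
  have z: "hom_class k G (\<lambda>g. of_int (ht g)) = coboundaries k G +>\<^bsub>cocycle_algebra k G\<^esub> ht_cochain"
    unfolding hom_class_def ht_cochain_def[abs_def] ..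
  have "restrict_cochain Ker ht_cochain = (\<lambda>_. 0 :: 'k)"
    by (rule ext) (auto simp: restrict_cochain_def ht_cochain_def Ker_def split: list.splits)
  then show ?thesis
    unfolding z
    by (intro restriction_iso group_axioms subgroup_Ker ht_cochain_cocycle
        restriction_surj[OF assms] restriction_kernel[OF assms])
qed

end

section \<open>Alternating chains on cliques\<close>

definition alternating :: "('v list \<Rightarrow> 'k::field) \<Rightarrow> bool" where
  "alternating c \<longleftrightarrow> (\<forall>xs x y ys. c (xs @ [x, y] @ ys) = - c (xs @ [y, x] @ ys))"

text \<open>Oriented chains of the flag complex with the vertex set \<open>W\<close> as a parameter,
  so that one can pass to subsets and links. As in \<open>oriented_chains\<close>, \<open>q\<close>
  counts vertices, and \<open>q = 0\<close> belongs to the empty clique.\<close>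

definition clique_chain :: "'v set set \<Rightarrow> 'v set \<Rightarrow> nat \<Rightarrow> ('v list \<Rightarrow> 'k::field) \<Rightarrow> bool" where
  "clique_chain E W q c \<longleftrightarrow> alternating c \<and>
    (\<forall>xs. c xs \<noteq> 0 \<longrightarrow> length xs = q \<and> distinct xs \<and> set xs \<subseteq> W \<and> clique (set xs) E)"

text \<open>Contraction with \<open>v\<close>, which takes a chain to the link of \<open>v\<close>.
  The simplicial boundary is the sum of all contractions.\<close>

abbreviation iota :: "'v \<Rightarrow> ('v list \<Rightarrow> 'k::field) \<Rightarrow> 'v list \<Rightarrow> 'k" where
  "iota v c \<equiv> \<lambda>xs. c (v # xs)"

text \<open>Exterior multiplication by \<open>v\<close> from the left; it is meant for chains on the link of \<open>v\<close>.\<close>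

fun wedge :: "'v \<Rightarrow> ('v list \<Rightarrow> 'k::field) \<Rightarrow> 'v list \<Rightarrow> 'k" where
  "wedge v c [] = 0"
| "wedge v c (x # xs) = (if x = v then c xs else - wedge v (iota x c) xs)"

lemma oriented_chains_clique_chain:
  assumes "finite V"
  shows "c \<in> oriented_chains k (flag_complex V E) q \<longleftrightarrow> clique_chain E V q c"
proof -
  have *: "set xs \<in> insert {} (flag_complex V E) \<longleftrightarrow> set xs \<subseteq> V \<and> clique (set xs) E" for xs
    by (auto simp: flag_complex_def clique_def)
  have "finite {xs. c xs \<noteq> 0}" if "clique_chain E V q c"
  proof (rule finite_subset)
    show "{xs. c xs \<noteq> 0} \<subseteq> {xs. set xs \<subseteq> V \<and> length xs = q}"
      using that by (auto simp: clique_chain_def)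
  qed (rule finite_lists_length_eq[OF assms])
  then show ?thesis
    unfolding oriented_chains_def clique_chain_def alternating_def * mem_Collect_eq by blast
qed

lemma clique_chainD:
  assumes "clique_chain E W q c" "c xs \<noteq> 0"
  shows "length xs = q" "distinct xs" "set xs \<subseteq> W" "clique (set xs) E"
  using assms by (auto simp: clique_chain_def)

lemma alternatingD: "alternating c \<Longrightarrow> c (xs @ [x, y] @ ys) = - c (xs @ [y, x] @ ys)"
  unfolding alternating_def by blast

lemma alternating_iota: "alternating c \<Longrightarrow> alternating (iota v c)"
  unfolding alternating_def by (metis append_Cons)

lemma clique_chain_mono: "clique_chain E W q c \<Longrightarrow> W \<subseteq> W' \<Longrightarrow> clique_chain E W' q c"
  by (auto simp: clique_chain_def)

lemma clique_chain_iota: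
  assumes "clique_chain E W (Suc q) c"
  shows "clique_chain E {w \<in> W. {v, w} \<in> E} q (iota v c)"
  unfolding clique_chain_def
proof (intro conjI allI impI)
  show "alternating (iota v c)" using assms alternating_iota by (auto simp: clique_chain_def)
  fix xs assume "c (v # xs) \<noteq> 0"
  note D = clique_chainD[OF assms this]
  show "length xs = q" "distinct xs" using D(1,2) by auto
  show "clique (set xs) E" using D(4) by (auto simp: clique_def)
  show "set xs \<subseteq> {w \<in> W. {v, w} \<in> E}" using D(2,3,4) by (auto simp: clique_def)
qed

lemma clique_chain_iota': "clique_chain E W (Suc q) c \<Longrightarrow> clique_chain E W q (iota v c)"
  by (rule clique_chain_mono[OF clique_chain_iota]) auto

lemma iota_outside: "clique_chain E W q c \<Longrightarrow> v \<notin> W \<Longrightarrow> iota v c = (\<lambda>_. 0)"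
  by (rule ext) (auto simp: clique_chain_def)

lemma wedge_uminus: "wedge v (\<lambda>xs. - c xs) xs = - wedge v c xs"
  by (induction xs arbitrary: c) simp_all

lemma wedge_add: "wedge v (\<lambda>xs. c xs + d xs) xs = wedge v c xs + wedge v d xs"
  by (induction xs arbitrary: c d) simp_all

lemma wedge_scale: "wedge v (\<lambda>xs. a * c xs) xs = a * wedge v c xs"
  by (induction xs arbitrary: c) simp_all

lemma wedge_zero [simp]: "wedge v (\<lambda>_. 0) xs = 0"
  by (induction xs) simp_all

lemma wedge_notin: "v \<notin> set xs \<Longrightarrow> wedge v c xs = 0"
  by (induction xs arbitrary: c) auto

lemma wedge_nonzero:
  "wedge v c xs \<noteq> 0 \<Longrightarrow> \<exists>ys zs. xs = ys @ v # zs \<and> c (ys @ zs) \<noteq> 0"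
proof (induction xs arbitrary: c)
  case (Cons x xs)
  show ?case
  proof (cases "x = v")
    case True
    with Cons.prems show ?thesis by (intro exI[of _ "[]"] exI[of _ xs]) simp
  next
    case False
    with Cons.prems Cons.IH[of "iota x c"] obtain ys zs where "xs = ys @ v # zs" "c (x # ys @ zs) \<noteq> 0"
      by auto
    then show ?thesis by (intro exI[of _ "x # ys"] exI[of _ zs]) simp
  qed
qed simp

lemma alternating_wedge:
  assumes "alternating c" and "\<And>xs. v \<in> set xs \<Longrightarrow> c xs = 0"
  shows "alternating (wedge v c)"
proof -
  have "wedge v c (xs @ [x, y] @ ys) = - wedge v c (xs @ [y, x] @ ys)" for xs x y ys
    using assms
  proof (induction xs arbitrary: c)
    case Nil
    have "wedge v (iota y (iota x c)) ys = wedge v (\<lambda>zs. - iota x (iota y c) zs) ys"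
      using alternatingD[OF Nil(1), of "[]" x y] by simp
    then show ?case using Nil(2)[of "v # ys"] by (simp add: wedge_uminus)
  next
    case (Cons z xs)
    have "wedge v (iota z c) (xs @ [x, y] @ ys) = - wedge v (iota z c) (xs @ [y, x] @ ys)"
      by (rule Cons.IH) (use Cons.prems alternating_iota in auto)
    then show ?case using alternatingD[OF Cons.prems(1), of xs x y ys] by simp
  qed
  then show ?thesis unfolding alternating_def by blast
qed

lemma clique_chain_wedge:
  assumes c: "clique_chain E L q c" and "L \<subseteq> W" "v \<in> W" "v \<notin> L" "\<And>w. w \<in> L \<Longrightarrow> {v, w} \<in> E"
  shows "clique_chain E W (Suc q) (wedge v c)"
  unfolding clique_chain_def
proof (intro conjI allI impI)
  show "alternating (wedge v c)"
    using c assms(4) by (intro alternating_wedge) (auto simp: clique_chain_def)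
  fix xs assume "wedge v c xs \<noteq> 0"
  then obtain ys zs where xs: "xs = ys @ v # zs" "c (ys @ zs) \<noteq> 0"
    by (auto dest: wedge_nonzero)
  note D = clique_chainD[OF c xs(2)]
  show "length xs = Suc q" "distinct xs" "set xs \<subseteq> W"
    using D assms(2-4) xs(1) by auto
  have "{v, w} \<in> E" "{w, v} \<in> E" if "w \<in> set (ys @ zs)" for w
    using assms(5)[of w] D(3) that by (auto simp: insert_commute[of w v])
  then show "clique (set xs) E" using D(4) unfolding xs clique_def by auto
qed

text \<open>Moving \<open>v\<close> to the front takes one transposition for each entry before it,
  and \<open>wedge\<close> changes sign once for each of them.\<close>

lemma wedge_iota:
  assumes "alternating c" "v \<notin> set ys"
  shows "wedge v (iota v c) (ys @ v # zs) = c (ys @ v # zs)"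
  using assms
proof (induction ys arbitrary: c)
  case (Cons y ys)
  have "iota y (iota v c) = (\<lambda>zs. - iota v (iota y c) zs)"
    using alternatingD[OF Cons.prems(1), of "[]" v y] by auto
  then have "wedge v (iota v c) ((y # ys) @ v # zs) = wedge v (iota v (iota y c)) (ys @ v # zs)"
    using Cons.prems(2) by (auto simp: wedge_uminus)
  also have "\<dots> = c (y # ys @ v # zs)"
    using Cons.IH[of "iota y c", OF alternating_iota[OF Cons.prems(1)]] Cons.prems(2) by simp
  finally show ?case by simp
qed simp

definition chain_restrict :: "'v set \<Rightarrow> ('v list \<Rightarrow> 'k::field) \<Rightarrow> 'v list \<Rightarrow> 'k" where
  "chain_restrict S c xs = (if set xs \<subseteq> S then c xs else 0)"

lemma clique_chain_restrict:
  assumes "clique_chain E W q c"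
  shows "clique_chain E S q (chain_restrict S c)"
proof -
  have "chain_restrict S c (xs @ [x, y] @ ys) = - chain_restrict S c (xs @ [y, x] @ ys)" for xs x y ys
    using alternatingD[of c xs x y ys] assms by (simp add: chain_restrict_def clique_chain_def insert_commute)
  then have "alternating (chain_restrict S c)" unfolding alternating_def by blast
  with assms show ?thesis by (auto simp: clique_chain_def chain_restrict_def)
qed

lemma chain_restrict_id: "clique_chain E S q c \<Longrightarrow> chain_restrict S c = c"
  by (rule ext) (auto simp: clique_chain_def chain_restrict_def)

text \<open>A clique either avoids \<open>v\<close> or is \<open>v\<close> joined to a clique in its
  link; this is the basis of the induction on the vertex set.\<close>

lemma clique_chain_split:
  assumes "clique_chain E (insert v W) q c" "v \<notin> W"
  shows "c = (\<lambda>xs. chain_restrict W c xs + wedge v (iota v c) xs)"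
proof
  fix xs
  have alt: "alternating c" using assms by (simp add: clique_chain_def)
  show "c xs = chain_restrict W c xs + wedge v (iota v c) xs"
  proof (cases "v \<in> set xs")
    case True
    then obtain ys zs where "xs = ys @ v # zs" "v \<notin> set ys" by (meson split_list_first)
    with assms(2) show ?thesis by (auto simp: chain_restrict_def wedge_iota[OF alt])
  next
    case False
    with clique_chainD(3)[OF assms(1), of xs] show ?thesis
      by (auto simp: chain_restrict_def wedge_notin)
  qed
qed

text \<open>Linearity is demanded on all functions on lists, so no domain has to be carried along;
  conditions such as closedness are imposed on clique chains only.\<close>

definition lin :: "(('v list \<Rightarrow> 'k::field) \<Rightarrow> 'k) \<Rightarrow> bool" where
  "lin \<phi> \<longleftrightarrow> (\<forall>c d. \<phi> (\<lambda>xs. c xs + d xs) = \<phi> c + \<phi> d) \<and> (\<forall>a c. \<phi> (\<lambda>xs. a * c xs) = a * \<phi> c)"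

lemma lin_add: "lin \<phi> \<Longrightarrow> \<phi> (\<lambda>xs. c xs + d xs) = \<phi> c + \<phi> d"
  and lin_scale: "lin \<phi> \<Longrightarrow> \<phi> (\<lambda>xs. a * c xs) = a * \<phi> c"
  by (simp_all add: lin_def)

lemma lin_zero: "lin \<phi> \<Longrightarrow> \<phi> (\<lambda>_. 0) = 0"
  using lin_scale[of \<phi> 0 "\<lambda>_. 0"] by simp

lemma lin_uminus: "lin \<phi> \<Longrightarrow> \<phi> (\<lambda>xs. - c xs) = - \<phi> c"
  using lin_scale[of \<phi> "- 1" c] by simp

lemma lin_sum: "lin \<phi> \<Longrightarrow> \<phi> (\<lambda>xs. \<Sum>v\<in>A. f v xs) = (\<Sum>v\<in>A. \<phi> (f v))"
proof (induction A rule: infinite_finite_induct)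
  case (insert x A)
  then show ?case using lin_add[OF insert.prems, of "f x" "\<lambda>xs. \<Sum>v\<in>A. f v xs"] by simp
qed (simp_all add: lin_zero)

lemma lin_diff_fun: "lin \<phi> \<Longrightarrow> lin \<psi> \<Longrightarrow> lin (\<lambda>c. \<phi> c - \<psi> c)"
  and lin_add_fun: "lin \<phi> \<Longrightarrow> lin \<psi> \<Longrightarrow> lin (\<lambda>c. \<phi> c + \<psi> c)"
  and lin_uminus_fun: "lin \<phi> \<Longrightarrow> lin (\<lambda>c. - \<phi> c)"
  and lin_zero_fun: "lin (\<lambda>_. 0)"
  and lin_iota: "lin \<phi> \<Longrightarrow> lin (\<lambda>c. \<phi> (iota v c))"
  and lin_eval: "lin (\<lambda>c. a * c xs)"
  by (simp_all add: lin_def algebra_simps)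

lemma lin_sum_fun: "(\<And>v. v \<in> A \<Longrightarrow> lin (\<phi> v)) \<Longrightarrow> lin (\<lambda>c. \<Sum>v\<in>A. \<phi> v c)"
  by (simp add: lin_def sum.distrib sum_distrib_left)

lemma lin_wedge: "lin \<phi> \<Longrightarrow> lin (\<lambda>c. \<phi> (wedge v c))"
  unfolding lin_def by (simp add: wedge_add[abs_def] wedge_scale[abs_def])

lemma lin_restrict: 
  assumes "lin \<phi>" shows "lin (\<lambda>c. \<phi> (chain_restrict S c))"
proof -
  have "chain_restrict S (\<lambda>xs. c xs + d xs) = (\<lambda>xs. chain_restrict S c xs + chain_restrict S d xs)"
    "chain_restrict S (\<lambda>xs. a * c xs) = (\<lambda>xs. a * chain_restrict S c xs)" for c d :: "'a list \<Rightarrow> 'b" and a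
    by (auto simp: chain_restrict_def)
  with assms show ?thesis by (simp add: lin_def)
qed

text \<open>The diagonal is a hypothesis of its own because antisymmetry does not force it to vanish
  when 2 is not invertible, as over a field of characteristic 2.\<close>

lemma sum_antisymmetric:
  fixes a :: "'v \<Rightarrow> 'v \<Rightarrow> 'k::ab_group_add"
  assumes "finite A" "\<And>u. a u u = 0" "\<And>u w. a u w = - a w u"
  shows "(\<Sum>u\<in>A. \<Sum>w\<in>A. a u w) = 0"
  using assms(1)
proof (induction A rule: finite_induct)
  case (insert x A)
  have "(\<Sum>w\<in>A. a x w) = - (\<Sum>u\<in>A. a u x)"
    unfolding sum_negf[symmetric] by (rule sum.cong[OF HOL.refl]) (rule assms(3))
  then show ?case using insert assms(2) by (simp add: sum.distrib)
qed simp

section \<open>The cellular complex\<close>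

text \<open>The group acts freely on a cube complex with one orbit of \<open>q\<close>-cubes for each \<open>q\<close>-clique; the cube
  at \<open>x\<close> on a clique \<open>\<sigma>\<close> has the vertices \<open>x \<tau>\<close> for \<open>\<tau> \<subseteq> \<sigma>\<close>. A cellular cochain is a family of linear
  functionals on the clique chains, indexed by the group, and \<open>cell_d\<close> is its coboundary.
  The axiom \<open>potential\<close> says that every \<open>1\<close>-cocycle of the subcomplex on \<open>W\<close> is a coboundary.\<close>

locale clique_group = height_group G ht s for G (structure) and ht s +
  fixes V :: "'v set" and E :: "'v set set" and gen :: "'v \<Rightarrow> 'a" and k :: "'k::field itself"
  assumes finite_V: "finite V"
    and no_loops: "\<And>v w. {v, w} \<in> E \<Longrightarrow> v \<noteq> w"
    and gen_closed: "\<And>v. v \<in> V \<Longrightarrow> gen v \<in> carrier G"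
    and ht_gen: "\<And>v. v \<in> V \<Longrightarrow> ht (gen v) = 1"
    and gen_commute: "\<And>v w. v \<in> V \<Longrightarrow> w \<in> V \<Longrightarrow> {v, w} \<in> E \<Longrightarrow> gen v \<otimes> gen w = gen w \<otimes> gen v"
    and gen_invariant: "\<And>(H :: 'a \<Rightarrow> 'k) x. (\<And>y v. y \<in> carrier G \<Longrightarrow> v \<in> V \<Longrightarrow> H (y \<otimes> gen v) = H y) \<Longrightarrow>
      x \<in> carrier G \<Longrightarrow> H x = H \<one>"
    and potential: "\<And>W (f :: 'v \<Rightarrow> 'a \<Rightarrow> 'k). W \<subseteq> V \<Longrightarrow>
      (\<And>u w x. u \<in> W \<Longrightarrow> w \<in> W \<Longrightarrow> {u, w} \<in> E \<Longrightarrow> x \<in> carrier G \<Longrightarrow>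
        f w (x \<otimes> gen u) - f w x = f u (x \<otimes> gen w) - f u x) \<Longrightarrow>
      \<exists>p. \<forall>x\<in>carrier G. \<forall>w\<in>W. p (x \<otimes> gen w) - p x = f w x"
begin

text \<open>In direction \<open>v\<close> a cube based at \<open>x\<close> has two opposite faces,
  based at \<open>x\<close> and at \<open>x \<otimes> gen v\<close>; the orientation signs are
  carried by \<open>iota\<close>.\<close>

definition cell_d :: "('a \<Rightarrow> ('v list \<Rightarrow> 'k) \<Rightarrow> 'k) \<Rightarrow> 'a \<Rightarrow> ('v list \<Rightarrow> 'k) \<Rightarrow> 'k" where
  "cell_d F x c = (\<Sum>v\<in>V. F (x \<otimes> gen v) (iota v c) - F x (iota v c))"

lemma lin_cell_d: "(\<And>x. lin (F x)) \<Longrightarrow> lin (cell_d F x)"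
  unfolding cell_d_def[abs_def] by (intro lin_sum_fun lin_diff_fun lin_iota)

lemma cell_d_diff: "cell_d (\<lambda>x c. F x c - F' x c) x c = cell_d F x c - cell_d F' x c"
  by (simp add: cell_d_def sum_subtractf[symmetric] algebra_simps)

lemma cell_d_add: "cell_d (\<lambda>x c. F x c + F' x c) x c = cell_d F x c + cell_d F' x c"
  by (simp add: cell_d_def sum.distrib[symmetric] algebra_simps)

lemma cell_d_cong:
  assumes "x \<in> carrier G" "clique_chain E W (Suc q) c"
    and "\<And>y e. y \<in> carrier G \<Longrightarrow> clique_chain E W q e \<Longrightarrow> F y e = F' y e"
  shows "cell_d F x c = cell_d F' x c"
  unfolding cell_d_def
  using assms(1) gen_closed by (intro sum.cong HOL.refl) (simp add: assms(3)[OF _ clique_chain_iota'[OF assms(2)]])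

text \<open>Two contractions anticommute, while the double difference of \<open>F\<close> in two
  adjacent directions is symmetric because their generators commute. For nonadjacent directions the
  contracted chain is zero.\<close>

lemma cell_d_cell_d:
  assumes F: "\<And>x. lin (F x)" and x: "x \<in> carrier G" and c: "clique_chain E W q c"
  shows "cell_d (cell_d F) x c = 0"
proof -
  let ?e = "\<lambda>u w xs. c (u # w # xs)"
  let ?a = "\<lambda>u w. (F (x \<otimes> gen u \<otimes> gen w) (?e u w) - F (x \<otimes> gen u) (?e u w)) -
    (F (x \<otimes> gen w) (?e u w) - F x (?e u w))"
  have "cell_d (cell_d F) x c = (\<Sum>u\<in>V. \<Sum>w\<in>V. ?a u w)"
    by (simp add: cell_d_def sum_subtractf)
  \<comment> \<open>\<open>sum_antisymmetric\<close> asks for antisymmetry at all indices; padding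
    by 0 provides it outside \<open>V\<close>.\<close>
  also have "\<dots> = (\<Sum>u\<in>V. \<Sum>w\<in>V. if u \<in> V \<and> w \<in> V then ?a u w else 0)"
    by (intro sum.cong) auto
  also have "\<dots> = 0"
  proof (rule sum_antisymmetric[OF finite_V])
    fix u w
    have alt: "?e u w = (\<lambda>xs. - ?e w u xs)"
      using c alternatingD[of c "[]" u w] by (auto simp: clique_chain_def)
    have zero: "?e u w = (\<lambda>_. 0)" if "u = w \<or> {u, w} \<notin> E"
    proof (rule ext, rule ccontr)
      fix xs assume "?e u w xs \<noteq> 0"
      from clique_chainD[OF c this] show False using that by (auto simp: clique_def)
    qed
    show "(if u \<in> V \<and> u \<in> V then ?a u u else 0) = 0"
    proof -
      have "?e u u = (\<lambda>_. 0)"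
        using clique_chainD(2)[OF c, of "u # u # _"] by fastforce
      then show ?thesis by (simp add: lin_zero[OF F])
    qed
    show "(if u \<in> V \<and> w \<in> V then ?a u w else 0) = - (if w \<in> V \<and> u \<in> V then ?a w u else 0)"
    proof (cases "u \<in> V \<and> w \<in> V \<and> {u, w} \<in> E")
      case True
      then have "x \<otimes> gen u \<otimes> gen w = x \<otimes> gen w \<otimes> gen u"
        using x gen_closed gen_commute[of u w] by (simp add: m_assoc)
      then show ?thesis using True unfolding alt by (simp add: lin_uminus[OF F])
    next
      case False
      show ?thesis
      proof (cases "u \<in> V \<and> w \<in> V")
        case True
        with False have "?e u w = (\<lambda>_. 0)" "?e w u = (\<lambda>_. 0)"
          using zero alt by (auto simp: fun_eq_iff)
        then show ?thesis by (simp add: lin_zero[OF F])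
      qed auto
    qed
  qed
  finally show ?thesis .
qed

lemma cell_d_wedge:
  assumes F: "\<And>x. lin (F x)" and v: "v \<in> V"
  shows "cell_d F x (wedge v e) =
    F (x \<otimes> gen v) e - F x e - (\<Sum>u\<in>V - {v}. F (x \<otimes> gen u) (wedge v (iota u e)) - F x (wedge v (iota u e)))"
proof -
  have "cell_d F x (wedge v e) = (F (x \<otimes> gen v) e - F x e) +
      (\<Sum>u\<in>V - {v}. F (x \<otimes> gen u) (iota u (wedge v e)) - F x (iota u (wedge v e)))"
    unfolding cell_d_def by (subst sum.remove[OF finite_V v]) simp
  also have "(\<Sum>u\<in>V - {v}. F (x \<otimes> gen u) (iota u (wedge v e)) - F x (iota u (wedge v e))) =
      (\<Sum>u\<in>V - {v}. - (F (x \<otimes> gen u) (wedge v (iota u e)) - F x (wedge v (iota u e))))"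
    by (rule sum.cong) (simp_all add: lin_uminus[OF F])
  finally show ?thesis unfolding sum_negf by simp
qed

text \<open>On single vertices a functional is a family of values on edges, one for each
  \<open>x\<close> and \<open>w\<close>. Closedness on \<open>wedge u (single w)\<close>, the square
  spanned by \<open>u\<close> and \<open>w\<close>, is then the hypothesis of
  \<open>potential\<close>.\<close>

lemma cell_exact_1:
  assumes W: "W \<subseteq> V" and F: "\<And>x. lin (F x)"
    and closed: "\<And>x c. x \<in> carrier G \<Longrightarrow> clique_chain E W 2 c \<Longrightarrow> cell_d F x c = 0"
  shows "\<exists>D. (\<forall>x. lin (D x)) \<and> (\<forall>x\<in>carrier G. \<forall>c. clique_chain E W 1 c \<longrightarrow> cell_d D x c = F x c)"
proof -
  define single :: "'v \<Rightarrow> 'v list \<Rightarrow> 'k" where "single w xs = (if xs = [w] then 1 else 0)" for w xs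
  have chain: "clique_chain E {w} 1 (single w)" for w
    by (auto simp: clique_chain_def single_def alternating_def clique_def append_eq_Cons_conv)
  have wedge: "wedge u (iota v (single w)) = (if v = w then single u else (\<lambda>_. 0))" for u v w
  proof
    fix xs
    have "wedge u (\<lambda>xs. if xs = [] then 1 else 0) xs = single u xs"
      by (cases xs) (auto simp: single_def)
    then show "wedge u (iota v (single w)) xs = (if v = w then single u else (\<lambda>_. 0)) xs"
      by (simp add: single_def)
  qed
  have "F (x \<otimes> gen u) (single w) - F x (single w) = F (x \<otimes> gen w) (single u) - F x (single u)"
    if uw: "u \<in> W" "w \<in> W" "{u, w} \<in> E" and x: "x \<in> carrier G" for u w x
  proof -
    have ne: "u \<noteq> w" using no_loops uw(3) by blast
    have "clique_chain E W 2 (wedge u (single w))"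
      using clique_chain_wedge[OF chain[of w], of W u] uw ne by (simp add: numeral_2_eq_2)
    then have "0 = cell_d F x (wedge u (single w))" using closed x by simp
    also have "\<dots> = F (x \<otimes> gen u) (single w) - F x (single w) -
        (\<Sum>v\<in>V - {u}. if v = w then F (x \<otimes> gen w) (single u) - F x (single u) else 0)"
      unfolding cell_d_wedge[OF F subsetD[OF W uw(1)]]
      by (intro arg_cong2[where f = "(-)"] sum.cong HOL.refl) (auto simp: wedge lin_zero[OF F])
    also have "\<dots> = F (x \<otimes> gen u) (single w) - F x (single w) -
        (F (x \<otimes> gen w) (single u) - F x (single u))"
      using finite_V ne W uw by (simp add: sum.delta' subset_eq)
    finally show ?thesis by simp
  qed
  from potential[OF W, of "\<lambda>w x. F x (single w)", OF this]
  obtain p where p: "\<forall>x\<in>carrier G. \<forall>w\<in>W. p (x \<otimes> gen w) - p x = F x (single w)" by blast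
  let ?D = "\<lambda>x c. p x * c []"
  have "cell_d ?D x c = F x c" if x: "x \<in> carrier G" and c: "clique_chain E W 1 c" for x c
  proof -
    have "c = (\<lambda>xs. \<Sum>w\<in>W. c [w] * single w xs)"
    proof
      fix xs
      show "c xs = (\<Sum>w\<in>W. c [w] * single w xs)"
      proof (cases "\<exists>w\<in>W. xs = [w]")
        case True
        then show ?thesis using finite_subset[OF W finite_V] by (auto simp: single_def if_distrib cong: if_cong)
      next
        case False
        have "c xs = 0"
        proof (rule ccontr)
          assume "c xs \<noteq> 0"
          from clique_chainD[OF c this] False show False by (cases xs) auto
        qed
        moreover have "single w xs = 0" if "w \<in> W" for w using False that by (auto simp: single_def)
        ultimately show ?thesis by simp
      qed
    qed
    then have "F x c = F x (\<lambda>xs. \<Sum>w\<in>W. c [w] * single w xs)" by simp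
    also have "\<dots> = (\<Sum>w\<in>W. c [w] * F x (single w))" by (simp add: lin_sum[OF F] lin_scale[OF F])
    also have "\<dots> = (\<Sum>w\<in>W. p (x \<otimes> gen w) * c [w] - p x * c [w])"
      using p x by (intro sum.cong) (simp_all add: algebra_simps flip: left_diff_distrib)
    also have "\<dots> = cell_d ?D x c"
      unfolding cell_d_def
      by (rule sum.mono_neutral_left[OF finite_V W]) (use clique_chainD(3)[OF c] in fastforce)
    finally show ?thesis ..
  qed
  then show ?thesis by (intro exI[of _ ?D]) (simp add: lin_eval)
qed

text \<open>Induction on \<open>W\<close>: after correcting by the solution on \<open>W - {v}\<close>, the cocycle only sees the cliques
  containing \<open>v\<close>, so it is a cocycle of one degree less on the link of \<open>v\<close>.\<close>

lemma cell_exact: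
  assumes "W \<subseteq> V" and "\<And>x. lin (F x)"
    and "\<And>x c. x \<in> carrier G \<Longrightarrow> clique_chain E W (Suc (Suc q)) c \<Longrightarrow> cell_d F x c = 0"
  shows "\<exists>D. (\<forall>x. lin (D x)) \<and>
    (\<forall>x\<in>carrier G. \<forall>c. clique_chain E W (Suc q) c \<longrightarrow> cell_d D x c = F x c)"
  using assms
proof (induction "card W" arbitrary: W F q rule: less_induct)
  case less
  note W = less.prems(1) and F = less.prems(2) and closed = less.prems(3)
  have fin: "finite W" using W finite_V by (rule finite_subset)
  show ?case
  proof (cases q)
    case 0
    then show ?thesis using cell_exact_1[OF W F] closed by (simp add: numeral_2_eq_2)
  next
    \<comment> \<open>As \<open>q\<close> is positive here, lowering the degree by one on the link
      still leaves cliques with at least one vertex, where the induction hypothesis applies.\<close>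
    case (Suc r)
    show ?thesis
    proof (cases "W = {}")
      case True
      have "c = (\<lambda>_. 0)" if "clique_chain E W (Suc q) c" for c :: "'v list \<Rightarrow> 'k"
      proof (rule ext, rule ccontr)
        fix xs assume "c xs \<noteq> 0"
        from clique_chainD[OF that this] show False using True by auto
      qed
      then have "F x c = 0" if "clique_chain E W (Suc q) c" for x c
        using that lin_zero[OF F] by metis
      then show ?thesis by (intro exI[of _ "\<lambda>_ _. 0"]) (simp add: lin_zero_fun cell_d_def)
    next
      case False
      then obtain v W' where v: "W = insert v W'" "v \<notin> W'" by (meson Set.set_insert ex_in_conv)
      define L where "L = {w \<in> W'. {v, w} \<in> E}"
      have vV: "v \<in> V" and W': "W' \<subseteq> V" and L: "L \<subseteq> V" "L \<subseteq> W'" "L \<subseteq> W" "v \<notin> L" "\<And>w. w \<in> L \<Longrightarrow> {v, w} \<in> E"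
        using W v by (auto simp: L_def)
      have card: "card W' < card W" "card L < card W"
        using v fin L(2) card_mono[of W' L] by (auto simp: less_Suc_eq_le)
      have link: "clique_chain E L r (iota v c)" if "clique_chain E W (Suc r) c" for r and c :: "'v list \<Rightarrow> 'k"
        by (rule clique_chain_mono[OF clique_chain_iota[OF that]]) (use v no_loops in \<open>auto simp: L_def\<close>)
      have W'W: "clique_chain E W r c" if "clique_chain E W' r c" for r and c :: "'v list \<Rightarrow> 'k"
        by (rule clique_chain_mono[OF that]) (use v in auto)
      obtain D1 where D1: "\<And>x. lin (D1 x)"
        and FD1: "\<And>x c. x \<in> carrier G \<Longrightarrow> clique_chain E W' (Suc q) c \<Longrightarrow> cell_d D1 x c = F x c"
        using less.hyps[OF card(1) W' F closed[OF _ W'W], of q] by blast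
      \<comment> \<open>\<open>D1\<close> is a solution over \<open>W'\<close> only. After
        \<open>chain_restrict\<close> it ignores the cliques through \<open>v\<close> and is
        unchanged on chains over \<open>W'\<close>.\<close>
      let ?D1 = "\<lambda>x c. D1 x (chain_restrict W' c)"
      let ?F2 = "\<lambda>x c. F x c - cell_d ?D1 x c"
      have D1': "lin (?D1 x)" for x using D1 by (rule lin_restrict)
      have F2: "lin (?F2 x)" for x by (intro lin_diff_fun F lin_cell_d D1')
      have F2_W': "?F2 x c = 0" if x: "x \<in> carrier G" and c: "clique_chain E W' (Suc q) c" for x c
      proof -
        have "cell_d ?D1 x c = cell_d D1 x c"
          by (rule cell_d_cong[OF x c]) (simp add: chain_restrict_id)
        then show ?thesis using FD1[OF x c] by simp
      qed
      have F2_closed: "cell_d ?F2 x c = 0" if x: "x \<in> carrier G" and c: "clique_chain E W (Suc (Suc q)) c" for x c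
        unfolding cell_d_diff using closed[OF x c] cell_d_cell_d[OF D1' x c] by simp
      \<comment> \<open>Since \<open>?F2\<close> vanishes on chains avoiding \<open>v\<close>, it is
        determined by its values on \<open>wedge v e\<close> with \<open>e\<close> on the
        link.\<close>
      let ?b = "\<lambda>x e. ?F2 x (wedge v e)"
      have b_closed: "cell_d ?b x e = 0" if x: "x \<in> carrier G" and e: "clique_chain E L (Suc q) e" for x e
      proof -
        have eW: "clique_chain E W (Suc (Suc q)) (wedge v e)"
          by (rule clique_chain_wedge[OF e L(3) _ L(4,5)]) (simp_all add: v)
        have eW': "clique_chain E W' (Suc q) e" by (rule clique_chain_mono[OF e L(2)])
        have "iota v e = (\<lambda>_. 0)" by (rule iota_outside[OF e L(4)])
        then have zero: "wedge v (iota v e) = (\<lambda>_. 0)" by auto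
        have "cell_d ?b x e = (\<Sum>u\<in>V - {v}. ?b (x \<otimes> gen u) (iota u e) - ?b x (iota u e))"
          unfolding cell_d_def[of ?b]
          by (subst sum.remove[OF finite_V vV]) (simp only: zero lin_zero[OF F2], simp)
        \<comment> \<open>The formula of \<open>cell_d_wedge\<close>, solved for the sum over the
          link directions. The first two terms vanish because \<open>e\<close> avoids
          \<open>v\<close>, the last because \<open>?F2\<close> is closed.\<close>
        also have "\<dots> = ?F2 (x \<otimes> gen v) e - ?F2 x e - cell_d ?F2 x (wedge v e)"
          unfolding cell_d_wedge[OF F2 vV] by simp
        also have "\<dots> = 0"
          using F2_closed[OF x eW] F2_W'[OF x eW'] F2_W'[of "x \<otimes> gen v", OF _ eW'] x gen_closed[OF vV] by simp
        finally show ?thesis .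
      qed
      obtain a where a: "\<And>x. lin (a x)"
        and ba: "\<And>x e. x \<in> carrier G \<Longrightarrow> clique_chain E L q e \<Longrightarrow> cell_d a x e = ?b x e"
        using less.hyps[OF card(2) L(1) lin_wedge[OF F2] b_closed[unfolded Suc]] unfolding Suc by blast
      \<comment> \<open>The sign compensates the one that appears when the contraction with
        \<open>v\<close> is moved past the contraction in \<open>cell_d\<close>.\<close>
      let ?D2 = "\<lambda>x c. - a x (iota v c)"
      have D2: "lin (?D2 x)" for x by (intro lin_uminus_fun lin_iota a)
      have "cell_d (\<lambda>x c. ?D1 x c + ?D2 x c) x c = F x c"
        if x: "x \<in> carrier G" and c: "clique_chain E W (Suc q) c" for x c
      proof -
        have alt: "iota v (iota u c) = (\<lambda>xs. - iota u (iota v c) xs)" for u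
          using c alternatingD[of c "[]" u v] by (auto simp: clique_chain_def)
        have "cell_d ?D2 x c = cell_d a x (iota v c)"
          unfolding cell_d_def by (intro sum.cong HOL.refl) (simp add: alt lin_uminus[OF a])
        also have "\<dots> = ?F2 x (wedge v (iota v c))" by (rule ba[OF x link[OF c]])
        also have "\<dots> = ?F2 x (chain_restrict W' c) + ?F2 x (wedge v (iota v c))"
          using F2_W'[OF x clique_chain_restrict[OF c]] by simp
        also have "\<dots> = ?F2 x c"
          using lin_add[OF F2, of x "chain_restrict W' c" "wedge v (iota v c)"]
            clique_chain_split[OF c[unfolded v(1)] v(2)] by simp
        finally show ?thesis unfolding cell_d_add by simp
      qed
      moreover have "lin (\<lambda>c. ?D1 x c + ?D2 x c)" for x by (rule lin_add_fun[OF D1' D2])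
      ultimately show ?thesis by (intro exI[of _ "\<lambda>x c. ?D1 x c + ?D2 x c"] conjI allI ballI impI) simp_all
    qed
  qed
qed

end

section \<open>Linear duality\<close>

text \<open>Over a field, \<open>d\<close> has a linear right inverse on the image of
  \<open>S\<close> that is defined on all functions; composing it with \<open>\<phi>\<close> gives a
  functional that is linear everywhere. Two preimages in \<open>S\<close> differ by an element of
  the kernel, which \<open>\<phi>\<close> kills.\<close>

lemma lin_factors:
  fixes \<phi> :: "('v list \<Rightarrow> 'k::field) \<Rightarrow> 'k" and S :: "('v list \<Rightarrow> 'k) set"
    and d :: "('v list \<Rightarrow> 'k) \<Rightarrow> 'v list \<Rightarrow> 'k"
  assumes S: "\<And>x y. x \<in> S \<Longrightarrow> y \<in> S \<Longrightarrow> (\<lambda>xs. x xs + y xs) \<in> S" "\<And>a x. x \<in> S \<Longrightarrow> (\<lambda>xs. a * x xs) \<in> S"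
      "(\<lambda>_. 0) \<in> S"
    and d: "\<And>x y. d (\<lambda>xs. x xs + y xs) = (\<lambda>xs. d x xs + d y xs)" "\<And>a x. d (\<lambda>xs. a * x xs) = (\<lambda>xs. a * d x xs)"
    and \<phi>: "lin \<phi>" "\<And>x. x \<in> S \<Longrightarrow> d x = (\<lambda>_. 0) \<Longrightarrow> \<phi> x = 0"
  shows "\<exists>\<psi>. lin \<psi> \<and> (\<forall>x\<in>S. \<psi> (d x) = \<phi> x)"
proof -
  interpret chains: vector_space "\<lambda>(a::'k) c (xs::'v list). a * c xs"
    by standard (auto simp: fun_eq_iff algebra_simps)
  interpret chains_pair: vector_space_pair
    "\<lambda>(a::'k) c (xs::'v list). a * c xs" "\<lambda>(a::'k) c (xs::'v list). a * c xs" ..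
  have sub: "chains.subspace S"
    by (rule chains.subspaceI) (use S in \<open>auto simp: plus_fun_def zero_fun_def\<close>)
  have lin: "Vector_Spaces.linear (\<lambda>a c xs. a * c xs) (\<lambda>a c xs. a * c xs) d"
    unfolding Vector_Spaces.linear_iff
    using chains.vector_space_axioms by (simp add: plus_fun_def d)
  obtain r where r: "range r \<subseteq> S" "Vector_Spaces.linear (\<lambda>a c xs. a * c xs) (\<lambda>a c xs. a * c xs) r"
    "\<And>y. y \<in> d ` S \<Longrightarrow> d (r y) = y"
    using chains_pair.linear_exists_right_inverse_on[OF lin sub] by auto
  interpret r: Vector_Spaces.linear "\<lambda>a c xs. a * c xs" "\<lambda>a c xs. a * c xs" r by (rule r(2))
  have "lin (\<lambda>y. \<phi> (r y))"
    using \<phi>(1) r.add r.scale unfolding lin_def by (simp add: plus_fun_def)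
  moreover have "\<phi> (r (d x)) = \<phi> x" if x: "x \<in> S" for x
  proof -
    let ?y = "r (d x)"
    have y: "?y \<in> S" "d ?y = d x" using r(1,3) x by auto
    define z where "z = (\<lambda>xs. ?y xs + - 1 * x xs)"
    have "z \<in> S" unfolding z_def by (intro S y x)
    moreover have "d z = (\<lambda>_. 0)" unfolding z_def d y(2) by simp
    ultimately have "\<phi> z = 0" by (rule \<phi>(2))
    moreover have "\<phi> z = \<phi> ?y + - 1 * \<phi> x"
      unfolding z_def lin_add[OF \<phi>(1)] lin_scale[OF \<phi>(1)] ..
    ultimately show ?thesis by simp
  qed
  ultimately show ?thesis by (intro exI[of _ "\<lambda>y. \<phi> (r y)"]) simp
qed

lemma clique_chain_add:
  assumes "clique_chain E W q c" "clique_chain E W q d"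
  shows "clique_chain E W q (\<lambda>xs. c xs + d xs)"
proof -
  have "c (xs @ [x, y] @ ys) + d (xs @ [x, y] @ ys) = - (c (xs @ [y, x] @ ys) + d (xs @ [y, x] @ ys))" for xs x y ys
    using assms alternatingD[of c xs x y ys] alternatingD[of d xs x y ys] by (simp add: clique_chain_def)
  then have "alternating (\<lambda>xs. c xs + d xs)" unfolding alternating_def by blast
  moreover have "c xs \<noteq> 0 \<or> d xs \<noteq> 0" if "c xs + d xs \<noteq> 0" for xs using that by auto
  ultimately show ?thesis using assms unfolding clique_chain_def by blast
qed

lemma clique_chain_scale:
  assumes "clique_chain E W q c"
  shows "clique_chain E W q (\<lambda>xs. a * c xs)"
proof -
  have "a * c (xs @ [x, y] @ ys) = - (a * c (xs @ [y, x] @ ys))" for xs x y ys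
    using assms alternatingD[of c xs x y ys] by (simp add: clique_chain_def)
  then have "alternating (\<lambda>xs. a * c xs)" unfolding alternating_def by blast
  with assms show ?thesis by (simp add: clique_chain_def)
qed

lemma clique_chain_zero: "clique_chain E W q (\<lambda>_. 0)"
  by (auto simp: clique_chain_def alternating_def)

lemma clique_chain_0: "clique_chain E W 0 c \<longleftrightarrow> (\<forall>xs. xs \<noteq> [] \<longrightarrow> c xs = 0)"
proof
  assume c: "\<forall>xs. xs \<noteq> [] \<longrightarrow> c xs = 0"
  then have "xs = []" if "c xs \<noteq> 0" for xs using that by blast
  then show "clique_chain E W 0 c"
    unfolding clique_chain_def alternating_def using c by (fastforce simp: clique_def)
qed (auto simp: clique_chain_def)

lemma simplicial_bd_iota:
  assumes "finite V" "clique_chain E V q c"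
  shows "simplicial_bd c = (\<lambda>xs. \<Sum>v\<in>V. iota v c xs)"
proof
  fix xs
  have "{v. c (v # xs) \<noteq> 0} \<subseteq> V" using clique_chainD(3)[OF assms(2)] by fastforce
  then show "simplicial_bd c xs = (\<Sum>v\<in>V. iota v c xs)"
    unfolding simplicial_bd_def using assms(1) by (intro sum.mono_neutral_left) auto
qed

lemma acyclic_cycle_is_boundary:
  fixes k :: "'k::field itself"
  assumes "finite V" and acyclic: "acyclic_over k (flag_complex V E)"
    and c: "clique_chain E V q c" "(\<lambda>xs. \<Sum>v\<in>V. iota v c xs) = (\<lambda>_. 0::'k)"
  shows "\<exists>d. clique_chain E V (Suc q) d \<and> c = (\<lambda>xs. \<Sum>v\<in>V. iota v d xs)"
proof -
  let ?K = "flag_complex V E"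
  let ?Z = "reduced_cycle_group k ?K q" and ?B = "simplicial_bd ` oriented_chains k ?K (Suc q)"
  note oc = oriented_chains_clique_chain[OF assms(1), of _ k E]
  have cZ: "c \<in> carrier ?Z"
    using c simplicial_bd_iota[OF assms(1) c(1)] by (simp add: reduced_cycle_group_def oc)
  \<comment> \<open>Zero being a boundary, \<open>c\<close> lies in its own coset, and the only
    coset is that of the boundaries.\<close>
  have zero_B: "(\<lambda>_. 0) \<in> ?B"
    by (rule image_eqI[of _ _ "\<lambda>_. 0"]) (simp_all add: oc clique_chain_zero simplicial_bd_def fun_eq_iff)
  have "trivial_group (?Z Mod ?B)"
    using acyclic unfolding acyclic_over_def reduced_homology_def by blast
  then have triv: "carrier (?Z Mod ?B) = {?B}"
    by (simp add: trivial_group_def FactGroup_def)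
  have "?B #>\<^bsub>?Z\<^esub> c \<in> carrier (?Z Mod ?B)"
    unfolding FactGroup_def RCOSETS_def using cZ by auto
  then have "?B #>\<^bsub>?Z\<^esub> c = ?B" unfolding triv by simp
  moreover have "c \<in> ?B #>\<^bsub>?Z\<^esub> c"
    unfolding r_coset_def by (intro UN_I[OF zero_B]) (simp add: reduced_cycle_group_def)
  ultimately have "c \<in> ?B" by simp
  then obtain d where "d \<in> oriented_chains k ?K (Suc q)" "c = simplicial_bd d" by blast
  then show ?thesis using simplicial_bd_iota[OF assms(1), of E "Suc q" d] oc by auto
qed

section \<open>Right-angled Artin groups\<close>

definition raag_class :: "'a set \<Rightarrow> 'a set set \<Rightarrow> 'a word \<Rightarrow> 'a word set" where
  "raag_class V E u = word_cong V (commutation_relators E) `` {u}"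

context
  fixes V :: "'a set" and E :: "'a set set"
begin

interpretation group "raag V E" by (rule group_raag)

abbreviation (input) "cls \<equiv> raag_class V E"
abbreviation (input) "gn v \<equiv> cls [(v, True)]"

lemma raag_carrier: "X \<in> carrier (raag V E) \<longleftrightarrow> (\<exists>u\<in>words V. X = cls u)"
  by (auto simp: raag_def raag_class_def presented_group_def quotient_def)

lemma raag_class_closed: "u \<in> words V \<Longrightarrow> cls u \<in> carrier (raag V E)"
  using raag_carrier by blast

lemma raag_class_append:
  "u \<in> words V \<Longrightarrow> w \<in> words V \<Longrightarrow> cls (u @ w) = cls u \<otimes>\<^bsub>raag V E\<^esub> cls w"
  by (simp add: raag_def raag_class_def mult_presented_group)

lemma raag_class_Nil: "cls [] = \<one>\<^bsub>raag V E\<^esub>"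
  by (simp add: raag_def raag_class_def presented_group_def)

lemma raag_class_cong: "(u, w) \<in> word_cong V (commutation_relators E) \<Longrightarrow> cls u = cls w"
  unfolding raag_class_def by (rule equiv_class_eq[OF equiv_word_cong])

lemma raag_class_eqD:
  "cls u = cls w \<Longrightarrow> w \<in> words V \<Longrightarrow> (u, w) \<in> word_cong V (commutation_relators E)"
  unfolding raag_class_def using word_cong.refl[of w V] by blast

lemma words_simps: "[] \<in> words V" "l # u \<in> words V \<longleftrightarrow> fst l \<in> V \<and> u \<in> words V"
  "u @ w \<in> words V \<longleftrightarrow> u \<in> words V \<and> w \<in> words V"
  by (auto simp: words_def mem_Times_iff)

lemma raag_class_inverse: "v \<in> V \<Longrightarrow> cls [(v, False)] = inv\<^bsub>raag V E\<^esub> gn v"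
proof (rule inv_equality[symmetric])
  assume v: "v \<in> V"
  have "([] @ [(v, False), (v, \<not> False)] @ [], [] @ []) \<in> word_cong V (commutation_relators E)"
    by (rule word_cong.cancel) (simp_all add: v words_simps)
  then have "cls ([(v, False)] @ [(v, True)]) = cls []" using raag_class_cong by simp
  then show "cls [(v, False)] \<otimes>\<^bsub>raag V E\<^esub> gn v = \<one>\<^bsub>raag V E\<^esub>"
    using raag_class_append[of "[(v, False)]" "[(v, True)]"] v by (simp add: words_simps raag_class_Nil)
qed (simp_all add: raag_class_closed words_simps)

lemma raag_gen_commute:
  assumes "v \<in> V" "w \<in> V" "{v, w} \<in> E"
  shows "gn v \<otimes>\<^bsub>raag V E\<^esub> gn w = gn w \<otimes>\<^bsub>raag V E\<^esub> gn v"
proof -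
  have "([] @ [(v, True), (w, True)] @ [], [] @ [(w, True), (v, True)] @ []) \<in> word_cong V (commutation_relators E)"
    by (rule word_cong.relator) (use assms in \<open>auto simp: words_simps commutation_relators_def\<close>)
  then have "cls ([(v, True)] @ [(w, True)]) = cls ([(w, True)] @ [(v, True)])"
    using raag_class_cong by simp
  then show ?thesis using assms by (simp add: raag_class_append words_simps del: append.simps)
qed

text \<open>The Cayley graph is connected: an inverse letter is an edge traversed backwards.\<close>

lemma raag_gen_invariant:
  assumes H: "\<And>y v. y \<in> carrier (raag V E) \<Longrightarrow> v \<in> V \<Longrightarrow> H (y \<otimes>\<^bsub>raag V E\<^esub> gn v) = H y"
    and x: "x \<in> carrier (raag V E)"
  shows "H x = H \<one>\<^bsub>raag V E\<^esub>"
proof -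
  have "u \<in> words V \<Longrightarrow> H (cls u) = H \<one>\<^bsub>raag V E\<^esub>" for u
  proof (induction u rule: rev_induct)
    case Nil
    then show ?case by (simp add: raag_class_Nil)
  next
    case (snoc l u)
    obtain v b where l: "l = (v, b)" by force
    have v: "v \<in> V" and u: "u \<in> words V" using snoc.prems l by (simp_all add: words_simps)
    have g: "gn v \<in> carrier (raag V E)" "cls u \<in> carrier (raag V E)"
      using u v by (simp_all add: raag_class_closed words_simps)
    show ?case
    proof (cases b)
      case True
      then show ?thesis using H[OF g(2) v] snoc.IH[OF u] u v l
        by (simp add: raag_class_append words_simps)
    next
      case False
      let ?y = "cls u \<otimes>\<^bsub>raag V E\<^esub> inv\<^bsub>raag V E\<^esub> gn v"
      have "?y \<otimes>\<^bsub>raag V E\<^esub> gn v = cls u" using g by (simp add: m_assoc)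
      then have "H ?y = H (cls u)" using H[of ?y v] v g by simp
      moreover have "cls (u @ [l]) = ?y"
        using False u v l by (simp add: raag_class_append words_simps raag_class_inverse)
      ultimately show ?thesis using snoc.IH[OF u] by simp
    qed
  qed
  with x show ?thesis unfolding raag_carrier by blast
qed

text \<open>Walking along a word from \<open>x\<close> while ignoring the letters outside \<open>W\<close> and adding up the values of \<open>f\<close>
  on the edges. Ignoring these letters is compatible with the relations, so the walk only depends on the
  group element. As \<open>x \<rho>(x)\<inverse>\<close> is constant on cosets of the subgroup generated by \<open>W\<close>, where \<open>\<rho>\<close> is the
  retraction onto it, walking from \<open>x \<rho>(x)\<inverse>\<close> along \<open>x\<close> gives a potential.\<close>

definition walk_step :: "'a set \<Rightarrow> ('a \<Rightarrow> 'a word set \<Rightarrow> 'k::ab_group_add) \<Rightarrow> 'a \<times> bool \<Rightarrow>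
    'a word set \<times> 'k \<Rightarrow> 'a word set \<times> 'k" where
  "walk_step W f l st = (let v = fst l; x = fst st; a = snd st in
    if v \<notin> W then st
    else if snd l then (x \<otimes>\<^bsub>raag V E\<^esub> gn v, a + f v x)
    else (x \<otimes>\<^bsub>raag V E\<^esub> inv\<^bsub>raag V E\<^esub> gn v, a - f v (x \<otimes>\<^bsub>raag V E\<^esub> inv\<^bsub>raag V E\<^esub> gn v)))"

definition walk :: "'a set \<Rightarrow> ('a \<Rightarrow> 'a word set \<Rightarrow> 'k::ab_group_add) \<Rightarrow> 'a word \<Rightarrow>
    'a word set \<times> 'k \<Rightarrow> 'a word set \<times> 'k" where
  "walk W f = fold (walk_step W f)"

lemma walk_closed:
  "u \<in> words V \<Longrightarrow> fst st \<in> carrier (raag V E) \<Longrightarrow> fst (walk W f u st) \<in> carrier (raag V E)"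
proof (induction u arbitrary: st)
  case (Cons l u)
  have "gn (fst l) \<in> carrier (raag V E)" using Cons.prems by (simp add: raag_class_closed words_simps)
  then have "fst (walk_step W f l st) \<in> carrier (raag V E)"
    using Cons.prems(2) by (simp add: walk_step_def Let_def)
  with Cons show ?case by (simp add: walk_def words_simps)
qed (simp add: walk_def)

text \<open>The position of a walk does not depend on the accumulated sum, so \<open>a\<close> and
  \<open>b\<close> may differ.\<close>

lemma walk_translate:
  "u \<in> words V \<Longrightarrow> x \<in> carrier (raag V E) \<Longrightarrow> y \<in> carrier (raag V E) \<Longrightarrow>
    fst (walk W f u (x \<otimes>\<^bsub>raag V E\<^esub> y, a)) = x \<otimes>\<^bsub>raag V E\<^esub> fst (walk W f u (y, b))"
proof (induction u arbitrary: y a b)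
  case (Cons l u)
  have g: "gn (fst l) \<in> carrier (raag V E)" using Cons.prems by (simp add: raag_class_closed words_simps)
  with Cons show ?case by (simp add: walk_def words_simps walk_step_def Let_def m_assoc)
qed (simp add: walk_def)

text \<open>A cancelling pair goes along an edge and back. The two sides of a commutation relator go
  around a square in the two ways, which the cocycle condition makes equal; if one of the letters is
  outside \<open>W\<close>, it is ignored and both ways are the same walk.\<close>

lemma walk_cong:
  assumes cocycle: "\<And>u w x. u \<in> W \<Longrightarrow> w \<in> W \<Longrightarrow> {u, w} \<in> E \<Longrightarrow> x \<in> carrier (raag V E) \<Longrightarrow>
      f w (x \<otimes>\<^bsub>raag V E\<^esub> gn u) - f w x = f u (x \<otimes>\<^bsub>raag V E\<^esub> gn w) - f u x"
    and "(u, w) \<in> word_cong V (commutation_relators E)" "fst st \<in> carrier (raag V E)"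
  shows "walk W f u st = walk W f w st"
  using assms(2,3)
proof (induction arbitrary: st rule: word_cong.induct)
  case (cancel u w s b)
  let ?st = "walk W f u st"
  have "fst ?st \<in> carrier (raag V E)" by (rule walk_closed[OF cancel(1,4)])
  moreover have "gn s \<in> carrier (raag V E)" using cancel(3) by (simp add: raag_class_closed words_simps)
  ultimately have "walk_step W f (s, \<not> b) (walk_step W f (s, b) ?st) = ?st"
    by (cases b) (simp_all add: walk_step_def Let_def m_assoc)
  then show ?case by (simp add: walk_def)
next
  case (relator u w l r)
  let ?st = "walk W f u st"
  obtain a b where ab: "l = [(a, True), (b, True)]" "r = [(b, True), (a, True)]" "{a, b} \<in> E"
    using relator(3) by (auto simp: commutation_relators_def)
  have V: "a \<in> V" "b \<in> V" using relator(4) ab by (simp_all add: words_simps)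
  have x: "fst ?st \<in> carrier (raag V E)" by (rule walk_closed[OF relator(1,6)])
  have "fst ?st \<otimes>\<^bsub>raag V E\<^esub> gn a \<otimes>\<^bsub>raag V E\<^esub> gn b = fst ?st \<otimes>\<^bsub>raag V E\<^esub> gn b \<otimes>\<^bsub>raag V E\<^esub> gn a"
    using V x raag_gen_commute[OF V ab(3)] by (simp add: m_assoc raag_class_closed words_simps)
  then have "walk_step W f (b, True) (walk_step W f (a, True) ?st) =
      walk_step W f (a, True) (walk_step W f (b, True) ?st)"
    using cocycle[OF _ _ ab(3) x] by (simp add: walk_step_def Let_def algebra_simps)
  then show ?case using ab by (simp add: walk_def)
qed simp_all

lemma raag_potential:
  fixes f :: "'a \<Rightarrow> 'a word set \<Rightarrow> 'k::ab_group_add"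
  assumes W: "W \<subseteq> V"
    and cocycle: "\<And>u w x. u \<in> W \<Longrightarrow> w \<in> W \<Longrightarrow> {u, w} \<in> E \<Longrightarrow> x \<in> carrier (raag V E) \<Longrightarrow>
      f w (x \<otimes>\<^bsub>raag V E\<^esub> gn u) - f w x = f u (x \<otimes>\<^bsub>raag V E\<^esub> gn w) - f u x"
  shows "\<exists>p. \<forall>x\<in>carrier (raag V E). \<forall>w\<in>W. p (x \<otimes>\<^bsub>raag V E\<^esub> gn w) - p x = f w x"
proof -
  define rep where "rep x = (SOME u. u \<in> words V \<and> x = cls u)" for x
  \<comment> \<open>The walk from the neutral element along a word for \<open>x\<close> ends at the
    retraction of \<open>x\<close> onto the subgroup generated by \<open>W\<close>.\<close>
  define start where "start u x = x \<otimes>\<^bsub>raag V E\<^esub> inv\<^bsub>raag V E\<^esub> fst (walk W f u (\<one>\<^bsub>raag V E\<^esub>, 0))" for u x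
  define p where "p x = snd (walk W f (rep x) (start (rep x) x, 0))" for x
  have p: "p (cls u) = snd (walk W f u (start u (cls u), 0))" if u: "u \<in> words V" for u
  proof -
    have rep: "rep (cls u) \<in> words V \<and> cls u = cls (rep (cls u))"
      unfolding rep_def by (rule someI[of _ u]) (simp add: u)
    then have "(rep (cls u), u) \<in> word_cong V (commutation_relators E)"
      using u by (intro raag_class_eqD) simp_all
    then have walk: "walk W f (rep (cls u)) st = walk W f u st" if "fst st \<in> carrier (raag V E)" for st
      using walk_cong[where f = f, OF cocycle] that by blast
    have "start u (cls u) \<in> carrier (raag V E)"
      unfolding start_def using u walk_closed[OF u, of "(\<one>\<^bsub>raag V E\<^esub>, 0)" W f] by (simp add: raag_class_closed)
    then show ?thesis unfolding p_def by (simp add: start_def walk)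
  qed
  have "p (x \<otimes>\<^bsub>raag V E\<^esub> gn w) - p x = f w x" if x: "x \<in> carrier (raag V E)" and w: "w \<in> W" for x w
  proof -
    obtain u where u: "u \<in> words V" "x = cls u" using x raag_carrier by blast
    let ?u = "u @ [(w, True)]" and ?r = "fst (walk W f u (\<one>\<^bsub>raag V E\<^esub>, 0))"
    have uw: "?u \<in> words V" "cls ?u = x \<otimes>\<^bsub>raag V E\<^esub> gn w"
      using u w W by (auto simp: words_simps raag_class_append)
    have g: "gn w \<in> carrier (raag V E)" using w W by (auto simp: raag_class_closed words_simps)
    have r: "?r \<in> carrier (raag V E)" using walk_closed[OF u(1), of "(\<one>\<^bsub>raag V E\<^esub>, 0)" W f] by simp
    have step: "walk W f ?u st = (fst (walk W f u st) \<otimes>\<^bsub>raag V E\<^esub> gn w,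
        snd (walk W f u st) + f w (fst (walk W f u st)))" for st
      using w by (simp add: walk_def walk_step_def Let_def)
    \<comment> \<open>Appending a letter of \<open>W\<close> multiplies both \<open>x\<close> and
      its retraction by the same generator on the right.\<close>
    have s: "start ?u (x \<otimes>\<^bsub>raag V E\<^esub> gn w) = start u x"
      using x g r by (simp add: start_def step inv_mult_group m_assoc mult_inv_mult)
    have "start u x \<in> carrier (raag V E)" using x r by (simp add: start_def)
    then have "fst (walk W f u (start u x, 0)) = start u x \<otimes>\<^bsub>raag V E\<^esub> ?r"
      using walk_translate[OF u(1), of "start u x" "\<one>\<^bsub>raag V E\<^esub>" W f 0 0] by simp
    also have "\<dots> = x" using x r by (simp add: start_def m_assoc)
    finally have "fst (walk W f u (start u x, 0)) = x" .
    moreover have "p (x \<otimes>\<^bsub>raag V E\<^esub> gn w) = snd (walk W f ?u (start u x, 0))"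
      using p[OF uw(1)] unfolding uw(2) s .
    moreover have "p x = snd (walk W f u (start u x, 0))" using p[OF u(1)] u(2) by simp
    ultimately show ?thesis by (simp add: step)
  qed
  then show ?thesis by blast
qed

end

section \<open>Comparison of the bar complex and the cellular complex\<close>

lemma lin_scale_fun: "lin \<phi> \<Longrightarrow> lin (\<lambda>c. a * \<phi> c)"
  by (simp add: lin_def algebra_simps)

lemma lin_hbd: "(\<And>ys. lin (\<Phi> ys)) \<Longrightarrow> lin (\<lambda>c. hbd (\<lambda>ys. \<Phi> ys c) gs)"
  unfolding hbd_def by (intro lin_sum_fun lin_scale_fun)

text \<open>Elements of the double complex: the list carries the bar direction, the group element and the
  functional the cellular direction.\<close>

type_synonym ('g, 'v, 'k) bicochain = "'g list \<Rightarrow> 'g \<Rightarrow> ('v list \<Rightarrow> 'k) \<Rightarrow> 'k"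

locale acyclic_clique_group = clique_group G ht s V E gen k
  for G (structure) and ht s and V :: "'v set" and E gen and k :: "'k::field itself" +
  assumes acyclic: "\<And>q c. clique_chain E V q c \<Longrightarrow> (\<lambda>xs. \<Sum>v\<in>V. iota v c xs) = (\<lambda>_. 0 :: 'k) \<Longrightarrow>
    \<exists>d. clique_chain E V (Suc q) d \<and> c = (\<lambda>xs. \<Sum>v\<in>V. iota v d xs)"
begin

abbreviation bd :: "('v list \<Rightarrow> 'k) \<Rightarrow> 'v list \<Rightarrow> 'k" where
  "bd c \<equiv> \<lambda>xs. \<Sum>v\<in>V. iota v c xs"

text \<open>The dual form of acyclicity: cycles are boundaries, so a functional that kills
  boundaries kills the kernel of \<open>bd\<close> and factors through it.\<close>

lemma cocycle_factors:
  assumes "lin \<phi>" "\<And>c. clique_chain E V (Suc q) c \<Longrightarrow> \<phi> (bd c) = 0"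
  shows "\<exists>\<psi>. lin \<psi> \<and> (\<forall>c. clique_chain E V q c \<longrightarrow> \<psi> (bd c) = \<phi> c)"
proof -
  have "\<exists>\<psi>. lin \<psi> \<and> (\<forall>x\<in>{c. clique_chain E V q c}. \<psi> (bd x) = \<phi> x)"
  proof (rule lin_factors)
    show "bd (\<lambda>xs. x xs + y xs) = (\<lambda>xs. bd x xs + bd y xs)" for x y
      by (simp add: sum.distrib)
    show "bd (\<lambda>xs. a * x xs) = (\<lambda>xs. a * bd x xs)" for a x
      by (simp add: sum_distrib_left)
    fix x assume "x \<in> {c. clique_chain E V q c}" and zero: "bd x = (\<lambda>_. 0)"
    then obtain d where "clique_chain E V (Suc q) d" "x = bd d" using acyclic[of q x] by auto
    then show "\<phi> x = 0" using assms(2) by simp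
  qed (simp_all add: assms(1) clique_chain_add clique_chain_scale clique_chain_zero)
  then show ?thesis by simp
qed

definition invariant_on :: "('a \<Rightarrow> 'd) \<Rightarrow> bool" where
  "invariant_on g \<longleftrightarrow> (\<forall>b\<in>Ker. \<forall>x\<in>carrier G. g (b \<otimes> x) = g x)"

lemma invariant_on_ht:
  assumes "invariant_on g" "x \<in> carrier G" "y \<in> carrier G" "ht x = ht y"
  shows "g x = g y"
proof -
  have "x \<otimes> inv y \<in> Ker" using assms by (simp add: Ker_def ht_mult ht_inv)
  then have "g (x \<otimes> inv y \<otimes> y) = g y" using assms unfolding invariant_on_def by blast
  then show ?thesis using assms by (simp add: m_assoc)
qed

text \<open>On \<open>Ker\<close>-invariant cellular cochains the cellular coboundary is \<open>T - 1\<close>, where \<open>T\<close> is translation by \<open>s\<close>, composed with the dual of the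
  simplicial boundary, so acyclicity makes \<open>T\<close> the identity on cohomology.\<close>

lemma invariant_monodromy:
  assumes g: "invariant_on g" "\<And>x. lin (g x)"
    and closed: "\<And>x c. x \<in> carrier G \<Longrightarrow> clique_chain E V (Suc q) c \<Longrightarrow> cell_d g x c = 0"
  shows "\<exists>g'. invariant_on g' \<and> (\<forall>x. lin (g' x)) \<and>
    (\<forall>x\<in>carrier G. \<forall>c. clique_chain E V q c \<longrightarrow> g (s \<otimes> x) c - g x c = cell_d g' x c)"
proof -
  \<comment> \<open>The points \<open>x \<otimes> gen v\<close> and \<open>s \<otimes> x\<close>
    have the same height, hence lie in the same coset of \<open>Ker\<close>.\<close>
  have g_gen: "g (x \<otimes> gen v) = g (s \<otimes> x)" if "x \<in> carrier G" "v \<in> V" for x v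
    using that gen_closed ht_gen by (intro invariant_on_ht[OF g(1)]) (simp_all add: ht_mult ht_s)
  let ?\<phi> = "\<lambda>i c. g (s [^] (i + 1 :: int)) c - g (s [^] i) c"
  have \<phi>: "g (s \<otimes> x) c - g x c = ?\<phi> (ht x) c" if x: "x \<in> carrier G" for x c
    using invariant_on_ht[OF g(1), of "s \<otimes> x" "s [^] (ht x + 1)"]
      invariant_on_ht[OF g(1) x, of "s [^] ht x"] x
    by (simp add: ht_mult ht_s ht_int_pow)
  have cell: "cell_d g x c = ?\<phi> (ht x) (bd c)" if x: "x \<in> carrier G" for x c
  proof -
    have "cell_d g x c = (\<Sum>v\<in>V. ?\<phi> (ht x) (iota v c))"
      unfolding cell_d_def by (intro sum.cong HOL.refl) (simp only: g_gen[OF x] \<phi>[OF x])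
    also have "\<dots> = ?\<phi> (ht x) (bd c)" by (simp add: lin_sum[OF g(2)] sum_subtractf)
    finally show ?thesis .
  qed
  \<comment> \<open>At height i, closedness of \<open>g\<close> says by \<open>cell\<close> that the
    difference functional vanishes on boundaries.\<close>
  have "\<exists>\<psi>. lin \<psi> \<and> (\<forall>c. clique_chain E V q c \<longrightarrow> \<psi> (bd c) = ?\<phi> i c)" for i
  proof (rule cocycle_factors)
    show "lin (?\<phi> i)" by (intro lin_diff_fun g)
    show "?\<phi> i (bd c) = 0" if "clique_chain E V (Suc q) c" for c
      using closed[OF _ that, of "s [^] i"] cell[of "s [^] i" c] by (simp add: ht_int_pow)
  qed
  then obtain \<psi> where \<psi>: "\<And>i. lin (\<psi> i)" "\<And>i c. clique_chain E V q c \<Longrightarrow> \<psi> i (bd c) = ?\<phi> i c"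
    by metis
  \<comment> \<open>As a function of the height with successive differences \<open>\<psi> i\<close>,
    it has the coboundary \<open>\<psi>\<close> summed over all contractions, that is
    \<open>\<psi>\<close> composed with \<open>bd\<close>.\<close>
  define g' where "g' x c = antidiff (\<lambda>i. \<psi> i c) (ht x)" for x c
  have "invariant_on g'" by (auto simp: invariant_on_def g'_def fun_eq_iff Ker_def ht_mult)
  moreover have "lin (g' x)" for x
    unfolding g'_def[abs_def] antidiff_def by (intro lin_diff_fun lin_sum_fun \<psi>)
  moreover have "g (s \<otimes> x) c - g x c = cell_d g' x c" if x: "x \<in> carrier G" and c: "clique_chain E V q c" for x c
  proof -
    have "cell_d g' x c = (\<Sum>v\<in>V. \<psi> (ht x) (iota v c))"
      unfolding cell_d_def g'_def
      using x gen_closed ht_gen by (intro sum.cong HOL.refl) (simp add: ht_mult antidiff_step)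
    also have "\<dots> = ?\<phi> (ht x) c" by (simp add: lin_sum[OF \<psi>(1), symmetric] \<psi>(2)[OF c])
    finally show ?thesis using \<phi>[OF x] by simp
  qed
  ultimately show ?thesis by blast
qed

section \<open>The double complex of bar simplices and cubes\<close>

definition bicochain :: "('a, 'v, 'k) bicochain \<Rightarrow> bool" where
  "bicochain \<Phi> \<longleftrightarrow> (\<forall>gs x. lin (\<Phi> gs x)) \<and>
    (\<forall>b\<in>Ker. \<forall>gs\<in>lists (carrier G). \<forall>x\<in>carrier G. \<Phi> (trans b gs) (b \<otimes> x) = \<Phi> gs x)"

lemma bicochainD:
  assumes "bicochain \<Phi>"
  shows "lin (\<Phi> gs x)"
    and "b \<in> Ker \<Longrightarrow> gs \<in> lists (carrier G) \<Longrightarrow> x \<in> carrier G \<Longrightarrow> \<Phi> (trans b gs) (b \<otimes> x) = \<Phi> gs x"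
  using assms unfolding bicochain_def by blast+

definition bar_d :: "('a, 'v, 'k) bicochain \<Rightarrow> ('a, 'v, 'k) bicochain" where
  "bar_d \<Phi> gs x c = hbd (\<lambda>ys. \<Phi> ys x c) gs"

definition shift_d :: "('a, 'v, 'k) bicochain \<Rightarrow> ('a, 'v, 'k) bicochain" where
  "shift_d \<Phi> gs x c = \<Phi> (trans s gs) (s \<otimes> x) c - \<Phi> gs x c"

text \<open>The base vertex of the cube serves as cone point. It moves with the cube under
  \<open>Ker\<close>, so invariance is preserved, which a fixed cone point would not achieve; but
  \<open>cone\<close> does not commute with \<open>cell_d\<close>, and this defect is what the
  staircase follows.\<close>

definition cone :: "('a, 'v, 'k) bicochain \<Rightarrow> ('a, 'v, 'k) bicochain" where
  "cone \<Phi> gs x c = \<Phi> (x # gs) x c"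

lemma bicochain_bar_d:
  assumes "bicochain \<Phi>" shows "bicochain (bar_d \<Phi>)"
  unfolding bicochain_def
proof (intro conjI allI ballI)
  show "lin (bar_d \<Phi> gs x)" for gs x
    unfolding bar_d_def[abs_def] by (intro lin_hbd bicochainD(1)[OF assms])
  fix b gs x assume *: "b \<in> Ker" "gs \<in> lists (carrier G)" "x \<in> carrier G"
  show "bar_d \<Phi> (trans b gs) (b \<otimes> x) = bar_d \<Phi> gs x"
    unfolding bar_d_def[abs_def] hbd_map
    by (rule ext, rule hbd_cong[OF *(2)]) (simp only: bicochainD(2)[OF assms *(1) _ *(3)])
qed

lemma bicochain_cell_d:
  assumes "bicochain \<Phi>" shows "bicochain (\<lambda>gs. cell_d (\<Phi> gs))"
  unfolding bicochain_def
proof (intro conjI allI ballI)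
  show "lin (cell_d (\<Phi> gs) x)" for gs x by (intro lin_cell_d bicochainD(1)[OF assms])
  fix b gs x assume *: "b \<in> Ker" "gs \<in> lists (carrier G)" "x \<in> carrier G"
  have b: "b \<in> carrier G" using *(1) Ker_subset by blast
  have "\<Phi> (trans b gs) (b \<otimes> x \<otimes> gen v) = \<Phi> gs (x \<otimes> gen v)" if "v \<in> V" for v
    using bicochainD(2)[OF assms *(1,2), of "x \<otimes> gen v"] *(3) b gen_closed[OF that] by (simp add: m_assoc)
  then show "cell_d (\<Phi> (trans b gs)) (b \<otimes> x) = cell_d (\<Phi> gs) x"
    unfolding cell_d_def[abs_def] by (intro ext sum.cong HOL.refl) (simp add: bicochainD(2)[OF assms *])
qed

lemma bicochain_cone:
  assumes "bicochain \<Phi>" shows "bicochain (cone \<Phi>)"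
  unfolding bicochain_def
proof (intro conjI allI ballI)
  show "lin (cone \<Phi> gs x)" for gs x
    unfolding cone_def[abs_def] by (rule bicochainD(1)[OF assms])
  fix b gs x assume *: "b \<in> Ker" "gs \<in> lists (carrier G)" "x \<in> carrier G"
  show "cone \<Phi> (trans b gs) (b \<otimes> x) = cone \<Phi> gs x"
    using bicochainD(2)[OF assms *(1), of "x # gs" x] * by (simp add: cone_def[abs_def])
qed

text \<open>\<open>Ker\<close> is normal: moving \<open>b\<close> past \<open>s\<close> replaces it
  by its conjugate, which has height 0 again.\<close>

lemma bicochain_shift_d:
  assumes "bicochain \<Phi>" shows "bicochain (shift_d \<Phi>)"
  unfolding bicochain_def
proof (intro conjI allI ballI)
  show "lin (shift_d \<Phi> gs x)" for gs x
    unfolding shift_d_def[abs_def] by (intro lin_diff_fun bicochainD(1)[OF assms])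
  fix b gs x assume *: "b \<in> Ker" "gs \<in> lists (carrier G)" "x \<in> carrier G"
  let ?b = "s \<otimes> b \<otimes> inv s"
  have b: "b \<in> carrier G" using *(1) Ker_subset by blast
  have b': "?b \<in> Ker" using * by (simp add: Ker_def ht_mult ht_inv)
  have sb: "s \<otimes> b = ?b \<otimes> s" using b by (simp add: m_assoc)
  have "trans s (trans b gs) = trans ?b (trans s gs)"
    using *(2) b sb by (simp add: trans_trans del: map_map)
  moreover have "s \<otimes> (b \<otimes> x) = ?b \<otimes> (s \<otimes> x)"
    using *(3) b by (simp add: m_assoc inv_mult_mult)
  ultimately have "\<Phi> (trans s (trans b gs)) (s \<otimes> (b \<otimes> x)) = \<Phi> (trans s gs) (s \<otimes> x)"
    using bicochainD(2)[OF assms b', of "trans s gs" "s \<otimes> x"] * by (simp del: map_map)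
  then show "shift_d \<Phi> (trans b gs) (b \<otimes> x) = shift_d \<Phi> gs x"
    unfolding shift_d_def[abs_def] bicochainD(2)[OF assms *] by simp
qed

lemma bicochain_diff:
  assumes "bicochain \<Phi>" "bicochain \<Psi>" shows "bicochain (\<lambda>gs x c. \<Phi> gs x c - \<Psi> gs x c)"
  using assms unfolding bicochain_def by (auto intro: lin_diff_fun)

lemma cell_bar_commute: "cell_d (bar_d \<Phi> gs) x c = hbd (\<lambda>ys. cell_d (\<Phi> ys) x c) gs"
  unfolding cell_d_def bar_d_def hbd_sum hbd_diff ..

lemma bar_cone: "bar_d (cone \<Phi>) gs x c = \<Phi> gs x c - bar_d \<Phi> (x # gs) x c"
  by (simp add: bar_d_def cone_def hbd_Cons)

lemma bar_shift: "hbd (\<lambda>ys. shift_d \<Phi> ys x c) gs = shift_d (bar_d \<Phi>) gs x c"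
  unfolding shift_d_def bar_d_def hbd_map hbd_diff ..

lemma cell_shift:
  assumes "x \<in> carrier G"
  shows "cell_d (shift_d \<Phi> gs) x c = shift_d (\<lambda>gs. cell_d (\<Phi> gs)) gs x c"
  unfolding cell_d_def shift_d_def using assms gen_closed
  by (simp add: m_assoc sum_subtractf[symmetric] algebra_simps)

text \<open>\<open>cell_exact\<close> solves the problem for each list separately, but the solutions
  must fit together under \<open>Ker\<close>. Translating by the inverse of the first entry gives a
  normalised problem \<open>N gs\<close> that is the same for all \<open>Ker\<close>-translates of
  \<open>gs\<close>; one solution is chosen for each normalised problem and translated back.\<close>

lemma column_exact:
  assumes \<Phi>: "bicochain \<Phi>"
    and closed: "\<And>gs x c. gs \<in> lists (carrier G) \<Longrightarrow> length gs = Suc p \<Longrightarrow> x \<in> carrier G \<Longrightarrow>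
      clique_chain E V (Suc (Suc q)) c \<Longrightarrow> cell_d (\<Phi> gs) x c = 0"
  shows "\<exists>\<Theta>. bicochain \<Theta> \<and> (\<forall>gs\<in>lists (carrier G). length gs = Suc p \<longrightarrow> (\<forall>x\<in>carrier G.
    \<forall>c. clique_chain E V (Suc q) c \<longrightarrow> cell_d (\<Theta> gs) x c = \<Phi> gs x c))"
proof -
  define solves where "solves F D \<longleftrightarrow> (\<forall>x. lin (D x)) \<and>
    (\<forall>x\<in>carrier G. \<forall>c. clique_chain E V (Suc q) c \<longrightarrow> cell_d D x c = F x c)"
    for F D :: "'a \<Rightarrow> ('v list \<Rightarrow> 'k) \<Rightarrow> 'k"
  \<comment> \<open>The choice below sees \<open>N gs\<close> as a whole function. Setting it to 0
    off the carrier makes the functions for translated lists literally equal.\<close>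
  define N where "N gs x = (if x \<in> carrier G then \<Phi> gs (hd gs \<otimes> x) else (\<lambda>_. 0))" for gs x
  let ?good = "\<lambda>gs. gs \<in> lists (carrier G) \<and> length gs = Suc p"
  define \<Theta> where "\<Theta> gs x = (if ?good gs then (SOME D. solves (N gs) D) (inv (hd gs) \<otimes> x) else (\<lambda>_. 0))" for gs x
  have hd: "hd gs \<in> carrier G" if "?good gs" for gs using that by (cases gs) auto
  have D: "solves (N gs) (SOME D. solves (N gs) D)" if gs: "?good gs" for gs
  proof -
    have "\<exists>D. solves (N gs) D"
      unfolding solves_def
    proof (rule cell_exact)
      show "lin (N gs x)" for x
        unfolding N_def by (simp add: bicochainD(1)[OF \<Phi>] lin_zero_fun)
      fix x and c :: "'v list \<Rightarrow> 'k"
      assume x: "x \<in> carrier G" and c: "clique_chain E V (Suc (Suc q)) c"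
      have "cell_d (N gs) x c = cell_d (\<Phi> gs) (hd gs \<otimes> x) c"
        unfolding cell_d_def N_def using x gen_closed hd[OF gs] by (intro sum.cong HOL.refl) (simp add: m_assoc)
      also have "\<dots> = 0" using gs hd[OF gs] x c by (intro closed) auto
      finally show "cell_d (N gs) x c = 0" .
    qed simp
    then show ?thesis by (rule someI_ex)
  qed
  have "bicochain \<Theta>"
    unfolding bicochain_def
  proof (intro conjI allI ballI)
    show "lin (\<Theta> gs x)" for gs x
      using D[of gs] unfolding \<Theta>_def solves_def by (simp add: lin_zero_fun)
    fix b gs x assume *: "b \<in> Ker" "gs \<in> lists (carrier G)" "x \<in> carrier G"
    have b: "b \<in> carrier G" using *(1) Ker_subset by blast
    show "\<Theta> (trans b gs) (b \<otimes> x) = \<Theta> gs x"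
    proof (cases "length gs = Suc p")
      case True
      then have g: "?good gs" "?good (trans b gs)" using * b by simp_all
      have h: "hd (trans b gs) = b \<otimes> hd gs" using True by (cases gs) simp_all
      have "N (trans b gs) = N gs"
        unfolding N_def h using bicochainD(2)[OF \<Phi> *(1,2)] b hd[OF g(1)]
        by (intro ext) (simp add: m_assoc)
      moreover have "inv (b \<otimes> hd gs) \<otimes> (b \<otimes> x) = inv (hd gs) \<otimes> x"
        using b hd[OF g(1)] *(3) by (simp add: inv_mult_group m_assoc inv_mult_mult)
      ultimately show ?thesis using g unfolding \<Theta>_def by (simp only: h if_True)
    qed (simp add: \<Theta>_def)
  qed
  moreover have "cell_d (\<Theta> gs) x c = \<Phi> gs x c"
    if gs: "?good gs" and x: "x \<in> carrier G" and c: "clique_chain E V (Suc q) c" for gs x c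
  proof -
    let ?D = "SOME D. solves (N gs) D" and ?y = "inv (hd gs) \<otimes> x"
    have y: "?y \<in> carrier G" using hd[OF gs] x by simp
    have "cell_d (\<Theta> gs) x c = cell_d ?D ?y c"
      unfolding cell_d_def \<Theta>_def using gs x gen_closed hd[OF gs] by (intro sum.cong HOL.refl) (simp add: m_assoc)
    also have "\<dots> = N gs ?y c" using D[OF gs] y c unfolding solves_def by blast
    also have "\<dots> = \<Phi> gs x c" unfolding N_def using y x hd[OF gs] by (simp add: mult_inv_mult)
    finally show ?thesis .
  qed
  ultimately show ?thesis by (intro exI[of _ \<Theta>]) blast
qed

text \<open>Climbing the staircase: a cocycle of bidegree \<open>(p, q)\<close> is the bar coboundary of its cone, whose
  cellular coboundary is a cocycle of bidegree \<open>(p - 1, q + 1)\<close>. At the end one is left with an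
  invariant cellular cocycle.\<close>

definition bicocycle :: "nat \<Rightarrow> nat \<Rightarrow> ('a, 'v, 'k) bicochain \<Rightarrow> bool" where
  "bicocycle p q \<Phi> \<longleftrightarrow> bicochain \<Phi> \<and>
    (\<forall>gs\<in>lists (carrier G). length gs = Suc (Suc p) \<longrightarrow> (\<forall>x\<in>carrier G. \<forall>c. clique_chain E V q c \<longrightarrow>
      bar_d \<Phi> gs x c = 0)) \<and>
    (\<forall>gs\<in>lists (carrier G). length gs = Suc p \<longrightarrow> (\<forall>x\<in>carrier G. \<forall>c. clique_chain E V (Suc q) c \<longrightarrow>
      cell_d (\<Phi> gs) x c = 0))"

lemma bicocycleD:
  assumes "bicocycle p q \<Phi>"
  shows "bicochain \<Phi>"
    and "gs \<in> lists (carrier G) \<Longrightarrow> length gs = Suc (Suc p) \<Longrightarrow> x \<in> carrier G \<Longrightarrow> clique_chain E V q c \<Longrightarrow>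
      bar_d \<Phi> gs x c = 0"
    and "gs \<in> lists (carrier G) \<Longrightarrow> length gs = Suc p \<Longrightarrow> x \<in> carrier G \<Longrightarrow> clique_chain E V (Suc q) c \<Longrightarrow>
      cell_d (\<Phi> gs) x c = 0"
  using assms unfolding bicocycle_def by simp_all

lemma cone_step:
  assumes \<Phi>: "bicocycle p q \<Phi>"
    and gs: "gs \<in> lists (carrier G)" "length gs = Suc p" and x: "x \<in> carrier G"
  shows "clique_chain E V q c \<Longrightarrow> bar_d (cone \<Phi>) gs x c = \<Phi> gs x c"
    and "clique_chain E V (Suc q) c \<Longrightarrow> bar_d (\<lambda>gs. cell_d (cone \<Phi> gs)) gs x c = 0"
proof -
  have cone: "bar_d (cone \<Phi>) gs x c = \<Phi> gs x c" if "x \<in> carrier G" "clique_chain E V q c" for x c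
    unfolding bar_cone using bicocycleD(2)[OF \<Phi>, of "x # gs" x c] gs that by simp
  then show "clique_chain E V q c \<Longrightarrow> bar_d (cone \<Phi>) gs x c = \<Phi> gs x c" using x by blast
  assume c: "clique_chain E V (Suc q) c"
  have "bar_d (\<lambda>gs. cell_d (cone \<Phi> gs)) gs x c = cell_d (bar_d (cone \<Phi>) gs) x c"
    by (simp add: cell_bar_commute bar_d_def)
  also have "\<dots> = cell_d (\<Phi> gs) x c" by (rule cell_d_cong[OF x c]) (rule cone)
  finally show "bar_d (\<lambda>gs. cell_d (cone \<Phi> gs)) gs x c = 0" using bicocycleD(3)[OF \<Phi> gs x c] by simp
qed

text \<open>The last clause replaces \<open>column_exact\<close>, which is not available on the empty list.\<close>

definition residue_of :: "('a, 'v, 'k) bicochain \<Rightarrow> nat \<Rightarrow> nat \<Rightarrow> ('a, 'v, 'k) bicochain \<Rightarrow> bool" where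
  "residue_of \<Phi> p q R \<longleftrightarrow> bicochain R \<and>
    (\<forall>gs\<in>lists (carrier G). length gs = p \<longrightarrow> (\<forall>x\<in>carrier G. \<forall>c. clique_chain E V (Suc q) c \<longrightarrow>
      cell_d (R gs) x c = 0)) \<and>
    (\<forall>gs\<in>lists (carrier G). length gs = Suc p \<longrightarrow> (\<forall>x\<in>carrier G. \<forall>c. clique_chain E V q c \<longrightarrow>
      shift_d \<Phi> gs x c = bar_d R gs x c)) \<and>
    (p = 0 \<longrightarrow> (\<exists>e. bicochain e \<and> (\<forall>x\<in>carrier G. \<forall>c. clique_chain E V q c \<longrightarrow>
      R [] x c = cell_d (e []) x c)))"

lemma residue_ofD:
  assumes "residue_of \<Phi> p q R"
  shows "bicochain R"
    and "gs \<in> lists (carrier G) \<Longrightarrow> length gs = p \<Longrightarrow> x \<in> carrier G \<Longrightarrow> clique_chain E V (Suc q) c \<Longrightarrow>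
      cell_d (R gs) x c = 0"
    and "gs \<in> lists (carrier G) \<Longrightarrow> length gs = Suc p \<Longrightarrow> x \<in> carrier G \<Longrightarrow> clique_chain E V q c \<Longrightarrow>
      shift_d \<Phi> gs x c = bar_d R gs x c"
    and "p = 0 \<Longrightarrow> \<exists>e. bicochain e \<and> (\<forall>x\<in>carrier G. \<forall>c. clique_chain E V q c \<longrightarrow>
      R [] x c = cell_d (e []) x c)"
  using assms unfolding residue_of_def by simp_all

text \<open>For \<open>C = cone \<Phi>\<close> and a residue \<open>R\<close> of its cellular
  coboundary, the cellular coboundary of \<open>shift_d C\<close> is \<open>bar_d R\<close>. If
  \<open>e\<close> has the cellular coboundary \<open>R\<close>, then subtracting
  \<open>bar_d e\<close> makes \<open>shift_d C\<close> closed in the cellular direction without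
  changing its bar coboundary, which is \<open>shift_d \<Phi>\<close>. At \<open>p = 0\<close> the
  cone on the empty list is an invariant cellular cocycle, and \<open>invariant_monodromy\<close>
  applies.\<close>

lemma staircase: "bicocycle p q \<Phi> \<Longrightarrow> \<exists>R. residue_of \<Phi> p q R"
proof (induction p arbitrary: \<Phi> q)
  case 0
  note \<Phi> = bicocycleD(1)[OF 0] and step = cone_step[OF 0]
  note cone = bicochain_cone[OF \<Phi>]
  have inv: "invariant_on (cone \<Phi> [])"
    using bicochainD(2)[OF cone, of _ "[]"] unfolding invariant_on_def by simp
  have closed: "cell_d (cone \<Phi> []) x c = 0" if x: "x \<in> carrier G" and c: "clique_chain E V (Suc q) c" for x c
  proof -
    \<comment> \<open>On a list with one entry \<open>bar_d\<close> is evaluation at the empty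
      list.\<close>
    have "bar_d (\<lambda>gs. cell_d (cone \<Phi> gs)) [\<one>] x c = 0" by (rule step(2)[OF _ _ x c]) simp_all
    then show ?thesis unfolding bar_d_def hbd_Cons by simp
  qed
  have "\<exists>g. invariant_on g \<and> (\<forall>x. lin (g x)) \<and> (\<forall>x\<in>carrier G. \<forall>c. clique_chain E V q c \<longrightarrow>
      cone \<Phi> [] (s \<otimes> x) c - cone \<Phi> [] x c = cell_d g x c)"
    by (rule invariant_monodromy[OF inv bicochainD(1)[OF cone]]) (rule closed)
  then obtain g where g: "invariant_on g" "\<And>x. lin (g x)"
    and eq: "\<And>x c. x \<in> carrier G \<Longrightarrow> clique_chain E V q c \<Longrightarrow>
      cone \<Phi> [] (s \<otimes> x) c - cone \<Phi> [] x c = cell_d g x c" by blast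
  have e: "bicochain (\<lambda>_. g)" using g unfolding bicochain_def invariant_on_def by blast
  have R: "bicochain (\<lambda>_. cell_d g)" using bicochain_cell_d[OF e] .
  have "shift_d \<Phi> gs x c = bar_d (\<lambda>_. cell_d g) gs x c"
    if gs: "gs \<in> lists (carrier G)" "length gs = Suc 0" and x: "x \<in> carrier G" and c: "clique_chain E V q c" for gs x c
  proof -
    have cone_eq: "bar_d (cone \<Phi>) hs y c = \<Phi> hs y c"
      if "hs \<in> lists (carrier G)" "length hs = Suc 0" "y \<in> carrier G" for hs y
      using step(1)[OF that c] .
    have "shift_d \<Phi> gs x c = shift_d (bar_d (cone \<Phi>)) gs x c"
      unfolding shift_d_def using gs x by (simp add: cone_eq)
    also have "\<dots> = hbd (\<lambda>ys. shift_d (cone \<Phi>) ys x c) gs" by (rule bar_shift[symmetric])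
    also have "\<dots> = bar_d (\<lambda>_. cell_d g) gs x c"
      unfolding bar_d_def using gs(2) eq[OF x c]
      by (intro hbd_cong[OF gs(1)]) (simp add: shift_d_def)
    finally show ?thesis .
  qed
  moreover have "cell_d (cell_d g) x c = 0" if "x \<in> carrier G" "clique_chain E V (Suc q) c" for x c
    by (rule cell_d_cell_d[OF g(2) that])
  ultimately show ?case
    using R e unfolding residue_of_def
    by (intro exI[of _ "\<lambda>_. cell_d g"] conjI impI exI[of _ "\<lambda>_. g"]) simp_all
next
  case (Suc p)
  note \<Phi> = bicocycleD(1)[OF Suc.prems] and step = cone_step[OF Suc.prems]
  note cone = bicochain_cone[OF \<Phi>]
  let ?\<Phi>' = "\<lambda>gs. cell_d (cone \<Phi> gs)"
  have \<Phi>': "bicochain ?\<Phi>'" by (rule bicochain_cell_d[OF cone])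
  have "cell_d (?\<Phi>' gs) x c = 0" if "x \<in> carrier G" "clique_chain E V (Suc (Suc q)) c" for gs x c
    by (rule cell_d_cell_d[OF bicochainD(1)[OF cone] that])
  then have "bicocycle p (Suc q) ?\<Phi>'"
    unfolding bicocycle_def using \<Phi>' step(2) by simp
  then obtain R where res: "residue_of ?\<Phi>' p (Suc q) R" using Suc.IH by blast
  note R = residue_ofD(1)[OF res] and R_closed = residue_ofD(2)[OF res]
    and R_eq = residue_ofD(3)[OF res] and R_0 = residue_ofD(4)[OF res]
  have "\<exists>e. bicochain e \<and> (\<forall>gs\<in>lists (carrier G). length gs = p \<longrightarrow> (\<forall>x\<in>carrier G.
      \<forall>c. clique_chain E V (Suc q) c \<longrightarrow> cell_d (e gs) x c = R gs x c))"
  proof (cases p)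
    case 0
    then show ?thesis using R_0 by fastforce
  next
    case (Suc p')
    show ?thesis using column_exact[OF R R_closed, of p'] unfolding Suc by blast
  qed
  then obtain e where e: "bicochain e"
    and e_eq: "\<And>gs x c. gs \<in> lists (carrier G) \<Longrightarrow> length gs = p \<Longrightarrow> x \<in> carrier G \<Longrightarrow>
      clique_chain E V (Suc q) c \<Longrightarrow> cell_d (e gs) x c = R gs x c"
    by blast
  let ?R = "\<lambda>gs x c. shift_d (cone \<Phi>) gs x c - bar_d e gs x c"
  have "bicochain ?R" by (intro bicochain_diff bicochain_shift_d bicochain_bar_d cone e)
  moreover have "cell_d (?R gs) x c = 0"
    if gs: "gs \<in> lists (carrier G)" "length gs = Suc p" and x: "x \<in> carrier G" and c: "clique_chain E V (Suc q) c" for gs x c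
  proof -
    have "cell_d (bar_d e gs) x c = hbd (\<lambda>ys. cell_d (e ys) x c) gs" by (rule cell_bar_commute)
    also have "\<dots> = bar_d R gs x c"
      unfolding bar_d_def using gs(2) by (intro hbd_cong[OF gs(1)]) (simp add: e_eq x c)
    also have "\<dots> = shift_d ?\<Phi>' gs x c" using R_eq[OF gs x c] ..
    also have "\<dots> = cell_d (shift_d (cone \<Phi>) gs) x c" by (rule cell_shift[OF x, symmetric])
    finally show ?thesis unfolding cell_d_diff by simp
  qed
  moreover have "shift_d \<Phi> gs x c = bar_d ?R gs x c"
    if gs: "gs \<in> lists (carrier G)" "length gs = Suc (Suc p)" and x: "x \<in> carrier G" and c: "clique_chain E V q c" for gs x c
  proof -
    have cone_eq: "bar_d (cone \<Phi>) hs y c = \<Phi> hs y c"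
      if "hs \<in> lists (carrier G)" "length hs = Suc (Suc p)" "y \<in> carrier G" for hs y
      using step(1)[OF that c] .
    have "shift_d \<Phi> gs x c = shift_d (bar_d (cone \<Phi>)) gs x c"
      unfolding shift_d_def using gs x by (simp add: cone_eq)
    also have "\<dots> = hbd (\<lambda>ys. shift_d (cone \<Phi>) ys x c) gs" by (rule bar_shift[symmetric])
    also have "\<dots> = bar_d ?R gs x c" unfolding bar_d_def hbd_diff by simp
    finally show ?thesis .
  qed
  ultimately show ?case unfolding residue_of_def by (intro exI[of _ ?R]) simp
qed

theorem trivial_monodromy_acyclic: "trivial_monodromy k"
  unfolding trivial_monodromy_def
proof (intro allI impI)
  fix n and f :: "'a list \<Rightarrow> 'k" assume f: "ker_inv f" "closed_in n f"
  define \<delta> :: "'v list \<Rightarrow> 'k" where "\<delta> xs = (if xs = [] then 1 else 0)" for xs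
  have \<delta>: "clique_chain E V 0 \<delta>" by (simp add: clique_chain_0 \<delta>_def)
  \<comment> \<open>The cochain \<open>f\<close> enters the double complex as a function that is
    constant on the vertices of the cube complex; \<open>c []\<close> is the coefficient of the
    empty clique.\<close>
  define \<Phi> :: "('a, 'v, 'k) bicochain" where "\<Phi> gs x c = f gs * c []" for gs x c
  have bi: "bicochain \<Phi>"
    using f(1) unfolding bicochain_def \<Phi>_def[abs_def] ker_inv_def by (simp add: lin_eval)
  have bar: "bar_d \<Phi> gs x c = 0" if "gs \<in> lists (carrier G)" "length gs = Suc (Suc n)" for gs x c
  proof -
    have "bar_d \<Phi> gs x c = c [] * hbd f gs" 
      unfolding bar_d_def \<Phi>_def hbd_scale[symmetric] by (simp only: mult.commute)
    then show ?thesis using f(2) that unfolding closed_in_def by simp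
  qed
  have cell: "cell_d (\<Phi> gs) x c = 0" for gs x c by (simp add: cell_d_def \<Phi>_def)
  have "bicocycle n 0 \<Phi>" unfolding bicocycle_def using bi bar cell by simp
  from staircase[OF this] obtain R where res: "residue_of \<Phi> n 0 R" by blast
  note R = residue_ofD(1)[OF res] and R_closed = residue_ofD(2)[OF res]
    and R_eq = residue_ofD(3)[OF res] and R_0 = residue_ofD(4)[OF res]
  \<comment> \<open>Being closed in the cellular direction, \<open>R gs\<close> is constant along
    the edges \<open>wedge v \<delta>\<close>, and the cube complex is connected by
    \<open>gen_invariant\<close>.\<close>
  have const: "R gs x \<delta> = R gs \<one> \<delta>" if gs: "gs \<in> lists (carrier G)" "length gs = n" and x: "x \<in> carrier G" for gs x
  proof (rule gen_invariant[where H = "\<lambda>x. R gs x \<delta>", OF _ x])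
    fix y v assume y: "y \<in> carrier G" and v: "v \<in> V"
    have "clique_chain E V (Suc 0) (wedge v \<delta>)"
      by (rule clique_chain_wedge[where L = "{}"]) (use v in \<open>simp_all add: clique_chain_0 \<delta>_def\<close>)
    then have "0 = cell_d (R gs) y (wedge v \<delta>)" using R_closed[OF gs y] by simp
    also have "\<dots> = R gs (y \<otimes> gen v) \<delta> - R gs y \<delta>"
      unfolding cell_d_wedge[OF bicochainD(1)[OF R] v]
      by (simp add: \<delta>_def wedge_zero[THEN ext] lin_zero[OF bicochainD(1)[OF R]])
    finally show "R gs (y \<otimes> gen v) \<delta> = R gs y \<delta>" by simp
  qed
  define K where "K gs = (if gs \<in> lists (carrier G) \<and> length gs = n then R gs \<one> \<delta> else 0)" for gs
  have "ker_inv K"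
    unfolding ker_inv_def
  proof (intro ballI)
    fix b gs assume b: "b \<in> Ker" and gs: "gs \<in> lists (carrier G)"
    have bG: "b \<in> carrier G" using b Ker_subset by blast
    show "K (trans b gs) = K gs"
    proof (cases "length gs = n")
      case True
      \<comment> \<open>Constancy in the cube variable turns the diagonal invariance of
        \<open>R\<close> into invariance in the list alone.\<close>
      have "R (trans b gs) \<one> \<delta> = R (trans b gs) b \<delta>"
        using const[of "trans b gs" b] gs bG True by simp
      also have "\<dots> = R gs \<one> \<delta>" using bicochainD(2)[OF R b gs one_closed] bG by simp
      finally show ?thesis using gs bG by (simp add: K_def)
    qed (simp add: K_def)
  qed
  moreover have "K [] = 0"
  proof (cases "n = 0")
    case True
    obtain e where e: "bicochain e" and eq: "R [] \<one> \<delta> = cell_d (e []) \<one> \<delta>"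
      using R_0[OF True] \<delta> by blast
    \<comment> \<open>All contractions of the empty clique vanish, so a cellular coboundary is zero
      on \<open>\<delta>\<close>.\<close>
    have "cell_d (e []) \<one> \<delta> = 0" by (simp add: cell_d_def \<delta>_def lin_zero[OF bicochainD(1)[OF e]])
    then show ?thesis using eq by (simp add: K_def)
  qed (simp add: K_def)
  moreover have "f (trans s gs) - f gs = hbd K gs" if gs: "gs \<in> lists (carrier G)" "length gs = Suc n" for gs
  proof -
    have "f (trans s gs) - f gs = shift_d \<Phi> gs \<one> \<delta>" by (simp add: shift_d_def \<Phi>_def \<delta>_def)
    also have "\<dots> = bar_d R gs \<one> \<delta>" by (rule R_eq[OF gs one_closed \<delta>])
    also have "\<dots> = hbd K gs"
      unfolding bar_d_def using gs(2) by (intro hbd_cong[OF gs(1)]) (simp add: K_def)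
    finally show ?thesis .
  qed
  ultimately show "\<exists>K. ker_inv K \<and> K [] = 0 \<and>
      (\<forall>gs\<in>lists (carrier G). length gs = Suc n \<longrightarrow> f (trans s gs) - f gs = hbd K gs)" by blast
qed

end

theorem proposition0p3:
  fixes k :: "'k::field itself" and V :: "'a set" and E :: "'a set set"
  assumes "finite V" and "simplicial_graph V E"
    and "acyclic_over k (flag_complex V E)"
  shows "\<exists>\<phi>. \<phi> \<in> graded_algebra_iso
    (cohomology k (bestvina_brady V E))
    (graded_quotient (cohomology k (raag V E)) (Idl\<^bsub>cohomology k (raag V E)\<^esub> {chi_class k V E}))"
proof -
  let ?g = "\<lambda>v. raag_class V E [(v, True)]"
  interpret group "raag V E" by (rule group_raag)
  \<comment> \<open>A vertex is needed to serve as \<open>s\<close>. For empty \<open>V\<close> the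
    empty clique would be a reduced cycle, in dimension -1, that bounds nothing.\<close>
  have "V \<noteq> {}"
  proof
    assume V: "V = {}"
    have "clique_chain E V 0 (\<lambda>xs. if xs = [] then 1 else 0 :: 'k)" by (simp add: clique_chain_0)
    from acyclic_cycle_is_boundary[OF assms(1,3) this] V
    have "(\<lambda>xs :: 'a list. if xs = [] then 1 else 0) = (\<lambda>xs. 0 :: 'k)" by auto
    from fun_cong[OF this, of "[]"] show False by simp
  qed
  then obtain v0 where v0: "v0 \<in> V" by blast
  have g: "?g v \<in> carrier (raag V E)" if "v \<in> V" for v
    using that by (intro raag_class_closed) (simp add: words_simps)
  have ht: "length_char (?g v) = 1" if "v \<in> V" for v
    using length_char_vertex[OF that] by (simp add: raag_class_def)
  interpret acyclic_clique_group "raag V E" length_char "?g v0" V E ?g k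
  proof unfold_locales
    show "length_char (x \<otimes>\<^bsub>raag V E\<^esub> y) = length_char x + length_char y"
      if "x \<in> carrier (raag V E)" "y \<in> carrier (raag V E)" for x y
      using hom_mult[OF length_char_hom that] by (simp add: integer_group_def)
    show "v \<noteq> w" if "{v, w} \<in> E" for v w
      using that assms(2) by (auto simp: simplicial_graph_def nsets_def)
    show "\<exists>p. \<forall>x\<in>carrier (raag V E). \<forall>w\<in>W. p (x \<otimes>\<^bsub>raag V E\<^esub> ?g w) - p x = f w x"
      if "W \<subseteq> V" "\<And>u w x. u \<in> W \<Longrightarrow> w \<in> W \<Longrightarrow> {u, w} \<in> E \<Longrightarrow> x \<in> carrier (raag V E) \<Longrightarrow>
        f w (x \<otimes>\<^bsub>raag V E\<^esub> ?g u) - f w x = f u (x \<otimes>\<^bsub>raag V E\<^esub> ?g w) - f u x"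
      for W and f :: "'a \<Rightarrow> 'a word set \<Rightarrow> 'k"
      using that by (rule raag_potential)
    show "H x = H \<one>\<^bsub>raag V E\<^esub>"
      if "\<And>y v. y \<in> carrier (raag V E) \<Longrightarrow> v \<in> V \<Longrightarrow> H (y \<otimes>\<^bsub>raag V E\<^esub> ?g v) = H y"
        "x \<in> carrier (raag V E)" for H :: "'a word set \<Rightarrow> 'k" and x
      using that by (rule raag_gen_invariant)
    show "\<exists>d. clique_chain E V (Suc q) d \<and> c = (\<lambda>xs. \<Sum>v\<in>V. iota v d xs)"
      if "clique_chain E V q c" "(\<lambda>xs. \<Sum>v\<in>V. iota v c xs) = (\<lambda>_. 0 :: 'k)" for q c
      by (rule acyclic_cycle_is_boundary[OF assms(1,3) that])
    show "?g v \<otimes>\<^bsub>raag V E\<^esub> ?g w = ?g w \<otimes>\<^bsub>raag V E\<^esub> ?g v" if "v \<in> V" "w \<in> V" "{v, w} \<in> E" for v w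
      using that by (rule raag_gen_commute)
  qed (use assms(1) v0 g ht in auto)
  have "kernel (raag V E) integer_group length_char = Ker"
    by (simp add: kernel_def Ker_def integer_group_def)
  then show ?thesis
    using cohomology_kernel_iso[OF trivial_monodromy_acyclic]
    by (simp only: bestvina_brady_def chi_class_def)
qed

end
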